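(* Let $(r_n: n \in \mathbb{N})$ and $(s_n : n \in \mathbb{N})$ be cutting and spacer parameters giving rise to the symbolic rank-one system $(X, \mu, \sigma)$. Suppose the following hold. (a) For some $R$ and all $n$, $r_n \leq R$. (b) For some $S$ and all $n$ and all $0 < i< r_n$, $s_n(i) \leq S$. (c) For all $n$ and all $c \in \mathbb{N}$, there are only two occurrences of $s_n$ in $s_n{}^{\frown}(c)^{\frown} s_n$. (d) $(X, \mu, \sigma)$ is totally ergodic. Then $(X, \mu, \sigma)$ has minimal self-joinings of all orders.
   Context: $\mathbb{N}=\{0,1,2,\dots\}$. Words: finite sequences of natural numbers are called words; $\mathrm{lh}(s)$ is the length of $s=(s(1),\dots,s(\mathrm{lh}(s)))$, and ${}^{\frown}$ is concatenation. An occurrence of $t$ in $s$ is a position $k$ with $1\le k\le \mathrm{lh}(s)-\mathrm{lh}(t)+1$ such that $s(k+i-1)=t(i)$ for $1\le i\le \mathrm{lh}(t)$. Parameters: a cutting parameter is a sequence $(r_n:n\in\mathbb{N})$ of natural numbers with $r_n\ge 2$; a spacer parameter is a sequence $(s_n:n\in\mathbb{N})$ of finite sequences of natural numbers with $\mathrm{lh}(s_n)=r_n-1$. They define binary words $v_0=0$, $v_{n+1}=v_n1^{s_n(1)}v_n1^{s_n(2)}v_n\cdots v_n1^{s_n(r_n-1)}v_n$, and the infinite binary word $V=\lim_n v_n$ having every $v_n$ as initial segment. Let $X=X_V$ be the set of $x\in\{0,1\}^{\mathbb{Z}}$ all of whose finite subwords are subwords of $V$, with the shift $\sigma(x)(i)=x(i+1)$.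 Let $h_n=\mathrm{lh}(v_n)$. Standing assumptions: $\sum_{n}\frac{h_{n+1}-h_nr_n}{h_{n+1}}<+\infty$; and $V$ is non-degenerate, i.e. there is no finite binary word $v$ beginning and ending with $0$ and $a\in\mathbb{N}$ with $V=v1^{a}v1^{a}v\cdots$. The measure $\mu$ is the unique $\sigma$-invariant Borel probability measure on $X$; $(X,\mu,\sigma)$ is the symbolic rank-one system given by the parameters. Totally ergodic means $(X,\mu,\sigma^k)$ is ergodic for every $k\ge 1$. Minimal self-joinings of order $m\geq 2$ means: every ergodic $\sigma\times\cdots\times\sigma$-invariant probability measure on $X^m$ all of whose one-dimensional marginals are $\mu$ is, for some partition of the coordinates $\{1,\dots,m\}$, the product over the classes of the partition of off-diagonal measures, where an off-diagonal measure on a class of $p$ coordinates is the image of $\mu$ under $x\mapsto(\sigma^{k_1}x,\dots,\sigma^{k_p}x)$ for some $k_1,\dots,k_p\in\mathbb{Z}$. (For $m=2$: every ergodic self-joining is either $\mu\times\mu$ or off-diagonal.) Minimal self-joinings of all orders means this for all $m\ge 2$. *)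

theory Defs
  imports "HOL-Probability.Probability"
begin

text \<open>
  Words are lists of natural numbers. Lists are indexed from 0, so the paper's \<open>s(i)\<close> is
  \<open>s ! (i - 1)\<close>, and positions of occurrences are shifted down by one.
\<close>

definition occurrences :: "nat list \<Rightarrow> nat list \<Rightarrow> nat set" where
  "occurrences t s =
     {k. k + length t \<le> length s \<and> (\<forall>i<length t. s ! (k + i) = t ! i)}"

definition cutting_parameter :: "(nat \<Rightarrow> nat) \<Rightarrow> bool" where
  "cutting_parameter r \<longleftrightarrow> (\<forall>n. r n \<ge> 2)"

definition spacer_parameter :: "(nat \<Rightarrow> nat) \<Rightarrow> (nat \<Rightarrow> nat list) \<Rightarrow> bool" where
  "spacer_parameter r s \<longleftrightarrow> (\<forall>n. length (s n) = r n - 1)"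

text \<open>The cutting parameter is not an argument, since \<open>r n = length (s n) + 1\<close>.\<close>

primrec rank_one_block :: "(nat \<Rightarrow> nat list) \<Rightarrow> nat \<Rightarrow> nat list" where
  "rank_one_block s 0 = [0]"
| "rank_one_block s (Suc n) =
     concat (map (\<lambda>a. rank_one_block s n @ replicate a 1) (s n)) @ rank_one_block s n"

definition height :: "(nat \<Rightarrow> nat list) \<Rightarrow> nat \<Rightarrow> nat" where
  "height s n = length (rank_one_block s n)"

text \<open>
  The limit word. Its \<open>i\<close>-th letter can be read off from the \<open>i\<close>-th block, which has more
  than \<open>i\<close> letters; see \<open>rank_one_word_eq\<close> below.
\<close>

definition rank_one_word :: "(nat \<Rightarrow> nat list) \<Rightarrow> nat \<Rightarrow> nat" where
  "rank_one_word s i = rank_one_block s i ! i"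

lemma rank_one_block_prefix:
  assumes "cutting_parameter r" "spacer_parameter r s"
  shows "\<exists>w. length w \<ge> 1 \<and> rank_one_block s (Suc n) = rank_one_block s n @ w"
proof -
  have "length (s n) \<ge> 1"
    using assms unfolding cutting_parameter_def spacer_parameter_def
    by (metis add_diff_cancel_left' diff_le_mono nat_1_add_1)
  then obtain a t where st: "s n = a # t" by (cases "s n") auto
  have ne: "rank_one_block s m \<noteq> []" for m by (induction m) auto
  show ?thesis
    using ne by (simp add: st Suc_le_eq)
qed

lemma rank_one_block_prefix_add:
  assumes "cutting_parameter r" "spacer_parameter r s"
  shows "\<exists>w. length w \<ge> d \<and> rank_one_block s (n + d) = rank_one_block s n @ w"
proof (induction d)
  case 0 then show ?case by simp
next
  case (Suc d)
  then obtain w where w: "length w \<ge> d" "rank_one_block s (n + d) = rank_one_block s n @ w"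
    by blast
  from rank_one_block_prefix[OF assms, of "n + d"] obtain u where
    "length u \<ge> 1" "rank_one_block s (Suc (n + d)) = rank_one_block s (n + d) @ u" by blast
  with w show ?case by (intro exI[of _ "w @ u"]) auto
qed

lemma rank_one_word_eq:
  assumes "cutting_parameter r" "spacer_parameter r s" "i < height s n"
  shows "rank_one_word s i = rank_one_block s n ! i"
proof -
  have "i < length (rank_one_block s i)"
    using rank_one_block_prefix_add[OF assms(1,2), of i 0] by auto
  moreover from rank_one_block_prefix_add[OF assms(1,2)]
  obtain w1 w2 where "rank_one_block s (n + i) = rank_one_block s n @ w1"
    "rank_one_block s (i + n) = rank_one_block s i @ w2" by metis
  ultimately show ?thesis
    using assms(3) unfolding rank_one_word_def height_def
    by (metis add.commute nth_append)
qed

text \<open>The equation below says that \<open>V\<close> is the infinite concatenation of copies of \<open>v1\<^sup>a\<close>.\<close>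

definition degenerate :: "(nat \<Rightarrow> nat) \<Rightarrow> bool" where
  "degenerate V \<longleftrightarrow>
     (\<exists>v a. v \<noteq> [] \<and> set v \<subseteq> {0, 1} \<and> hd v = 0 \<and> last v = 0 \<and>
        (\<forall>i. V i = (v @ replicate a 1) ! (i mod (length v + a))))"

definition word_subshift :: "(nat \<Rightarrow> nat) \<Rightarrow> (int \<Rightarrow> nat) set" where
  "word_subshift V =
     {x. range x \<subseteq> {0, 1} \<and> (\<forall>i l. \<exists>k. \<forall>j<l. x (i + int j) = V (k + j))}"

definition shift :: "(int \<Rightarrow> nat) \<Rightarrow> int \<Rightarrow> nat" where
  "shift x = (\<lambda>i. x (i + 1))"

text \<open>Integer powers of the (invertible) shift.\<close>

definition shift_power :: "int \<Rightarrow> (int \<Rightarrow> nat) \<Rightarrow> int \<Rightarrow> nat" where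
  "shift_power k x = (\<lambda>i. x (i + k))"

lemma shift_power_of_nat: "shift_power (int n) = shift ^^ n"
  by (induction n) (auto simp: shift_power_def shift_def fun_eq_iff ac_simps)

lemma shift_power_neg: "shift_power (- int n) = inv (shift ^^ n)"
proof -
  have "bij (shift ^^ n)"
    unfolding shift_power_of_nat[symmetric]
    by (rule o_bij[of "shift_power (- int n)"]) (auto simp: shift_power_def fun_eq_iff)
  moreover have "(shift ^^ n) (shift_power (- int n) x) = x" for x
    unfolding shift_power_of_nat[symmetric] by (simp add: shift_power_def)
  ultimately show ?thesis
    by (metis bij_inv_eq_iff ext)
qed

definition invariant_measure :: "'a measure \<Rightarrow> ('a \<Rightarrow> 'a) \<Rightarrow> bool" where
  "invariant_measure M T \<longleftrightarrow> T \<in> measurable M M \<and> distr M M T = M"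

definition ergodic_system :: "'a measure \<Rightarrow> ('a \<Rightarrow> 'a) \<Rightarrow> bool" where
  "ergodic_system M T \<longleftrightarrow>
     prob_space M \<and> invariant_measure M T \<and>
     (\<forall>A\<in>sets M. T -` A \<inter> space M = A \<longrightarrow> measure M A = 0 \<or> measure M A = 1)"

definition totally_ergodic :: "'a measure \<Rightarrow> ('a \<Rightarrow> 'a) \<Rightarrow> bool" where
  "totally_ergodic M T \<longleftrightarrow> (\<forall>k\<ge>1. ergodic_system M (T ^^ k))"

text \<open>
  The topology on the type \<open>int \<Rightarrow> nat\<close> is the product of the discrete topologies, so
  \<open>restrict_space borel X\<close> carries the Borel sets of \<open>X\<close>.
\<close>

definition invariant_prob_on :: "(int \<Rightarrow> nat) set \<Rightarrow> (int \<Rightarrow> nat) measure \<Rightarrow> bool" where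
  "invariant_prob_on X M \<longleftrightarrow>
     sets M = sets (restrict_space borel X) \<and> prob_space M \<and> invariant_measure M shift"

definition unique_invariant_prob_on :: "(int \<Rightarrow> nat) set \<Rightarrow> (int \<Rightarrow> nat) measure \<Rightarrow> bool" where
  "unique_invariant_prob_on X M \<longleftrightarrow>
     invariant_prob_on X M \<and> (\<forall>N. invariant_prob_on X N \<longrightarrow> N = M)"

text \<open>
  Points of \<open>X\<^sup>I\<close> are functions that are \<open>undefined\<close> outside \<open>I\<close>, as in the library's \<open>PiM\<close>.
  Where \<open>PiM I (\<lambda>_. M)\<close> occurs below, it only serves to fix the product \<open>\<sigma>\<close>-algebra on \<open>X\<^sup>I\<close>.
\<close>

definition product_shift :: "nat set \<Rightarrow> (nat \<Rightarrow> int \<Rightarrow> nat) \<Rightarrow> nat \<Rightarrow> int \<Rightarrow> nat" where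
  "product_shift I x = (\<lambda>i\<in>I. shift (x i))"

definition ergodic_self_joining ::
    "(int \<Rightarrow> nat) measure \<Rightarrow> nat set \<Rightarrow> (nat \<Rightarrow> int \<Rightarrow> nat) measure \<Rightarrow> bool" where
  "ergodic_self_joining M I N \<longleftrightarrow>
     sets N = sets (PiM I (\<lambda>_. M)) \<and>
     ergodic_system N (product_shift I) \<and>
     (\<forall>i\<in>I. distr N M (\<lambda>x. x i) = M)"

definition off_diagonal ::
    "(int \<Rightarrow> nat) measure \<Rightarrow> nat set \<Rightarrow> (nat \<Rightarrow> int \<Rightarrow> nat) measure \<Rightarrow> bool" where
  "off_diagonal M C D \<longleftrightarrow>
     (\<exists>k :: nat \<Rightarrow> int. D = distr M (PiM C (\<lambda>_. M)) (\<lambda>x. \<lambda>i\<in>C. shift_power (k i) x))"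

text \<open>
  The product over the classes \<open>C \<in> P\<close> of measures \<open>D C\<close> on \<open>X\<^sup>C\<close>, transported along the
  identification of the product of the \<open>X\<^sup>C\<close> with \<open>X\<^sup>I\<close>, where \<open>P\<close> is a partition of \<open>I\<close>.
\<close>

definition class_product ::
    "(int \<Rightarrow> nat) measure \<Rightarrow> nat set \<Rightarrow> nat set set \<Rightarrow>
     (nat set \<Rightarrow> (nat \<Rightarrow> int \<Rightarrow> nat) measure) \<Rightarrow> (nat \<Rightarrow> int \<Rightarrow> nat) measure" where
  "class_product M I P D =
     distr (PiM P D) (PiM I (\<lambda>_. M)) (\<lambda>w. \<lambda>i\<in>I. w (THE C. C \<in> P \<and> i \<in> C) i)"

definition minimal_self_joinings :: "nat \<Rightarrow> (int \<Rightarrow> nat) measure \<Rightarrow> bool" where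
  "minimal_self_joinings m M \<longleftrightarrow>
     (\<forall>N. ergodic_self_joining M {1..m} N \<longrightarrow>
        (\<exists>P D. partition_on {1..m} P \<and> (\<forall>C\<in>P. off_diagonal M C (D C)) \<and>
           N = class_product M {1..m} P D))"

end

theory Submission
  imports Defs
begin

text \<open>
  Write \<open>v\<^sub>n\<close> for the block of level \<open>n\<close>, \<open>h\<^sub>n\<close> for its length and \<open>T\<close> for the shift. The condition on
  occurrences of \<open>s\<^sub>n\<close> makes the blocks recognizable: \<open>v\<^sub>n\<close> occurs in \<open>V\<close> only where \<open>V\<close> was built from a
  copy of \<open>v\<^sub>n\<close> (\<open>V_occurrence\<close>). So every point of \<open>X\<close> is, at each level \<open>n\<close>, in exactly one way a
  concatenation of copies of \<open>v\<^sub>n\<close> separated by gaps, and a gap consists of at most \<open>S\<close> ones.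

  The argument is the one used by del Junco, Rahe and Swanson for the transformation of Chacon. Take
  two points \<open>x\<close>, \<open>y\<close> of \<open>X\<close> and follow a block of \<open>x\<close> and a block of \<open>y\<close> of level \<open>n\<close> that overlap in
  about half of their length at least. While the gaps after the two blocks are equal, the offset of the
  blocks does not change; if they stay equal for a few multiples of \<open>h\<^sub>n\<^sub>+\<^sub>1\<close>, then a block of level
  \<open>n + 1\<close> in \<open>x\<close> is matched by a block of \<open>y\<close> at the same offset. Hence either \<open>x\<close> is a translate of \<open>y\<close>
  on a half-line, or for infinitely many \<open>n\<close> there are, at distance \<open>O(h\<^sub>n)\<close> from the origin, two
  overlapping blocks followed by gaps \<open>a \<noteq> b\<close> (\<open>gap_changes_or_asymptotic\<close>). In the second case the
  translation by \<open>h\<^sub>n + a\<close> coincides on the overlap with the identity on \<open>x\<close> and with the translation by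
  \<open>a - b\<close> on \<open>y\<close>, and on finitely many further points it coincides with bounded translations after the
  overlap has been shortened by a constant factor (\<open>common_recurrence\<close>). If the tuple of points is
  generic for an ergodic joining \<open>N\<close>, the overlap is long enough for the frequencies of visits in it to
  be those prescribed by \<open>N\<close>. Therefore \<open>N\<close> is invariant under translating the coordinates by integers
  \<open>b\<^sub>i\<close> that are different for the two chosen coordinates (\<open>joint_translation_invariance\<close>). In the first
  case ergodicity improves agreement on a half-line to agreement everywhere
  (\<open>forward_asymptotic_null_or_translate\<close>).

  Suppose that no coordinate of \<open>N\<close> is a translate of another one. Subtracting a constant from the
  \<open>b\<^sub>i\<close>, one may assume that they vanish on a nonempty set \<open>J\<close> of coordinates and nowhere on its
  nonempty complement \<open>K\<close>. By induction on the number of coordinates the marginals on \<open>J\<close> and on \<open>K\<close>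
  are product measures. Translating a box in the coordinates \<open>K\<close> does not change its joint
  probability with a box in the coordinates \<open>J\<close>, while weak mixing makes the translates of the former
  independent of each other on average, hence independent of any fixed event
  (\<open>independent_of_averaged_events\<close>). So \<open>N\<close> is a product measure (\<open>unrelated_joining_is_product\<close>). In
  general the coordinates fall into classes of translates of each other, and what was said applies to
  one representative of each class (\<open>product_of_off_diagonals\<close>).

  Weak mixing comes from total ergodicity. The word \<open>s\<^sub>n\<close> has two different entries \<open>b < a\<close>, which may be
  assumed to be the same for infinitely many \<open>n\<close>. Where a block is followed by a gap \<open>a\<close>, the
  translation by \<open>h\<^sub>n + a\<close> looks like the identity, and the set of these places has measure bounded from
  below and becomes independent of every fixed event (\<open>gap_middle_weak_limit\<close>); the same holds for \<open>b\<close>.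
  On the product of the two sets the translation of both coordinates by \<open>h\<^sub>n + a\<close> therefore looks like
  \<open>id \<times> T\<^sup>a\<^sup>-\<^sup>b\<close>. So a set invariant under \<open>T \<times> T\<close> is invariant under \<open>id \<times> T\<^sup>a\<^sup>-\<^sup>b\<close>, and since
  \<open>T\<^sup>a\<^sup>-\<^sup>b\<close> and \<open>T\<close> are ergodic it has measure 0 or 1 (\<open>ergodic_product\<close>).
\<close>


section \<open>Frequencies of visits in ergodic systems\<close>

definition visit_frequency :: "('a \<Rightarrow> 'a) \<Rightarrow> 'a set \<Rightarrow> nat \<Rightarrow> 'a \<Rightarrow> real" where
  "visit_frequency T A n x = (\<Sum>i<n. indicator A ((T ^^ i) x)) / real n"

lemma ergodic_systemD:
  assumes "ergodic_system N T"
  shows "prob_space N" "T \<in> measurable N N" "distr N N T = N"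
  using assms by (auto simp: ergodic_system_def invariant_measure_def)

lemma measurable_funpow:
  assumes "T \<in> measurable N N" shows "(T ^^ i) \<in> measurable N N"
  by (induction i) (use assms in \<open>auto simp: measurable_compose o_def\<close>)

lemma funpow_in_space:
  assumes "T \<in> measurable N N" "x \<in> space N" shows "(T ^^ i) x \<in> space N"
  using measurable_space[OF measurable_funpow[OF assms(1)] assms(2)] .

lemma distr_funpow:
  assumes "T \<in> measurable N N" "distr N N T = N" shows "distr N N (T ^^ i) = N"
proof (induction i)
  case 0
  then show ?case by (simp add: id_def distr_id)
next
  case (Suc i)
  have "distr N N (T ^^ Suc i) = distr (distr N N (T ^^ i)) N T"
    using assms measurable_funpow[OF assms(1)] by (subst distr_distr) (auto simp: o_def)
  then show ?case by (simp only: Suc assms(2))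
qed

lemma measure_preserving_vimage:
  assumes "T \<in> measurable N N" "distr N N T = N" "A \<in> sets N"
  shows "measure N ((T ^^ i) -` A \<inter> space N) = measure N A"
  using measure_distr[OF measurable_funpow[OF assms(1), of i] assms(3)]
    distr_funpow[OF assms(1,2), of i] by simp

lemma borel_measurable_visit_frequency:
  assumes "T \<in> measurable N N" "A \<in> sets N"
  shows "visit_frequency T A n \<in> borel_measurable N"
proof -
  have "(\<lambda>x. indicator A ((T ^^ i) x) :: real) \<in> borel_measurable N" for i
    using measurable_compose[OF measurable_funpow[OF assms(1), of i] borel_measurable_indicator[OF assms(2)]] .
  then show ?thesis unfolding visit_frequency_def by measurable
qed

lemma visit_frequency_bounds: "0 \<le> visit_frequency T A n x" "visit_frequency T A n x \<le> 1"
proof -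
  have "(\<Sum>i<n. indicator A ((T ^^ i) x)) \<le> (\<Sum>i<n. 1::real)"
    by (intro sum_mono) (auto simp: indicator_def)
  then show "visit_frequency T A n x \<le> 1"
    by (auto simp: visit_frequency_def divide_le_eq)
  show "0 \<le> visit_frequency T A n x"
    by (auto simp: visit_frequency_def intro!: divide_nonneg_nonneg sum_nonneg)
qed

text \<open>
  The orbit is cut into pieces of length at most \<open>L\<close> on each of which the average is at least \<open>c\<close>; only
  the last piece may be incomplete.
\<close>

lemma sum_orbit_ge_of_frequent_returns:
  fixes f g :: "'a \<Rightarrow> real"
  assumes X: "\<And>x. x \<in> X \<Longrightarrow> T x \<in> X"
    and c: "0 \<le> c" and g: "\<And>x. x \<in> X \<Longrightarrow> 0 \<le> g x"
    and ret: "\<And>x. x \<in> X \<Longrightarrow> \<exists>k. 1 \<le> k \<and> k \<le> L \<and> c * real k \<le> (\<Sum>i<k. g ((T ^^ i) x))"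
    and x: "x \<in> X"
  shows "c * (real n - real L) \<le> (\<Sum>i<n. g ((T ^^ i) x))"
  using x
proof (induction n arbitrary: x rule: less_induct)
  case (less n)
  have X': "(T ^^ i) x \<in> X" if "x \<in> X" for x i using that by (induction i) (auto intro: X)
  show ?case
  proof (cases "n \<le> L")
    case True
    then have "c * (real n - real L) \<le> 0" using c by (simp add: mult_nonneg_nonpos)
    also have "0 \<le> (\<Sum>i<n. g ((T ^^ i) x))" by (intro sum_nonneg g X' less.prems)
    finally show ?thesis .
  next
    case False
    obtain k where k: "1 \<le> k" "k \<le> L" "c * real k \<le> (\<Sum>i<k. g ((T ^^ i) x))"
      using ret[OF less.prems] by blast
    have kn: "k \<le> n" using k False by simp
    have "c * (real (n - k) - real L) \<le> (\<Sum>i<n-k. g ((T ^^ i) ((T ^^ k) x)))"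
      using k kn by (intro less.IH X' less.prems) auto
    also have "\<dots> = (\<Sum>i=k..<n. g ((T ^^ i) x))"
      using kn by (intro sum.reindex_bij_witness[of _ "\<lambda>i. i - k" "\<lambda>i. i + k"])
        (auto simp: funpow_add)
    finally have "c * (real n - real L) \<le> (\<Sum>i<k. g ((T ^^ i) x)) + (\<Sum>i=k..<n. g ((T ^^ i) x))"
      using k kn by (simp add: of_nat_diff algebra_simps)
    also have "\<dots> = (\<Sum>i<n. g ((T ^^ i) x))"
      using kn by (metis atLeast0LessThan sum.atLeastLessThan_concat zero_le)
    finally show ?thesis .
  qed
qed

text \<open>
  The set where the time \<open>k\<close> cannot be chosen below \<open>L\<close> has small measure for large \<open>L\<close>. Adding its
  indicator to that of \<open>A\<close> makes \<open>k = 1\<close> a good time there, so that good times are bounded by \<open>L\<close>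
  everywhere, at the cost of a small change of the integral.
\<close>

lemma maximal_visit_inequality:
  assumes N: "prob_space N" and T: "T \<in> measurable N N" "distr N N T = N"
    and A: "A \<in> sets N" and c: "0 \<le> c"
    and ex: "AE x in N. \<exists>k\<ge>1. c < visit_frequency T A k x"
  shows "c \<le> measure N A"
proof -
  interpret prob_space N by fact
  note [measurable] = borel_measurable_visit_frequency[OF T(1) A] A
  define G where "G L = {x\<in>space N. \<exists>k\<in>{1..L}. c < visit_frequency T A k x}" for L :: nat
  have G[measurable]: "G L \<in> sets N" for L unfolding G_def by measurable
  have "(\<lambda>L. measure N (G L)) \<longlonglongrightarrow> measure N (\<Union>L. G L)"
    by (intro finite_Lim_measure_incseq) (auto simp: incseq_def G_def)
  also have "measure N (\<Union>L. G L) = 1"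
  proof -
    have "AE x in N. x \<in> (\<Union>L. G L)"
      using ex AE_space
    proof eventually_elim
      case (elim x)
      then obtain k where "k \<ge> 1" "c < visit_frequency T A k x" by blast
      then have "x \<in> G k" using elim(2) by (auto simp: G_def)
      then show ?case by blast
    qed
    then show ?thesis by (intro prob_eq_1[THEN iffD2]) auto
  qed
  finally have lim: "(\<lambda>L. measure N (G L)) \<longlonglongrightarrow> 1" .
  (* Needed for k = 1 to be a good time on the bad set. *)
  have c1: "c \<le> 1"
  proof (rule ccontr)
    assume "\<not> c \<le> 1"
    have "AE x in N. False"
      using ex
    proof eventually_elim
      case (elim x)
      then obtain k where "c < visit_frequency T A k x" by blast
      then show ?case using visit_frequency_bounds(2)[of T A k x] \<open>\<not> c \<le> 1\<close> by linarith
    qed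
    then show False by simp
  qed
  have main: "c * (1 - real L / real n) \<le> measure N A + (1 - measure N (G L))" if L: "L \<ge> 1" and n: "n \<ge> 1" for L n
  proof -
    define g where "g x = (indicator A x + indicator (space N - G L) x :: real)" for x
    have [measurable]: "g \<in> borel_measurable N" unfolding g_def by measurable
    have g0: "0 \<le> g x" "g x \<le> 2" for x by (auto simp: g_def indicator_def)
    have gi: "integrable N (\<lambda>x. g ((T ^^ i) x))" for i
      by (rule integrable_const_bound[where B=2])
        (use g0 measurable_compose[OF measurable_funpow[OF T(1), of i], of g] in \<open>auto\<close>)
    have eq: "(\<integral>x. g ((T ^^ i) x) \<partial>N) = measure N A + (1 - measure N (G L))" for i
    proof -
      have "(\<integral>x. g ((T ^^ i) x) \<partial>N) = (\<integral>x. g x \<partial>(distr N N (T ^^ i)))"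
        by (subst integral_distr) (auto intro: measurable_funpow T)
      also have "\<dots> = (\<integral>x. g x \<partial>N)" using distr_funpow[OF T] by simp
      also have "\<dots> = measure N A + measure N (space N - G L)"
        unfolding g_def by (subst Bochner_Integration.integral_add) (auto simp: emeasure_eq_measure)
      finally show ?thesis by (simp add: prob_compl)
    qed
    have pt: "c * (real n - real L) \<le> (\<Sum>i<n. g ((T ^^ i) x))" if x: "x \<in> space N" for x
    proof (rule sum_orbit_ge_of_frequent_returns[where X="space N" and T=T and L=L and g=g, OF _ c g0(1) _ x])
      show "\<And>x. x \<in> space N \<Longrightarrow> T x \<in> space N" using measurable_space[OF T(1)] .
      fix y assume y: "y \<in> space N"
      show "\<exists>k. 1 \<le> k \<and> k \<le> L \<and> c * real k \<le> (\<Sum>i<k. g ((T ^^ i) y))"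
      proof (cases "y \<in> G L")
        case True
        then obtain k where k: "k \<ge> 1" "k \<le> L" "c < visit_frequency T A k y" by (auto simp: G_def)
        then have "c * real k \<le> (\<Sum>i<k. indicator A ((T ^^ i) y))"
          by (simp add: visit_frequency_def pos_less_divide_eq)
        also have "\<dots> \<le> (\<Sum>i<k. g ((T ^^ i) y))"
          by (intro sum_mono) (auto simp: g_def)
        finally show ?thesis using k by blast
      next
        case False
        then have "1 \<le> g y" using y by (auto simp: g_def)
        then show ?thesis using c1 L by (intro exI[of _ 1]) auto
      qed
    qed
    have "c * (real n - real L) = (\<integral>x. c * (real n - real L) \<partial>N)" by (simp add: prob_space)
    also have "\<dots> \<le> (\<integral>x. (\<Sum>i<n. g ((T ^^ i) x)) \<partial>N)"
      using pt gi by (intro integral_mono) auto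
    also have "\<dots> = real n * (measure N A + (1 - measure N (G L)))"
      using gi by (simp add: eq)
    finally show ?thesis using n by (simp add: field_simps)
  qed
  have "c \<le> measure N A + (1 - measure N (G L))" if L: "L \<ge> 1" for L
  proof (rule LIMSEQ_le_const2[of "\<lambda>n. c * (1 - real L / real n)"])
    have "(\<lambda>n. c * (1 - real L / real n)) \<longlonglongrightarrow> c * (1 - 0)"
      by (intro tendsto_intros lim_const_over_n)
    then show "(\<lambda>n. c * (1 - real L / real n)) \<longlonglongrightarrow> c" by simp
    show "\<exists>M. \<forall>n\<ge>M. c * (1 - real L / real n) \<le> measure N A + (1 - measure N (G L))"
      using main[OF L] by blast
  qed
  moreover have "(\<lambda>L. measure N A + (1 - measure N (G L))) \<longlonglongrightarrow> measure N A + (1 - 1)"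
    by (intro tendsto_intros lim)
  ultimately show ?thesis
    by (intro LIMSEQ_le_const[of "\<lambda>L. measure N A + (1 - measure N (G L))"]) auto
qed

text \<open>
  If the limit superior exceeded the measure of \<open>A\<close> on a set that is not null, this invariant set would have
  full measure, contradicting the inequality above.
\<close>

lemma limsup_visit_frequency_le:
  assumes erg: "ergodic_system N T" and A: "A \<in> sets N"
  shows "AE x in N. limsup (\<lambda>n. ereal (visit_frequency T A n x)) \<le> ereal (measure N A)"
proof -
  note T = ergodic_systemD(2,3)[OF erg]
  interpret prob_space N using ergodic_systemD[OF erg] by simp
  note [measurable] = borel_measurable_visit_frequency[OF T(1) A] A T(1)
  have inv: "limsup (\<lambda>n. ereal (visit_frequency T A n (T x))) =
     limsup (\<lambda>n. ereal (visit_frequency T A n x))" for x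
  proof -
    define u where "u n = (indicator A ((T ^^ n) x) - indicator A x) / real n" for n
    have eq: "visit_frequency T A n (T x) = u n + visit_frequency T A n x" for n
    proof -
      have "(\<Sum>i<n. indicator A ((T ^^ i) (T x))) = (\<Sum>i<n. indicator A ((T ^^ Suc i) x) :: real)"
        by (simp add: funpow_Suc_right del: funpow.simps)
      also have "\<dots> = (\<Sum>i<Suc n. indicator A ((T ^^ i) x)) - indicator A x"
        by (subst sum.lessThan_Suc_shift) simp
      finally show ?thesis by (simp add: visit_frequency_def u_def add_divide_distrib diff_divide_distrib)
    qed
    have "u \<longlonglongrightarrow> 0"
    proof (rule Lim_null_comparison)
      show "\<forall>\<^sub>F n in sequentially. norm (u n) \<le> 1 / real n"
        by (intro always_eventually) (auto simp: u_def indicator_def)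
    qed (rule lim_const_over_n)
    then have "(\<lambda>n. ereal (u n)) \<longlonglongrightarrow> ereal 0" by simp
    from ereal_limsup_lim_add[OF this, of "\<lambda>n. ereal (visit_frequency T A n x)"]
    show ?thesis by (simp add: eq flip: zero_ereal_def)
  qed
  have null: "AE x in N. limsup (\<lambda>n. ereal (visit_frequency T A n x)) \<le> ereal c"
    if c: "measure N A < c" for c
  proof -
    define U where "U = {x\<in>space N. ereal c < limsup (\<lambda>n. ereal (visit_frequency T A n x))}"
    have U[measurable]: "U \<in> sets N" unfolding U_def by measurable
    have "T -` U \<inter> space N = U"
      using measurable_space[OF T(1)] by (auto simp: U_def inv)
    then have "measure N U = 0 \<or> measure N U = 1" using erg U by (auto simp: ergodic_system_def)
    moreover have "measure N U \<noteq> 1"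
    proof
      assume "measure N U = 1"
      then have "AE x in N. x \<in> U" by (simp add: prob_eq_1)
      then have "AE x in N. \<exists>k\<ge>1. c < visit_frequency T A k x"
      proof eventually_elim
        case (elim x)
        then have l: "ereal c < limsup (\<lambda>n. ereal (visit_frequency T A n x))" by (simp add: U_def)
        show ?case
        proof (rule ccontr)
          assume "\<not> ?case"
          then have "\<forall>\<^sub>F n in sequentially. ereal (visit_frequency T A n x) \<le> ereal c"
            by (auto simp: eventually_sequentially not_less)
          then have "limsup (\<lambda>n. ereal (visit_frequency T A n x)) \<le> ereal c" by (rule Limsup_bounded)
          with l show False by simp
        qed
      qed
      with maximal_visit_inequality[OF prob_space_axioms T A, of c] have "c \<le> measure N A"
        using c measure_nonneg[of N A] by linarith
      with c show False by simp
    qed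
    ultimately have "measure N U = 0" by simp
    then have "AE x in N. x \<notin> U" by (simp add: prob_eq_0)
    then show ?thesis using AE_space by eventually_elim (auto simp: U_def)
  qed
  have "AE x in N. \<forall>k::nat. limsup (\<lambda>n. ereal (visit_frequency T A n x)) \<le> ereal (measure N A + 1 / real (Suc k))"
    by (subst AE_all_countable) (auto intro!: null)
  then show ?thesis
  proof eventually_elim
    case (elim x)
    show ?case
    proof (rule LIMSEQ_le_const[of "\<lambda>k. ereal (measure N A + 1 / real (Suc k))"])
      have "(\<lambda>k. measure N A + 1 / real (Suc k)) \<longlonglongrightarrow> measure N A + 0"
        by (intro tendsto_intros) (use LIMSEQ_Suc[OF lim_1_over_n] in simp)
      then show "(\<lambda>k. ereal (measure N A + 1 / real (Suc k))) \<longlonglongrightarrow> ereal (measure N A)" by simp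
    qed (use elim in auto)
  qed
qed

theorem birkhoff_visit_frequency:
  assumes erg: "ergodic_system N T" and A: "A \<in> sets N"
  shows "AE x in N. (\<lambda>n. visit_frequency T A n x) \<longlonglongrightarrow> measure N A"
proof -
  note T = ergodic_systemD(2,3)[OF erg]
  interpret prob_space N using ergodic_systemD[OF erg] by simp
  have A': "space N - A \<in> sets N" using A by auto
  show ?thesis
    using limsup_visit_frequency_le[OF erg A] limsup_visit_frequency_le[OF erg A'] AE_space
  proof eventually_elim
    case (elim x)
    have eq: "\<forall>\<^sub>F n in sequentially. ereal (visit_frequency T A n x) = 1 - ereal (visit_frequency T (space N - A) n x)"
      unfolding eventually_sequentially
    proof (intro exI[of _ 1] allI impI)
      fix n :: nat assume n: "1 \<le> n"
      have "indicator A ((T ^^ i) x) = (1 - indicator (space N - A) ((T ^^ i) x) :: real)" for i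
        using funpow_in_space[OF T(1) elim(3), of i] by (simp add: indicator_def)
      then have "visit_frequency T A n x = (\<Sum>i<n. 1 - indicator (space N - A) ((T ^^ i) x)) / real n"
        by (simp only: visit_frequency_def)
      also have "\<dots> = 1 - visit_frequency T (space N - A) n x"
        using n by (simp add: visit_frequency_def sum_subtractf diff_divide_distrib)
      finally show "ereal (visit_frequency T A n x) = 1 - ereal (visit_frequency T (space N - A) n x)"
        by (simp add: one_ereal_def)
    qed
    have "ereal (measure N A) = 1 - ereal (measure N (space N - A))"
      using A by (simp add: prob_compl one_ereal_def)
    also have "\<dots> \<le> 1 - limsup (\<lambda>n. ereal (visit_frequency T (space N - A) n x))"
      using elim(2) by (intro ereal_minus_mono) auto
    also have "\<dots> = liminf (\<lambda>n. 1 - ereal (visit_frequency T (space N - A) n x))"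
      by (simp add: liminf_ereal_cminus)
    also have "\<dots> = liminf (\<lambda>n. ereal (visit_frequency T A n x))"
      by (rule Liminf_eq) (use eq in eventually_elim, simp)
    finally have "ereal (measure N A) \<le> liminf (\<lambda>n. ereal (visit_frequency T A n x))" .
    then have low: "\<forall>y<ereal (measure N A). \<forall>\<^sub>F n in sequentially. y < ereal (visit_frequency T A n x)"
      by (simp only: le_Liminf_iff)
    have up: "\<forall>y>ereal (measure N A). \<forall>\<^sub>F n in sequentially. ereal (visit_frequency T A n x) < y"
      using elim(1) by (simp only: Limsup_le_iff)
    show ?case
    proof (rule order_tendstoI)
      fix B assume "B < measure N A"
      then show "\<forall>\<^sub>F n in sequentially. B < visit_frequency T A n x"
        using low[rule_format, of "ereal B"] by simp
    next
      fix B assume "measure N A < B"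
      then show "\<forall>\<^sub>F n in sequentially. visit_frequency T A n x < B"
        using up[rule_format, of "ereal B"] by simp
    qed
  qed
qed

lemma mean_visit_frequency:
  assumes erg: "ergodic_system N T" and A: "A \<in> sets N"
  shows "(\<lambda>n. \<integral>x. \<bar>visit_frequency T A n x - measure N A\<bar> \<partial>N) \<longlonglongrightarrow> 0"
proof -
  note T = ergodic_systemD(2,3)[OF erg]
  interpret prob_space N using ergodic_systemD[OF erg] by simp
  note [measurable] = borel_measurable_visit_frequency[OF T(1) A]
  have "(\<lambda>n. \<integral>x. \<bar>visit_frequency T A n x - measure N A\<bar> \<partial>N) \<longlonglongrightarrow> (\<integral>x. 0 \<partial>N)"
  proof (rule integral_dominated_convergence[where w = "\<lambda>_. 1"])
    show "AE x in N. (\<lambda>n. \<bar>visit_frequency T A n x - measure N A\<bar>) \<longlonglongrightarrow> 0"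
      using birkhoff_visit_frequency[OF erg A]
      by eventually_elim (auto simp: tendsto_rabs_zero_iff LIM_zero_iff)
    show "AE x in N. norm \<bar>visit_frequency T A n x - measure N A\<bar> \<le> 1" for n
    proof (rule AE_I2)
      fix x
      show "norm \<bar>visit_frequency T A n x - measure N A\<bar> \<le> 1"
        using visit_frequency_bounds[of T A n x] prob_le_1[of A] measure_nonneg[of N A]
        unfolding real_norm_def abs_abs abs_le_iff by linarith
    qed
  qed auto
  then show ?thesis by simp
qed

lemma (in prob_space) integral_visit_frequency_on:
  assumes p: "p \<in> measurable M N" and T: "T \<in> measurable N N"
    and A: "A \<in> sets N" and G: "G \<in> sets M"
  shows "(\<integral>y. indicator G y * visit_frequency T A n (p y) \<partial>M) =
    (\<Sum>i<n. measure M (G \<inter> {y \<in> space M. (T ^^ i) (p y) \<in> A})) / real n"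
proof -
  have m: "{y \<in> space M. (T ^^ i) (p y) \<in> A} \<in> sets M" for i
    using measurable_sets[OF measurable_compose[OF p measurable_funpow[OF T, of i]] A]
    by (simp add: vimage_def Int_def conj_commute)
  define H where "H i = G \<inter> {y \<in> space M. (T ^^ i) (p y) \<in> A}" for i
  have H: "H i \<in> sets M" for i using m G by (simp add: H_def)
  have pt: "indicator G y * visit_frequency T A n (p y) = (\<Sum>i<n. indicator (H i) y) / real n"
    if "y \<in> space M" for y
  proof -
    have "indicator G y * indicator A ((T ^^ i) (p y)) = (indicator (H i) y :: real)" for i
      using that by (simp add: H_def indicator_def)
    then show ?thesis by (simp only: visit_frequency_def times_divide_eq_right sum_distrib_left)
  qed
  have "(\<integral>y. indicator G y * visit_frequency T A n (p y) \<partial>M) = (\<integral>y. (\<Sum>i<n. indicator (H i) y) / real n \<partial>M)"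
    by (rule Bochner_Integration.integral_cong[OF refl pt])
  also have "\<dots> = (\<Sum>i<n. \<integral>y. indicator (H i) y \<partial>M) / real n"
    unfolding integral_divide_zero using H
    by (subst Bochner_Integration.integral_sum) (auto simp: emeasure_eq_measure)
  also have "\<dots> = (\<Sum>i<n. measure M (H i)) / real n"
    using sets.sets_into_space[OF H] by (simp add: Int_absorb2)
  finally show ?thesis by (simp only: H_def)
qed

text \<open>
  Averages along the orbit of \<open>p y\<close> are asymptotically independent of any event \<open>G\<close>. The bound does not
  depend on \<open>G\<close>, so it remains useful when \<open>G\<close> changes with the level of the blocks.
\<close>

lemma weak_average_bound:
  assumes erg: "ergodic_system N T" and nu: "prob_space L" and p: "p \<in> measurable L N" "distr L N p = N"
    and A: "A \<in> sets N" and G: "G \<in> sets L" and n: "n \<ge> 1"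
  shows "\<bar>(\<Sum>i<n. measure L (G \<inter> {y \<in> space L. (T ^^ i) (p y) \<in> A})) / real n - measure L G * measure N A\<bar>
    \<le> (\<integral>x. \<bar>visit_frequency T A n x - measure N A\<bar> \<partial>N)"
proof -
  note T = ergodic_systemD(2,3)[OF erg]
  interpret L: prob_space L by fact
  note m0 = borel_measurable_visit_frequency[OF T(1) A, of n]
  note [measurable] = m0 measurable_compose[OF p(1) m0] G
  have i1: "integrable L (\<lambda>y. indicator G y * visit_frequency T A n (p y))"
    using visit_frequency_bounds[of T A n]
    by (intro L.integrable_const_bound[where B=1]) (auto simp: indicator_def)
  have i2: "integrable L (\<lambda>y. indicator G y * measure N A)"
    by (intro L.integrable_const_bound[where B="measure N A"]) (auto simp: indicator_def)
  have b: "\<bar>visit_frequency T A n x - measure N A\<bar> \<le> 1" for x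
    using visit_frequency_bounds[of T A n x] prob_space.prob_le_1[OF ergodic_systemD(1)[OF erg], of A] measure_nonneg[of N A]
    by linarith
  have i3: "integrable L (\<lambda>y. \<bar>visit_frequency T A n (p y) - measure N A\<bar>)"
    using b by (intro L.integrable_const_bound[where B=1]) auto
  have "(\<Sum>i<n. measure L (G \<inter> {y \<in> space L. (T ^^ i) (p y) \<in> A})) / real n - measure L G * measure N A
    = (\<integral>y. indicator G y * visit_frequency T A n (p y) \<partial>L) - (\<integral>y. indicator G y * measure N A \<partial>L)"
    using L.integral_visit_frequency_on[OF p(1) T(1) A G, of n] sets.sets_into_space[OF G]
    by (simp add: Int_absorb2)
  also have "\<dots> = (\<integral>y. indicator G y * (visit_frequency T A n (p y) - measure N A) \<partial>L)"
    using i1 i2 by (simp add: right_diff_distrib)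
  finally have "\<bar>(\<Sum>i<n. measure L (G \<inter> {y \<in> space L. (T ^^ i) (p y) \<in> A})) / real n - measure L G * measure N A\<bar>
    = \<bar>\<integral>y. indicator G y * (visit_frequency T A n (p y) - measure N A) \<partial>L\<bar>" by simp
  also have "\<dots> \<le> (\<integral>y. \<bar>indicator G y * (visit_frequency T A n (p y) - measure N A)\<bar> \<partial>L)"
    by (rule integral_abs_bound)
  also have "\<dots> \<le> (\<integral>y. \<bar>visit_frequency T A n (p y) - measure N A\<bar> \<partial>L)"
    using i3 by (intro integral_mono') (auto simp: indicator_def)
  also have "\<dots> = (\<integral>x. \<bar>visit_frequency T A n x - measure N A\<bar> \<partial>(distr L N p))"
    using p by (subst integral_distr) auto
  finally show ?thesis using p(2) by simp
qed

lemma weak_average: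
  assumes erg: "ergodic_system N T" and nu: "prob_space L" and p: "p \<in> measurable L N" "distr L N p = N"
    and A: "A \<in> sets N" and G: "G \<in> sets L"
  shows "(\<lambda>n. (\<Sum>i<n. measure L (G \<inter> {y \<in> space L. (T ^^ i) (p y) \<in> A})) / real n)
    \<longlonglongrightarrow> measure L G * measure N A"
proof (rule LIM_zero_cancel, rule Lim_null_comparison[OF _ mean_visit_frequency[OF erg A]])
  show "\<forall>\<^sub>F n in sequentially. norm ((\<Sum>i<n. measure L (G \<inter> {y \<in> space L. (T ^^ i) (p y) \<in> A})) / real n - measure L G * measure N A)
    \<le> (\<integral>x. \<bar>visit_frequency T A n x - measure N A\<bar> \<partial>N)"
    using eventually_ge_at_top[of 1]
    by eventually_elim (unfold real_norm_def, rule weak_average_bound[OF assms])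
qed

text \<open>
  The average over \<open>i\<close> of a constant is that constant, and by \<open>weak_average\<close> it converges to the product.
\<close>

lemma independent_of_ergodic_factor:
  assumes erg: "ergodic_system N T" and nu: "prob_space L" and p: "p \<in> measurable L N" "distr L N p = N"
    and A: "A \<in> sets N" and G: "G \<in> sets L"
    and const: "\<And>i. measure L (G \<inter> {y \<in> space L. (T ^^ i) (p y) \<in> A}) = measure L (G \<inter> {y \<in> space L. p y \<in> A})"
  shows "measure L (G \<inter> {y \<in> space L. p y \<in> A}) = measure L G * measure N A"
proof (rule LIMSEQ_unique[OF _ weak_average[OF assms(1-6)]])
  show "(\<lambda>n. (\<Sum>i<n. measure L (G \<inter> {y \<in> space L. (T ^^ i) (p y) \<in> A})) / real n)
    \<longlonglongrightarrow> measure L (G \<inter> {y \<in> space L. p y \<in> A})"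
    unfolding const
    by (rule tendsto_eventually, rule eventually_mono[OF eventually_gt_at_top[of 0]]) simp
qed

section \<open>Words, blocks and gaps\<close>

definition spaced_word :: "nat list \<Rightarrow> nat list \<Rightarrow> nat list" where
  "spaced_word u w = concat (map (\<lambda>a. u @ replicate a 1) w) @ u"

definition copy_start :: "nat \<Rightarrow> nat list \<Rightarrow> nat \<Rightarrow> nat" where
  "copy_start k w i = (\<Sum>l<i. k + w ! l)"

lemma copy_start_simps [simp]:
  "copy_start k w 0 = 0" "copy_start k w (Suc i) = copy_start k w i + k + w ! i"
  by (simp_all add: copy_start_def)

lemma copy_start_Cons: "copy_start k (a # w) (Suc i) = k + a + copy_start k w i"
  unfolding copy_start_def by (subst sum.lessThan_Suc_shift) simp

lemma length_spaced_word: "length (spaced_word u w) = copy_start (length u) w (length w) + length u"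
proof (induction w)
  case (Cons a w)
  then show ?case by (simp add: spaced_word_def copy_start_Cons del: copy_start_simps(2))
qed (simp add: spaced_word_def)

lemma spaced_word_copy:
  assumes "i \<le> length w" "j < length u"
  shows "spaced_word u w ! (copy_start (length u) w i + j) = u ! j"
  using assms
proof (induction w arbitrary: i)
  case (Cons a w)
  show ?case
  proof (cases i)
    case 0
    then show ?thesis using Cons.prems by (simp add: spaced_word_def nth_append)
  next
    case (Suc i')
    have "spaced_word u (a # w) = (u @ replicate a 1) @ spaced_word u w" by (simp add: spaced_word_def)
    moreover have "copy_start (length u) (a # w) i + j = length (u @ replicate a (1::nat)) + (copy_start (length u) w i' + j)"
      unfolding Suc copy_start_Cons by simp
    ultimately have "spaced_word u (a # w) ! (copy_start (length u) (a # w) i + j) = spaced_word u w ! (copy_start (length u) w i' + j)"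
      by (simp only: nth_append_length_plus)
    then show ?thesis using Cons Suc by simp
  qed
qed (simp add: spaced_word_def)

lemma spaced_word_spacer:
  assumes "i < length w" "j < w ! i"
  shows "spaced_word u w ! (copy_start (length u) w i + length u + j) = 1"
  using assms
proof (induction w arbitrary: i)
  case (Cons a w)
  have split: "spaced_word u (a # w) = (u @ replicate a 1) @ spaced_word u w" by (simp add: spaced_word_def)
  show ?case
  proof (cases i)
    case 0
    then show ?thesis using Cons.prems unfolding split by (simp add: nth_append)
  next
    case (Suc i')
    have "copy_start (length u) (a # w) i + length u + j = length (u @ replicate a (1::nat)) + (copy_start (length u) w i' + length u + j)"
      unfolding Suc copy_start_Cons by simp
    then have "spaced_word u (a # w) ! (copy_start (length u) (a # w) i + length u + j) = spaced_word u w ! (copy_start (length u) w i' + length u + j)"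
      unfolding split by (simp only: nth_append_length_plus)
    then show ?thesis using Cons Suc by simp
  qed
qed simp

lemma copy_start_cover:
  assumes "j < copy_start k w m + k" "0 < k"
  shows "(\<exists>i\<le>m. \<exists>l<k. j = copy_start k w i + l) \<or> (\<exists>i<m. \<exists>l<w ! i. j = copy_start k w i + k + l)"
  using assms
proof (induction m)
  case 0
  then show ?case by auto
next
  case (Suc m)
  consider "j < copy_start k w m + k" | "copy_start k w m + k \<le> j" "j < copy_start k w m + k + w ! m"
    | "copy_start k w (Suc m) \<le> j" by fastforce
  then show ?case
  proof cases
    case 1
    then show ?thesis using Suc by (meson le_SucI less_SucI)
  next
    case 2
    then show ?thesis by (intro disjI2 exI[of _ m] conjI exI[of _ "j - (copy_start k w m + k)"]) auto
  next
    case 3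
    then show ?thesis using Suc.prems
      by (intro disjI1 exI[of _ "Suc m"] conjI exI[of _ "j - copy_start k w (Suc m)"]) auto
  qed
qed

locale bounded_rank_one =
  fixes r :: "nat \<Rightarrow> nat" and s :: "nat \<Rightarrow> nat list" and R S :: nat
  assumes cutting: "cutting_parameter r" and spacer: "spacer_parameter r s"
    and r_le: "r n \<le> R" and spacer_le: "a \<in> set (s n) \<Longrightarrow> a \<le> S"
    and recognizable: "card (occurrences (s n) (s n @ [c] @ s n)) = 2"
begin

abbreviation "v \<equiv> rank_one_block s"
abbreviation "h \<equiv> height s"
abbreviation "V \<equiv> rank_one_word s"
abbreviation "off n \<equiv> copy_start (h n) (s n)"

lemma r_ge: "2 \<le> r n" using cutting by (simp add: cutting_parameter_def)

lemma length_s: "length (s n) = r n - 1" using spacer by (simp add: spacer_parameter_def)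

lemma s_nth_le: "i < r n - 1 \<Longrightarrow> s n ! i \<le> S"
  using spacer_le[of "s n ! i" n] length_s[of n] by simp

lemma v_Suc: "v (Suc n) = spaced_word (v n) (s n)" by (simp add: spaced_word_def)

lemma h_0: "h 0 = 1" by (simp add: height_def)

lemma h_Suc: "h (Suc n) = off n (r n - 1) + h n"
  unfolding height_def v_Suc length_spaced_word length_s by (simp add: height_def)

lemma v_Suc_copy: "i < r n \<Longrightarrow> j < h n \<Longrightarrow> v (Suc n) ! (off n i + j) = v n ! j"
  unfolding v_Suc height_def by (rule spaced_word_copy) (auto simp: length_s height_def)

lemma v_Suc_spacer: "i < r n - 1 \<Longrightarrow> j < s n ! i \<Longrightarrow> v (Suc n) ! (off n i + h n + j) = 1"
  unfolding v_Suc height_def by (rule spaced_word_spacer) (auto simp: length_s)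

lemma off_ge: "i * h n \<le> off n i" by (induction i) auto

lemma off_le: "i < r n \<Longrightarrow> off n i \<le> i * (h n + S)"
proof (induction i)
  case (Suc i)
  have "i < r n - 1" using Suc.prems by simp
  then show ?case using Suc s_nth_le[of i n] by simp
qed simp

lemma off_mono: "i \<le> j \<Longrightarrow> off n i \<le> off n j"
  by (rule lift_Suc_mono_le[of "off n"]) auto

lemma h_Suc_ge: "2 * h n \<le> h (Suc n)"
proof -
  have "1 * h n \<le> (r n - 1) * h n" using r_ge[of n] by (intro mult_le_mono1) simp
  then show ?thesis using off_ge[of "r n - 1" n] h_Suc[of n] by linarith
qed

lemma h_pos: "0 < h n"
proof (induction n)
  case (Suc n)
  then show ?case using h_Suc_ge[of n] by linarith
qed (simp add: h_0)

lemma h_ge: "n \<le> h n"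
proof (induction n)
  case (Suc n)
  then show ?case using h_Suc_ge[of n] h_pos[of n] by linarith
qed simp

lemma h_mono: "m \<le> n \<Longrightarrow> h m \<le> h n"
proof (rule lift_Suc_mono_le[of h])
  show "h n \<le> h (Suc n)" for n using h_Suc_ge[of n] by linarith
qed

lemma h_Suc_le: "h (Suc n) \<le> R * (h n + S)"
proof -
  have "off n (r n - 1) \<le> (r n - 1) * (h n + S)" using r_ge[of n] by (intro off_le) simp
  then have "h (Suc n) \<le> (r n - 1) * (h n + S) + (h n + S)" unfolding h_Suc by simp
  also have "\<dots> = (r n - 1 + 1) * (h n + S)" by (simp only: distrib_right mult_1)
  also have "\<dots> = r n * (h n + S)" using r_ge[of n] by simp
  also have "\<dots> \<le> R * (h n + S)" by (intro mult_le_mono1 r_le)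
  finally show ?thesis .
qed

lemma v_hd: "v n ! 0 = 0"
proof (induction n)
  case (Suc n)
  then show ?case using v_Suc_copy[of 0 n 0] h_pos[of n] r_ge[of n] by simp
qed simp

text \<open>
  The length of the gap after copy number \<open>k\<close> of the block of level \<open>n\<close> in the limit word. Within a block of
  level \<open>n + 1\<close> the gaps are the entries of \<open>s n\<close>; after its last copy the gap is the one that follows the
  block of level \<open>n + 1\<close>.
\<close>

function gap :: "nat \<Rightarrow> nat \<Rightarrow> nat" where
  "gap n k = (if k mod r n < r n - 1 then s n ! (k mod r n) else gap (Suc n) (k div r n))"
  by auto
termination
proof (relation "Wellfounded.measure snd")
  fix n k assume "\<not> k mod r n < r n - 1"
  then have "k \<noteq> 0" using r_ge[of n] by (intro notI) simp
  then show "((Suc n, k div r n), n, k) \<in> Wellfounded.measure snd"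
    using r_ge[of n] by simp
qed simp

declare gap.simps [simp del]

lemma gap_inner: "i < r n - 1 \<Longrightarrow> gap n (r n * q + i) = s n ! i"
  using r_ge[of n] by (subst gap.simps) simp

lemma gap_last: "gap n (r n * q + (r n - 1)) = gap (Suc n) q"
proof -
  have "(r n * q + (r n - 1)) mod r n = r n - 1" "(r n * q + (r n - 1)) div r n = q"
    using r_ge[of n] by (simp_all only: mod_mult_self4 div_mult_self4[of "r n"] mod_less div_less diff_less)
  then show ?thesis by (subst gap.simps) simp
qed

lemma gap_le: "gap n k \<le> S"
proof (induction n k rule: gap.induct)
  case (1 n k)
  then show ?case by (subst gap.simps) (auto intro: s_nth_le)
qed

definition pos :: "nat \<Rightarrow> nat \<Rightarrow> nat" where
  "pos n k = (\<Sum>l<k. h n + gap n l)"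

lemma pos_simps [simp]: "pos n 0 = 0" "pos n (Suc k) = pos n k + h n + gap n k"
  by (simp_all add: pos_def)

lemma pos_inner: "i \<le> r n - 1 \<Longrightarrow> pos n (r n * q + i) = pos n (r n * q) + off n i"
proof (induction i)
  case (Suc i)
  then show ?case using gap_inner[of i n q] by simp
qed simp

lemma pos_Suc_level: "pos n (r n * q) = pos (Suc n) q"
proof (induction q)
  case (Suc q)
  have "r n * Suc q = Suc (r n * q + (r n - 1))" using r_ge[of n] by simp
  then have "pos n (r n * Suc q) = pos n (r n * q + (r n - 1)) + h n + gap n (r n * q + (r n - 1))"
    by (simp only: pos_simps)
  also have "\<dots> = pos (Suc n) (Suc q)"
    unfolding pos_inner[OF order_refl] gap_last Suc by (simp add: h_Suc)
  finally show ?case .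
qed simp

lemma pos_div: "pos n k = pos (Suc n) (k div r n) + off n (k mod r n)"
proof -
  have "k mod r n \<le> r n - 1" using r_ge[of n] by (simp add: less_Suc_eq_le[symmetric])
  from pos_inner[OF this, of "k div r n"] show ?thesis by (simp add: pos_Suc_level)
qed

lemma div_r_less: "0 < k \<Longrightarrow> k div r n < k" using r_ge[of n] by simp

lemma mod_r_less: "k mod r n < r n" using r_ge[of n] by simp

lemma off_less: "i < r n \<Longrightarrow> j < h n \<Longrightarrow> off n i + j < h (Suc n)"
proof -
  assume "i < r n" "j < h n"
  moreover then have "off n i \<le> off n (r n - 1)" by (intro off_mono) simp
  ultimately show ?thesis unfolding h_Suc by linarith
qed

text \<open>
  Copy number \<open>k\<close> of level \<open>n\<close> lies in copy number \<open>k div r n\<close> of level \<open>n + 1\<close>. Since \<open>k div r n < k\<close> for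
  \<open>k > 0\<close>, induction on \<open>k\<close> for all levels at once reduces to the first copy.
\<close>

lemma V_block: "j < h n \<Longrightarrow> V (pos n k + j) = v n ! j"
proof (induction k arbitrary: n j rule: less_induct)
  case (less k)
  show ?case
  proof (cases "k = 0")
    case True
    then show ?thesis using rank_one_word_eq[OF cutting spacer less.prems] by simp
  next
    case False
    have "V (pos n k + j) = V (pos (Suc n) (k div r n) + (off n (k mod r n) + j))"
      by (subst pos_div) (simp add: ac_simps)
    also have "\<dots> = v (Suc n) ! (off n (k mod r n) + j)"
      using False less.prems by (intro less.IH div_r_less off_less mod_r_less) auto
    also have "\<dots> = v n ! j" by (intro v_Suc_copy mod_r_less less.prems)
    finally show ?thesis .
  qed
qed

lemma V_gap: "j < gap n k \<Longrightarrow> V (pos n k + h n + j) = 1"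
proof (induction k arbitrary: n rule: less_induct)
  case (less k)
  show ?case
  proof (cases "k mod r n < r n - 1")
    case True
    then have j: "j < s n ! (k mod r n)" using less.prems by (subst (asm) gap.simps) simp
    have "off n (Suc (k mod r n)) \<le> off n (r n - 1)" using True by (intro off_mono) simp
    then have "off n (k mod r n) + h n + j < h (Suc n)" using j by (simp add: h_Suc)
    then have "V (pos (Suc n) (k div r n) + (off n (k mod r n) + h n + j)) = v (Suc n) ! (off n (k mod r n) + h n + j)"
      by (rule V_block)
    also have "\<dots> = 1" by (rule v_Suc_spacer[OF True j])
    finally show ?thesis by (subst pos_div) (simp add: ac_simps)
  next
    case False
    then have m: "k mod r n = r n - 1" using mod_r_less[of k n] by simp
    have k: "0 < k" using False r_ge[of n] by (intro gr0I) simp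
    have "j < gap (Suc n) (k div r n)" using less.prems False by (subst (asm) gap.simps) simp
    then have "V (pos (Suc n) (k div r n) + h (Suc n) + j) = 1"
      by (intro less.IH div_r_less k)
    then show ?thesis by (subst pos_div) (simp add: m h_Suc ac_simps)
  qed
qed

lemma pos_strict_mono: "strict_mono (pos n)"
  by (rule strict_mono_Suc_iff[THEN iffD2]) (use h_pos in auto)

lemma pos_less: "k < l \<Longrightarrow> pos n k + h n \<le> pos n l"
proof -
  assume "k < l"
  then have "pos n (Suc k) \<le> pos n l" by (metis pos_strict_mono strict_mono_less_eq Suc_leI)
  then show ?thesis by simp
qed

lemma pos_cover: "\<exists>k. pos n k \<le> i \<and> i < pos n (Suc k)"
proof (induction i)
  case 0
  then show ?case using h_pos[of n] by (intro exI[of _ 0]) simp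
next
  case (Suc i)
  then obtain k where k: "pos n k \<le> i" "i < pos n (Suc k)" by blast
  show ?case
  proof (cases "Suc i < pos n (Suc k)")
    case True
    then show ?thesis using k by (intro exI[of _ k]) simp
  next
    case False
    then have "Suc i = pos n (Suc k)" using k by simp
    then show ?thesis using h_pos[of n] by (intro exI[of _ "Suc k"]) simp
  qed
qed

text \<open>
  The two occurrences of \<open>s n\<close> that \<open>s n @ [c] @ s n\<close> has anyway are at the positions 0 and \<open>r n\<close>.
\<close>

lemma spacer_word_shift_eq_0:
  assumes "i0 < r n" and eq: "\<And>i. i < r n - 1 \<Longrightarrow> (s n @ [c] @ s n) ! (i0 + i) = s n ! i"
  shows "i0 = 0"
proof (rule ccontr)
  assume "i0 \<noteq> 0"
  let ?O = "occurrences (s n) (s n @ [c] @ s n)"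
  have "0 \<in> ?O" by (auto simp: occurrences_def nth_append)
  moreover have "r n \<in> ?O" using r_ge[of n]
    by (auto simp: occurrences_def nth_append length_s)
  moreover have "i0 \<in> ?O" using assms by (auto simp: occurrences_def length_s)
  ultimately have "card {0, r n, i0} \<le> card ?O"
    by (intro card_mono) (auto simp: occurrences_def intro: finite_subset[of _ "{..2 * r n}"] simp: length_s)
  moreover have "card {0, r n, i0} = 3" using \<open>i0 \<noteq> 0\<close> assms(1) r_ge[of n] by simp
  ultimately show False using recognizable[of n c] by simp
qed

text \<open>
  A word constantly equal to \<open>a\<close> occurs in \<open>s n @ [a] @ s n\<close> at position 1 as well.
\<close>

lemma spacers_not_constant: "\<exists>a\<in>set (s n). \<exists>b\<in>set (s n). a \<noteq> b"
proof (rule ccontr)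
  assume const: "\<not> ?thesis"
  have l: "length (s n) \<noteq> 0" using r_ge[of n] length_s[of n] by simp
  define a where "a = s n ! 0"
  have eq: "s n ! i = a" if "i < length (s n)" for i
    using const that l unfolding a_def by (metis nth_mem length_greater_0_conv list.size(3))
  have "(1::nat) = 0"
  proof (rule spacer_word_shift_eq_0[where n = n and c = a])
    show "1 < r n" using r_ge[of n] by simp
    fix i assume "i < r n - 1"
    then show "(s n @ [a] @ s n) ! (1 + i) = s n ! i"
      using eq length_s[of n] by (auto simp: nth_append nth_Cons' eq)
  qed
  then show False by simp
qed

text \<open>
  Blocks are recognizable. If the block of level \<open>n + 1\<close> occurs at \<open>p\<close>, its copies of the block of level \<open>n\<close>
  are, by induction, copies from which the limit word was built. They are consecutive, since a block begins
  with 0 and spacers are ones, so \<open>s n\<close> occurs in the sequence of gaps of level \<open>n\<close>. That sequence reads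
  \<open>s n\<close>, \<open>c\<close>, \<open>s n\<close>, \<open>c'\<close>, \<open>s n\<close>, and so on, and an occurrence of \<open>s n\<close> in it lies within some
  \<open>s n @ [c] @ s n\<close>.
\<close>

lemma V_occurrence: "(\<forall>j<h n. V (p + j) = v n ! j) \<longleftrightarrow> p \<in> range (pos n)"
proof
  assume "p \<in> range (pos n)"
  then show "\<forall>j<h n. V (p + j) = v n ! j" using V_block by auto
next
  show "\<forall>j<h n. V (p + j) = v n ! j \<Longrightarrow> p \<in> range (pos n)"
  proof (induction n arbitrary: p)
    case 0
    then have p: "V p = 0" using h_0 by (auto dest: spec[of _ 0])
    obtain k where k: "pos 0 k \<le> p" "p < pos 0 (Suc k)" using pos_cover by blast
    have "p = pos 0 k"
    proof (rule ccontr)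
      assume "p \<noteq> pos 0 k"
      then have "V (pos 0 k + h 0 + (p - (pos 0 k + 1))) = 1"
        using k h_0 by (intro V_gap) auto
      then show False using p k \<open>p \<noteq> pos 0 k\<close> h_0 by simp
    qed
    then show ?case by simp
  next
    case (Suc n)
    have sub: "p + off n i \<in> range (pos n)" if "i < r n" for i
    proof (rule Suc.IH, intro allI impI)
      fix j assume "j < h n"
      then show "V (p + off n i + j) = v n ! j"
        using Suc.prems off_less[OF that] v_Suc_copy[OF that] by (simp add: add.assoc)
    qed
    obtain k where k: "p = pos n k" using sub[of 0] r_ge[of n] by auto
    have step: "gap n (k + i) = s n ! i" if i: "i < r n - 1" and e: "p + off n i = pos n (k + i)" for i
    proof (rule linorder_cases[of "gap n (k + i)" "s n ! i"])
      have z: "V (pos n l) = 0" for l using V_block[of 0 n l] h_pos[of n] v_hd[of n] by simp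
      have sp: "V (p + off n i + h n + j) = 1" if "j < s n ! i" for j
      proof -
        have "off n (Suc i) \<le> off n (r n - 1)" using i by (intro off_mono) simp
        then have "off n i + h n + j < h (Suc n)" using that by (simp add: h_Suc)
        then have "V (p + (off n i + h n + j)) = v (Suc n) ! (off n i + h n + j)" using Suc.prems by blast
        then show ?thesis using v_Suc_spacer[OF i that] by (simp add: add.assoc)
      qed
      {
        assume "gap n (k + i) < s n ! i"
        from sp[OF this] have "V (pos n (Suc (k + i))) = 1" by (simp add: e add.assoc)
        then show ?thesis using z[of "Suc (k + i)"] by simp
      next
        assume "s n ! i < gap n (k + i)"
        from V_gap[OF this] have one: "V (p + off n (Suc i)) = 1" by (simp flip: e add: add.assoc)
        obtain l where "p + off n (Suc i) = pos n l" using sub[of "Suc i"] i by (metis imageE less_diff_conv Suc_eq_plus1)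
        then show ?thesis using z[of l] one by simp
      }
    qed
    have al: "i \<le> r n - 1 \<Longrightarrow> p + off n i = pos n (k + i)" for i
    proof (induction i)
      case (Suc i)
      then show ?case using step[of i] by simp
    qed (simp add: k)
    have g: "gap n (k + i) = s n ! i" if "i < r n - 1" for i using step[OF that al] that by simp
    define q where "q = k div r n"
    define i0 where "i0 = k mod r n"
    have kq: "k = r n * q + i0" by (simp add: q_def i0_def)
    have i0: "i0 < r n" by (simp add: i0_def mod_r_less)
    let ?w = "s n @ [gap (Suc n) q] @ s n"
    have w: "?w ! l = gap n (r n * q + l)" if l: "l < 2 * r n - 1" for l
    proof -
      consider "l < r n - 1" | "l = r n - 1" | "r n \<le> l" by linarith
      then show ?thesis
      proof cases
        case 1
        then show ?thesis using gap_inner[OF 1] by (simp add: nth_append length_s)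
      next
        case 2
        then show ?thesis using gap_last[of n q] by (simp add: nth_append length_s)
      next
        case 3
        have "gap n (r n * Suc q + (l - r n)) = s n ! (l - r n)"
          using 3 l by (intro gap_inner) linarith
        moreover have "r n * Suc q + (l - r n) = r n * q + l" using 3 by simp
        ultimately have "gap n (r n * q + l) = s n ! (l - r n)" by metis
        moreover have "?w ! l = s n ! (l - r n)" using 3 r_ge[of n]
          by (auto simp: nth_append length_s nth_Cons')
        ultimately show ?thesis by simp
      qed
    qed
    have "i0 = 0"
    proof (rule spacer_word_shift_eq_0[OF i0])
      fix i assume i: "i < r n - 1"
      then have "?w ! (i0 + i) = gap n (r n * q + (i0 + i))" using i0 by (intro w) linarith
      also have "\<dots> = s n ! i" using g[OF i] by (simp add: kq add.assoc)
      finally show "?w ! (i0 + i) = s n ! i" .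
    qed
    then have "p = pos (Suc n) q" by (simp add: k kq pos_Suc_level)
    then show ?case by simp
  qed
qed

end

section \<open>Blocks in points of the subshift\<close>

context bounded_rank_one
begin

abbreviation "X \<equiv> word_subshift V"

definition occ :: "nat \<Rightarrow> (int \<Rightarrow> nat) \<Rightarrow> int set" where
  "occ n x = {p. \<forall>j<h n. x (p + int j) = v n ! j}"

lemma occ_nth: "p \<in> occ n x \<Longrightarrow> p \<le> i \<Longrightarrow> i < p + int (h n) \<Longrightarrow> x i = v n ! nat (i - p)"
  unfolding occ_def by (auto dest: spec[of _ "nat (i - p)"])

lemma X_window: "x \<in> X \<Longrightarrow> \<exists>k. \<forall>j<l. x (i + int j) = V (k + j)"
  by (auto simp: word_subshift_def)

lemma V_occ_next:
  assumes "\<forall>j<h n. V (p + j) = v n ! j"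
  shows "\<exists>a\<le>S. (\<forall>j<h n. V (p + h n + a + j) = v n ! j) \<and> (\<forall>j<a. V (p + h n + j) = 1)"
proof -
  obtain k where k: "p = pos n k" using assms V_occurrence[of n p] by auto
  show ?thesis
  proof (intro exI[of _ "gap n k"] conjI allI impI gap_le)
    show "V (p + h n + gap n k + j) = v n ! j" if "j < h n" for j
      using V_block[OF that, of "Suc k"] by (simp add: k)
    show "V (p + h n + j) = 1" if "j < gap n k" for j
      using V_gap[OF that] by (simp add: k)
  qed
qed

lemma V_occ_separated:
  assumes "\<forall>j<h n. V (p + j) = v n ! j" "\<forall>j<h n. V (q + j) = v n ! j" "p < q"
  shows "p + h n \<le> q"
proof -
  obtain k l where kl: "p = pos n k" "q = pos n l"
    using assms(1,2) V_occurrence[of n p] V_occurrence[of n q] by auto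
  then have "k < l" using assms(3) pos_strict_mono[of n] by (simp add: strict_mono_less)
  then show ?thesis using pos_less[of k l n] kl by simp
qed

lemma V_occ_cover: "\<exists>p. (\<forall>j<h n. V (p + j) = v n ! j) \<and> p \<le> i \<and> i < p + h n + S"
proof -
  obtain k where "pos n k \<le> i" "i < pos n (Suc k)" using pos_cover by blast
  then show ?thesis using V_block[of _ n k] gap_le[of n k] by (intro exI[of _ "pos n k"]) auto
qed

text \<open>
  Statements about finitely many letters of the limit word carry over to points of the subshift, because
  every window of a point occurs in the limit word.
\<close>

lemma occ_separated:
  assumes x: "x \<in> X" and p: "p \<in> occ n x" and q: "q \<in> occ n x" and pq: "p < q"
  shows "p + int (h n) \<le> q"
proof (rule ccontr)
  assume less: "\<not> ?thesis"
  define d where "d = nat (q - p)"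
  have d: "q = p + int d" "0 < d" "d < h n" using less pq by (auto simp: d_def)
  obtain k where k: "\<forall>j<2 * h n. x (p + int j) = V (k + j)" using X_window[OF x] by blast
  have "\<forall>j<h n. V (k + j) = v n ! j"
    using k p by (auto simp: occ_def)
  moreover have "\<forall>j<h n. V (k + d + j) = v n ! j"
  proof (intro allI impI)
    fix j assume j: "j < h n"
    have "x (p + int (d + j)) = V (k + (d + j))" using j d by (intro k[rule_format]) simp
    then show "V (k + d + j) = v n ! j" using q j by (simp add: occ_def d(1) add.assoc)
  qed
  ultimately have "k + h n \<le> k + d" using d by (intro V_occ_separated[of n k "k + d"]) auto
  then show False using d by simp
qed

lemma occ_next:
  assumes x: "x \<in> X" and p: "p \<in> occ n x"
  shows "\<exists>a\<le>S. p + int (h n) + int a \<in> occ n x \<and>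
    (\<forall>i. p + int (h n) \<le> i \<longrightarrow> i < p + int (h n) + int a \<longrightarrow> x i = 1)"
proof -
  obtain k where k: "\<forall>j<2 * h n + S. x (p + int j) = V (k + j)" using X_window[OF x] by blast
  have "\<forall>j<h n. V (k + j) = v n ! j" using k p by (auto simp: occ_def)
  from V_occ_next[OF this] obtain a where a: "a \<le> S" "\<forall>j<h n. V (k + h n + a + j) = v n ! j"
    "\<forall>j<a. V (k + h n + j) = 1" by blast
  show ?thesis
  proof (intro exI[of _ a] conjI a allI impI)
    show "p + int (h n) + int a \<in> occ n x"
      unfolding occ_def
    proof (intro CollectI allI impI)
      fix j assume j: "j < h n"
      have "x (p + int (h n + a + j)) = V (k + (h n + a + j))" using j a(1) by (intro k[rule_format]) simp
      then show "x (p + int (h n) + int a + int j) = v n ! j" using a(2) j by (simp add: add.assoc)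
    qed
    fix i assume i: "p + int (h n) \<le> i" "i < p + int (h n) + int a"
    define j where "j = nat (i - (p + int (h n)))"
    have j: "j < a" "i = p + int (h n + j)" using i by (auto simp: j_def)
    have "x (p + int (h n + j)) = V (k + (h n + j))" using j(1) a(1) by (intro k[rule_format]) simp
    then show "x i = 1" using a(3) j by (simp add: ac_simps)
  qed
qed

lemma occ_cover:
  assumes x: "x \<in> X"
  shows "\<exists>p\<in>occ n x. p \<le> i \<and> i < p + int (h n) + int S"
proof -
  define o' where "o' = i - int (h n + S)"
  obtain k where k: "\<forall>j<2 * h n + S + 1. x (o' + int j) = V (k + j)" using X_window[OF x] by blast
  obtain p where p: "\<forall>j<h n. V (p + j) = v n ! j" "p \<le> k + h n + S" "k + h n + S < p + h n + S"
    using V_occ_cover[of n "k + h n + S"] by blast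
  define d where "d = p - k"
  have d: "p = k + d" "d \<le> h n + S" "0 < d" using p by (auto simp: d_def)
  show ?thesis
  proof (intro bexI conjI)
    show "o' + int d \<in> occ n x"
      unfolding occ_def
    proof (intro CollectI allI impI)
      fix j assume j: "j < h n"
      have "x (o' + int (d + j)) = V (k + (d + j))" using j d by (intro k[rule_format]) simp
      then show "x (o' + int d + int j) = v n ! j" using p(1) j d(1) by (simp add: add.assoc)
    qed
    show "o' + int d \<le> i" "i < o' + int d + int (h n) + int S" using d by (auto simp: o'_def)
  qed
qed

text \<open>
  When blocks are longer than \<open>S\<close>, there is no room for a further block between \<open>p\<close> and \<open>q\<close>.
\<close>

lemma occ_next_eq:
  assumes x: "x \<in> X" and S: "S < h n" and p: "p \<in> occ n x" and q: "q \<in> occ n x"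
    and pq: "p < q" "q \<le> p + int (h n) + int S"
  shows "p + int (h n) \<le> q \<and> (\<forall>i. p + int (h n) \<le> i \<longrightarrow> i < q \<longrightarrow> x i = 1)"
proof -
  have le: "p + int (h n) \<le> q" by (rule occ_separated[OF x p q pq(1)])
  obtain a where a: "a \<le> S" "p + int (h n) + int a \<in> occ n x"
    "\<forall>i. p + int (h n) \<le> i \<longrightarrow> i < p + int (h n) + int a \<longrightarrow> x i = 1"
    using occ_next[OF x p] by blast
  have "q = p + int (h n) + int a"
  proof (rule linorder_cases[of q "p + int (h n) + int a"])
    assume "q < p + int (h n) + int a"
    from occ_separated[OF x q a(2) this] show ?thesis using le a(1) S by simp
  next
    assume "p + int (h n) + int a < q"
    from occ_separated[OF x a(2) q this] show ?thesis using pq(2) S by simp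
  qed
  then show ?thesis using a(3) le by blast
qed

lemma occ_Suc_copy: "q \<in> occ (Suc n) x \<Longrightarrow> i < r n \<Longrightarrow> q + int (off n i) \<in> occ n x"
  unfolding occ_def
proof (intro CollectI allI impI)
  fix j assume q: "q \<in> {p. \<forall>j<h (Suc n). x (p + int j) = v (Suc n) ! j}" and i: "i < r n" and j: "j < h n"
  have "x (q + int (off n i + j)) = v (Suc n) ! (off n i + j)"
    using q off_less[OF i j] by blast
  then show "x (q + int (off n i) + int j) = v n ! j" using v_Suc_copy[OF i j] by (simp add: ac_simps)
qed

text \<open>
  The spacers between the copies consist of ones by \<open>occ_next_eq\<close>, so the positions of the copies determine
  the block.
\<close>

lemma occ_SucI:
  assumes x: "x \<in> X" and S: "S < h n" and q: "\<And>i. i < r n \<Longrightarrow> q + int (off n i) \<in> occ n x"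
  shows "q \<in> occ (Suc n) x"
  unfolding occ_def
proof (intro CollectI allI impI)
  fix j assume j: "j < h (Suc n)"
  from copy_start_cover[of j "h n" "s n" "r n - 1"] j h_pos[of n]
  consider (copy) i l where "i \<le> r n - 1" "l < h n" "j = off n i + l"
    | (spacer) i l where "i < r n - 1" "l < s n ! i" "j = off n i + h n + l"
    unfolding h_Suc by blast
  then show "x (q + int j) = v (Suc n) ! j"
  proof cases
    case copy
    then have i: "i < r n" using r_ge[of n] by simp
    show ?thesis using q[OF i] copy(2,3) v_Suc_copy[OF i copy(2)] by (simp add: occ_def ac_simps)
  next
    case spacer
    have i: "i < r n" "Suc i < r n" using spacer(1) by auto
    have "s n ! i \<le> S" using s_nth_le[OF spacer(1)] .
    then have "\<forall>t. q + int (off n i) + int (h n) \<le> t \<longrightarrow> t < q + int (off n (Suc i)) \<longrightarrow> x t = 1"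
      using occ_next_eq[OF x S q[OF i(1)] q[OF i(2)]] h_pos[of n] by simp
    then have "x (q + int j) = 1" using spacer(2,3) by auto
    then show ?thesis using v_Suc_spacer[OF spacer(1,2)] spacer(3) by simp
  qed
qed

definition gap_change :: "nat \<Rightarrow> (int \<Rightarrow> nat) \<Rightarrow> (int \<Rightarrow> nat) \<Rightarrow> int \<Rightarrow> int \<Rightarrow> nat \<Rightarrow> nat \<Rightarrow> bool" where
  "gap_change n x y p d a b \<longleftrightarrow>
     p \<in> occ n x \<and> p + int (h n) + int a \<in> occ n x \<and>
     p + d \<in> occ n y \<and> p + d + int (h n) + int b \<in> occ n y \<and> a \<le> S \<and> b \<le> S \<and> a \<noteq> b"

text \<open>
  While matched blocks are followed by equal gaps, the next blocks are matched at the same offset.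
\<close>

lemma aligned_until:
  assumes x: "x \<in> X" and y: "y \<in> X" and S: "S < h n"
    and no: "\<And>p a b. p0 \<le> p \<Longrightarrow> p \<le> L \<Longrightarrow> \<not> gap_change n x y p d a b"
    and p0: "p0 \<in> occ n x" "p0 + d \<in> occ n y"
  shows aligned_occ: "p \<in> occ n x \<Longrightarrow> p0 \<le> p \<Longrightarrow> p \<le> L \<Longrightarrow> p + d \<in> occ n y"
    and aligned_letter: "p0 \<le> i \<Longrightarrow> i \<le> L \<Longrightarrow> x i = y (i + d)"
proof -
  have cover: "\<exists>p\<in>occ n x. p0 \<le> p \<and> p \<le> i \<and> i < p + int (h n) + int S" if i: "p0 \<le> i" for i
  proof -
    obtain p where p: "p \<in> occ n x" "p \<le> i" "i < p + int (h n) + int S" using occ_cover[OF x] by blast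
    show ?thesis
    proof (cases "p0 \<le> p")
      case True
      then show ?thesis using p by blast
    next
      case False
      then have "p + int (h n) \<le> p0" using occ_separated[OF x p(1) p0(1)] by simp
      then show ?thesis using p i p0 by (intro bexI[of _ p0]) auto
    qed
  qed
  have same: "\<exists>a\<le>S. p + int (h n) + int a \<in> occ n x \<and> p + int (h n) + int a + d \<in> occ n y \<and>
      (\<forall>i. p + int (h n) \<le> i \<longrightarrow> i < p + int (h n) + int a \<longrightarrow> x i = 1 \<and> y (i + d) = 1)"
    if p: "p \<in> occ n x" "p + d \<in> occ n y" "p0 \<le> p" "p \<le> L" for p
  proof -
    obtain a where a: "a \<le> S" "p + int (h n) + int a \<in> occ n x"
      "\<forall>i. p + int (h n) \<le> i \<longrightarrow> i < p + int (h n) + int a \<longrightarrow> x i = 1"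
      using occ_next[OF x p(1)] by blast
    obtain b where b: "b \<le> S" "p + d + int (h n) + int b \<in> occ n y"
      "\<forall>i. p + d + int (h n) \<le> i \<longrightarrow> i < p + d + int (h n) + int b \<longrightarrow> y i = 1"
      using occ_next[OF y p(2)] by blast
    have "a = b" using no[OF p(3,4), of a b] a b p by (auto simp: gap_change_def)
    show ?thesis
    proof (intro exI[of _ a] conjI allI impI a)
      show "p + int (h n) + int a + d \<in> occ n y" using b(2) \<open>a = b\<close> by (simp add: ac_simps)
      fix i assume "p + int (h n) \<le> i" "i < p + int (h n) + int a"
      then show "x i = 1" "y (i + d) = 1" using a(3) b(3)[rule_format, of "i + d"] \<open>a = b\<close> by auto
    qed
  qed
  have occ: "p \<in> occ n x \<Longrightarrow> p0 \<le> p \<Longrightarrow> p \<le> L \<Longrightarrow> p + d \<in> occ n y" for p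
  proof (induction "nat (p - p0)" arbitrary: p rule: less_induct)
    case less
    show ?case
    proof (cases "p = p0")
      case True
      then show ?thesis using p0 by simp
    next
      case False
      then obtain q where q: "q \<in> occ n x" "p0 \<le> q" "q \<le> p - 1" "p - 1 < q + int (h n) + int S"
        using cover[of "p - 1"] less.prems by auto
      have "q + d \<in> occ n y" using q less.prems by (intro less.hyps) auto
      then obtain a where a: "a \<le> S" "q + int (h n) + int a \<in> occ n x" "q + int (h n) + int a + d \<in> occ n y"
        using same[of q] q less.prems by auto
      have le: "q + int (h n) \<le> p" using occ_separated[OF x q(1) less.prems(1)] q by simp
      have "p = q + int (h n) + int a"
      proof (rule linorder_cases[of p "q + int (h n) + int a"])
        assume "p < q + int (h n) + int a"
        from occ_separated[OF x less.prems(1) a(2) this] show ?thesis using le a(1) S by simp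
      next
        assume "q + int (h n) + int a < p"
        from occ_separated[OF x a(2) less.prems(1) this] show ?thesis using q(4) S by simp
      qed
      then show ?thesis using a(3) by simp
    qed
  qed
  show "p \<in> occ n x \<Longrightarrow> p0 \<le> p \<Longrightarrow> p \<le> L \<Longrightarrow> p + d \<in> occ n y" by (rule occ)
  show "x i = y (i + d)" if i: "p0 \<le> i" "i \<le> L"
  proof -
    have block: "x i = y (i + d)" if "p \<in> occ n x" "p + d \<in> occ n y" "p \<le> i" "i < p + int (h n)" for p
      using occ_nth[OF that(1,3,4)] occ_nth[OF that(2), of "i + d"] that by simp
    obtain p where p: "p \<in> occ n x" "p0 \<le> p" "p \<le> i" "i < p + int (h n) + int S" using cover[OF i(1)] by blast
    have pd: "p + d \<in> occ n y" using p i by (intro occ) auto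
    obtain a where a: "a \<le> S" "p + int (h n) + int a \<in> occ n x" "p + int (h n) + int a + d \<in> occ n y"
      "\<forall>i. p + int (h n) \<le> i \<longrightarrow> i < p + int (h n) + int a \<longrightarrow> x i = 1 \<and> y (i + d) = 1"
      using same[of p] p pd i by auto
    consider "i < p + int (h n)" | "p + int (h n) \<le> i" "i < p + int (h n) + int a" | "p + int (h n) + int a \<le> i"
      by linarith
    then show ?thesis
    proof cases
      case 1
      then show ?thesis using block p pd by blast
    next
      case 2
      then show ?thesis using a(4) by simp
    next
      case 3
      then show ?thesis using block[OF a(2,3)] p(4) S by simp
    qed
  qed
qed

definition forward_asymptotic :: "(int \<Rightarrow> nat) \<Rightarrow> (int \<Rightarrow> nat) \<Rightarrow> bool" where
  "forward_asymptotic x y \<longleftrightarrow> (\<exists>d i0. \<forall>i\<ge>i0. x i = y (i + d))"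

text \<open>
  Otherwise, from some level on, matched blocks near the origin are always followed by equal gaps. Then a
  matching at offset \<open>d\<close> persists for a time in which \<open>x\<close> passes through a complete block of level \<open>n + 1\<close>,
  which is therefore matched at the same offset \<open>d\<close>. This continues through all levels. A matching whose
  offset is about \<open>h n / 2\<close> at most exists at the initial level, and the condition on the offset is weaker at
  higher levels.
\<close>

lemma gap_changes_or_asymptotic:
  assumes x: "x \<in> X" and y: "y \<in> X" and na: "\<not> forward_asymptotic x y"
  shows "\<exists>n\<ge>N. \<exists>p d a b. 0 \<le> p \<and> p \<le> int ((4 + 4 * R) * h n) \<and> 2 * \<bar>d\<bar> \<le> int (h n) + 2 * int S \<and>
    gap_change n x y p d a b"
proof (rule ccontr)
  assume contra: "\<not> ?thesis"
  (* A matching that starts before 3 * h n and persists up to C * h n covers the first block of level n + 1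
     after its start, which begins before 3 * h (n + 1). *)
  define C where "C = 4 + 4 * R"
  define n0 where "n0 = max N (Suc S)"
  have no: "\<not> gap_change n x y p d a b"
    if "n0 \<le> n" "0 \<le> p" "p \<le> int (C * h n)" "2 * \<bar>d\<bar> \<le> int (h n) + 2 * int S" for n p d a b
    using contra that unfolding C_def n0_def by (metis max.bounded_iff)
  have S: "S < h n" if "n0 \<le> n" for n using h_ge[of n] that unfolding n0_def by simp
  have C: "3 * h n + h (Suc n) + h (Suc n) + S \<le> C * h n" if "n0 \<le> n" for n
  proof -
    have "h (Suc n) \<le> R * (h n + h n)"
      using h_Suc_le[of n] S[OF that] by (meson add_le_cancel_left less_imp_le mult_le_mono2 order_trans)
    then show ?thesis using S[OF that] by (simp add: C_def algebra_simps)
  qed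
  obtain p0 where p0: "p0 \<in> occ n0 x" "0 \<le> p0" "p0 \<le> int (3 * h n0)"
  proof -
    obtain p where "p \<in> occ n0 x" "p \<le> int (h n0 + S)" "int (h n0 + S) < p + int (h n0) + int S"
      using occ_cover[OF x, of n0 "int (h n0 + S)"] by blast
    then show ?thesis using S[of n0] by (intro that[of p]) auto
  qed
  (* The block of y before p0 or the one after it is close enough to p0. *)
  obtain d where d: "p0 + d \<in> occ n0 y" "2 * \<bar>d\<bar> \<le> int (h n0) + 2 * int S"
  proof -
    obtain q where q: "q \<in> occ n0 y" "q \<le> p0" "p0 < q + int (h n0) + int S"
      using occ_cover[OF y, of n0 p0] by blast
    obtain a where a: "a \<le> S" "q + int (h n0) + int a \<in> occ n0 y" using occ_next[OF y q(1)] by blast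
    show ?thesis
    proof (cases "2 * (p0 - q) \<le> int (h n0) + 2 * int S")
      case True
      then show ?thesis using q by (intro that[of "q - p0"]) auto
    next
      case False
      define E where "E = q + int (h n0) + int a"
      have "int a \<le> int S" using a(1) by simp
      moreover have "0 \<le> int (h n0)" "0 \<le> int a" by simp_all
      ultimately have "2 * \<bar>E - p0\<bar> \<le> int (h n0) + 2 * int S"
        using False q(3) by (simp add: abs_if E_def)
      moreover have "E \<in> occ n0 y" using a(2) by (simp only: E_def)
      moreover have "p0 + (E - p0) = E" by simp
      ultimately show ?thesis by (intro that[of "E - p0"]) (simp_all only:)
    qed
  qed
  have d': "2 * \<bar>d\<bar> \<le> int (h n) + 2 * int S" if "n0 \<le> n" for n
    using d(2) h_mono[OF that] by linarith
  have Q: "\<exists>p\<in>occ n x. 0 \<le> p \<and> p \<le> int (3 * h n) \<and> p + d \<in> occ n y \<and>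
      (\<forall>i. p0 \<le> i \<longrightarrow> i \<le> int (C * h n) \<longrightarrow> x i = y (i + d))" if "n0 \<le> n" for n
    using that
  proof (induction n rule: dec_induct)
    case base
    have "x i = y (i + d)" if "p0 \<le> i" "i \<le> int (C * h n0)" for i
    proof (rule aligned_letter[OF x y S[OF order_refl] _ p0(1) d(1) that])
      show "\<not> gap_change n0 x y p' d a b" if "p0 \<le> p'" "p' \<le> int (C * h n0)" for p' a b
        using that p0(2) by (intro no[OF order_refl _ _ d'[OF order_refl]]) linarith+
    qed
    then show ?case using p0 d by blast
  next
    case (step n)
    then obtain p where p: "p \<in> occ n x" "0 \<le> p" "p \<le> int (3 * h n)" "p + d \<in> occ n y"
      "\<forall>i. p0 \<le> i \<longrightarrow> i \<le> int (C * h n) \<longrightarrow> x i = y (i + d)" by blast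
    note n = \<open>n0 \<le> n\<close>
    have n': "n0 \<le> Suc n" using n by simp
    obtain q where q: "q \<in> occ (Suc n) x" "q \<le> p + int (h (Suc n) + S)" "p + int (h (Suc n) + S) < q + int (h (Suc n)) + int S"
      using occ_cover[OF x, of "Suc n" "p + int (h (Suc n) + S)"] by blast
    have pq: "p < q" using q(3) by simp
    have qd: "q + d \<in> occ (Suc n) y"
    proof (rule occ_SucI[OF y S[OF n]])
      fix i assume i: "i < r n"
      have "off n i \<le> h (Suc n)" using off_less[OF i h_pos] by simp
      then have le: "q + int (off n i) \<le> int (C * h n)" using q(2) p(3) C[OF n] by linarith
      have "q + int (off n i) + d \<in> occ n y"
      proof (rule aligned_occ[OF x y S[OF n] _ p(1,4) occ_Suc_copy[OF q(1) i] _ le])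
        show "\<not> gap_change n x y p' d a b" if "p \<le> p'" "p' \<le> int (C * h n)" for p' a b
          using that p(2) by (intro no[OF n _ _ d'[OF n]]) linarith+
        show "p \<le> q + int (off n i)" using pq by linarith
      qed
      then show "q + d + int (off n i) \<in> occ n y" by (simp add: ac_simps)
    qed
    have q3: "q \<le> int (3 * h (Suc n))" using q(2) p(3) h_Suc_ge[of n] S[OF n] by linarith
    have qC: "q \<le> int (C * h n)" using q(2) p(3) C[OF n] by linarith
    have "x i = y (i + d)" if i: "p0 \<le> i" "i \<le> int (C * h (Suc n))" for i
    proof (cases "i \<le> int (C * h n)")
      case True
      then show ?thesis using p(5) i by blast
    next
      case False
      show ?thesis
      proof (rule aligned_letter[OF x y S[OF n'] _ q(1) qd _ i(2)])
        show "\<not> gap_change (Suc n) x y p' d a b" if "q \<le> p'" "p' \<le> int (C * h (Suc n))" for p' a b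
          using that p(2) pq by (intro no[OF n' _ _ d'[OF n']]) linarith+
        show "q \<le> i" using False qC by linarith
      qed
    qed
    then show ?case using q(1) q3 pq p(2) qd by (intro bexI[of _ q]) auto
  qed
  have "x i = y (i + d)" if "p0 \<le> i" for i
  proof -
    define n where "n = max n0 (nat i)"
    have "nat i \<le> 1 * h n" using h_ge[of n] by (simp add: n_def)
    also have "\<dots> \<le> C * h n" by (intro mult_le_mono1) (simp add: C_def)
    finally have "i \<le> int (C * h n)" by linarith
    then show ?thesis using Q[of n] that by (auto simp: n_def)
  qed
  then have "forward_asymptotic x y" unfolding forward_asymptotic_def by blast
  then show False using na by simp
qed

end

section \<open>Simultaneous recurrence of several points\<close>

context bounded_rank_one
begin

text \<open>
  Translation by \<open>h n + a\<close> passes one block and the gap \<open>e\<close> after it, up to the bounded error \<open>a - e\<close>.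
\<close>

lemma recurrence_in_block:
  assumes p: "p \<in> occ n z" and q: "p + int (h n) + int e \<in> occ n z"
    and i: "p + int S \<le> i" "i < p + int (h n) - int S" and ae: "a \<le> S" "e \<le> S"
  shows "z (i + (int (h n) + int a)) = z (i + (int a - int e))"
proof -
  have "z (i + (int (h n) + int a)) = v n ! nat (i + (int a - int e) - p)"
    using occ_nth[OF q, of "i + (int (h n) + int a)"] i ae by (simp add: algebra_simps)
  also have "\<dots> = z (i + (int a - int e))"
    using occ_nth[OF p, of "i + (int a - int e)"] i ae by simp
  finally show ?thesis .
qed

text \<open>
  An interval that is not longer than a block is covered, up to gaps, by two consecutive blocks, and one of
  them contains about half of it. The loss of \<open>8 * S\<close> in \<open>2 * l'\<close> accounts for gaps and for cutting off \<open>S\<close>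
  letters at both ends, where the translation by \<open>b\<close> could leave the block.
\<close>

lemma recurrence_subinterval:
  assumes z: "z \<in> X" and l: "0 \<le> l" "l \<le> int (h n)" and a: "a \<le> S"
  shows "\<exists>u' l' b. \<bar>b\<bar> \<le> int S \<and> u \<le> u' \<and> u' + l' \<le> u + l \<and> 0 \<le> l' \<and> l - 8 * int S \<le> 2 * l' \<and>
    (\<forall>i. u' \<le> i \<longrightarrow> i < u' + l' \<longrightarrow> z (i + (int (h n) + int a)) = z (i + b))"
proof -
  have "\<exists>u' l' b. \<bar>b\<bar> \<le> int S \<and> u \<le> u' \<and> u' + l' \<le> u + l \<and> l - 8 * int S \<le> 2 * l' \<and>
    (\<forall>i. u' \<le> i \<longrightarrow> i < u' + l' \<longrightarrow> z (i + (int (h n) + int a)) = z (i + b))"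
  proof -
  obtain p where p: "p \<in> occ n z" "p \<le> u" "u < p + int (h n) + int S" using occ_cover[OF z] by blast
  obtain e where e: "e \<le> S" "p + int (h n) + int e \<in> occ n z" using occ_next[OF z p(1)] by blast
  define q where "q = p + int (h n) + int e"
  have q: "q \<in> occ n z" using e by (simp add: q_def)
  obtain e' where e': "e' \<le> S" "q + int (h n) + int e' \<in> occ n z" using occ_next[OF z q] by blast
  show ?thesis
  proof (cases "l \<le> 2 * (p + int (h n) - u)")
    case True
    define r' where "r' = min (p + int (h n)) (u + l)"
    show ?thesis
    proof (rule exI[of _ "u + int S"], rule exI[of _ "r' - u - 2 * int S"], rule exI[of _ "int a - int e"],
        intro conjI allI impI)
      show "\<bar>int a - int e\<bar> \<le> int S" using a e by simp
      show "u \<le> u + int S" "u + int S + (r' - u - 2 * int S) \<le> u + l"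
        "l - 8 * int S \<le> 2 * (r' - u - 2 * int S)"
        using True l(1) by (auto simp: r'_def min_def)
      fix i assume "u + int S \<le> i" "i < u + int S + (r' - u - 2 * int S)"
      then show "z (i + (int (h n) + int a)) = z (i + (int a - int e))"
        using p(2) by (intro recurrence_in_block[OF p(1) e(2) _ _ a e(1)]) (auto simp: r'_def)
    qed
  next
    case False
    define u' where "u' = max u q"
    have qu: "q < u + l - (p + int (h n) - u) + int S" "2 * (q - u) \<le> l + 2 * int S" "u - int S \<le> q"
      using False p e by (auto simp: q_def)
    show ?thesis
    proof (rule exI[of _ "u' + int S"], rule exI[of _ "u + l - u' - 3 * int S"], rule exI[of _ "int a - int e'"],
        intro conjI allI impI)
      show "\<bar>int a - int e'\<bar> \<le> int S" using a e' by simp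
      show "u \<le> u' + int S" "u' + int S + (u + l - u' - 3 * int S) \<le> u + l"
        by (auto simp: u'_def)
      show "l - 8 * int S \<le> 2 * (u + l - u' - 3 * int S)"
      proof (cases "u \<le> q")
        case True
        then show ?thesis using qu by (simp add: u'_def)
      next
        case f: False
        have "0 \<le> l" by (rule l(1))
        then show ?thesis using f by (simp add: u'_def)
      qed
      fix i assume "u' + int S \<le> i" "i < u' + int S + (u + l - u' - 3 * int S)"
      then show "z (i + (int (h n) + int a)) = z (i + (int a - int e'))"
        using qu l by (intro recurrence_in_block[OF q e'(2) _ _ a e'(1)]) (auto simp: u'_def)
    qed
  qed
qed
  then obtain u' l' b where b: "\<bar>b\<bar> \<le> int S" "u \<le> u'" "u' + l' \<le> u + l" "l - 8 * int S \<le> 2 * l'"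
    "\<forall>i. u' \<le> i \<longrightarrow> i < u' + l' \<longrightarrow> z (i + (int (h n) + int a)) = z (i + b)" by blast
  show ?thesis
  proof (cases "0 \<le> l'")
    case True
    then show ?thesis using b by blast
  next
    case False
    show ?thesis
      by (rule exI[of _ u], rule exI[of _ 0], rule exI[of _ b]) (use False b l in auto)
  qed
qed

text \<open>
  Each further point halves the interval once more.
\<close>

lemma recurrence_subinterval_finite:
  fixes x :: "'i \<Rightarrow> int \<Rightarrow> nat"
  assumes K: "finite K" and x: "\<And>j. j \<in> K \<Longrightarrow> x j \<in> X" and l: "0 \<le> l" "l \<le> int (h n)" and a: "a \<le> S"
  shows "\<exists>u' l' b. 0 \<le> l' \<and> (\<forall>j\<in>K. \<bar>b j\<bar> \<le> int S) \<and> u \<le> u' \<and> u' + l' \<le> u + l \<and>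
    l - 8 * int S * 2 ^ card K \<le> 2 ^ card K * l' \<and>
    (\<forall>j\<in>K. \<forall>i. u' \<le> i \<longrightarrow> i < u' + l' \<longrightarrow> x j (i + (int (h n) + int a)) = x j (i + b j))"
  using K x
proof (induction K rule: finite_induct)
  case empty
  show ?case by (rule exI[of _ u], rule exI[of _ l]) (use l in auto)
next
  case (insert k K)
  from insert.IH insert.prems obtain u' l' b where l': "0 \<le> l'" and b: "\<forall>j\<in>K. \<bar>b j\<bar> \<le> int S" "u \<le> u'" "u' + l' \<le> u + l"
    "l - 8 * int S * 2 ^ card K \<le> 2 ^ card K * l'"
    "\<forall>j\<in>K. \<forall>i. u' \<le> i \<longrightarrow> i < u' + l' \<longrightarrow> x j (i + (int (h n) + int a)) = x j (i + b j)"
    by auto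
  have "l' \<le> int (h n)" using b l by linarith
  from recurrence_subinterval[OF insert.prems[of k] l' this a, of u']
  obtain u'' l'' b' where l'': "0 \<le> l''" and b': "\<bar>b'\<bar> \<le> int S" "u' \<le> u''" "u'' + l'' \<le> u' + l'" "l' - 8 * int S \<le> 2 * l''"
    "\<forall>i. u'' \<le> i \<longrightarrow> i < u'' + l'' \<longrightarrow> x k (i + (int (h n) + int a)) = x k (i + b')" by auto
  show ?case
  proof (rule exI[of _ u''], rule exI[of _ l''], rule exI[of _ "b(k := b')"], intro conjI ballI allI impI)
    show "0 \<le> l''" by (rule l'')
    show "\<bar>(b(k := b')) j\<bar> \<le> int S" if "j \<in> insert k K" for j using that b(1) b'(1) by auto
    show "u \<le> u''" "u'' + l'' \<le> u + l" using b b' by linarith+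
    have "l - 8 * int S * 2 ^ card K - 8 * int S * 2 ^ card K \<le> 2 ^ card K * l' - 2 ^ card K * (8 * int S)"
      using b(4) by simp
    also have "\<dots> = 2 ^ card K * (l' - 8 * int S)" by (simp add: algebra_simps)
    also have "\<dots> \<le> 2 ^ card K * (2 * l'')" using b'(4) by simp
    finally show "l - 8 * int S * 2 ^ card (insert k K) \<le> 2 ^ card (insert k K) * l''"
      using insert.hyps by simp
    fix j i assume ji: "j \<in> insert k K" "u'' \<le> i" "i < u'' + l''"
    show "x j (i + (int (h n) + int a)) = x j (i + (b(k := b')) j)"
      using ji b(5) b'(2,3,5) insert.hyps(2) by (cases "j = k") auto
  qed
qed

text \<open>
  On the overlap of the two blocks the translation by \<open>h n + a\<close> is the identity for the first point and the
  translation by \<open>a - b'\<close> for the second one. The overlap is then shortened to suit the other points.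
\<close>

lemma common_recurrence_level:
  fixes x :: "'i \<Rightarrow> int \<Rightarrow> nat"
  assumes I: "finite I" and x: "\<And>j. j \<in> I \<Longrightarrow> x j \<in> X" and k: "k1 \<noteq> k2"
    and g: "gap_change n (x k1) (x k2) p d a b'" and d: "2 * \<bar>d\<bar> \<le> int (h n) + 2 * int S"
    and p: "0 \<le> p" "p \<le> int (C * h n)" and H: "32 * S * 2 ^ card I + 12 * S \<le> h n" "S < h n"
  shows "\<exists>b::'i \<Rightarrow> int. \<exists>u l t::nat. b k1 \<noteq> b k2 \<and> (\<forall>j\<in>I. \<bar>b j\<bar> \<le> int S) \<and>
    u + l \<le> (C + 2) * h n \<and> t \<le> (C + 2) * h n \<and> h n \<le> 2 ^ (card I + 2) * l \<and>
    (\<forall>j\<in>I. \<forall>i. int u \<le> i \<longrightarrow> i < int u + int l \<longrightarrow> x j (i + int t) = x j (i + b j))"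
proof -
  note g' = g[unfolded gap_change_def]
  have ab: "a \<le> S" "b' \<le> S" "a \<noteq> b'" using g' by auto
  define K where "K = I - {k1, k2}"
  have K: "finite K" "\<And>j. j \<in> K \<Longrightarrow> x j \<in> X" "card K \<le> card I"
    using I x by (auto simp: K_def intro: card_mono)
  define U where "U = max p (p + d) + int S"
  define L where "L = min p (p + d) + int (h n) - int S - U"
  have L: "L \<le> int (h n)" "int (h n) - 6 * int S \<le> 2 * L"
    using d by (auto simp: L_def U_def min_def max_def abs_if split: if_splits)
  have L0: "0 \<le> L" using L(2) H(1) by linarith
  obtain u l b where l0: "0 \<le> l" and b: "\<forall>j\<in>K. \<bar>b j\<bar> \<le> int S" "U \<le> u" "u + l \<le> U + L"
    "L - 8 * int S * 2 ^ card K \<le> 2 ^ card K * l"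
    "\<forall>j\<in>K. \<forall>i. u \<le> i \<longrightarrow> i < u + l \<longrightarrow> x j (i + (int (h n) + int a)) = x j (i + b j)"
    using recurrence_subinterval_finite[where x = x and u = U, OF K(1,2) L0 L(1) ab(1)] by blast
  have pw: "(2::int) ^ card K \<le> 2 ^ card I" using K(3) by simp
  have H': "32 * (int S * 2 ^ card I) + 12 * int S \<le> int (h n)"
    using H(1) by (metis (mono_tags) mult.assoc of_nat_add of_nat_le_iff of_nat_mult of_nat_numeral of_nat_power)
  have SK: "int S * 2 ^ card K \<le> int S * 2 ^ card I" using pw by (intro mult_left_mono) auto
  have big: "int (h n) \<le> 4 * (2 ^ card K * l)"
    using b(4) L(2) H' SK by linarith
  have big': "int (h n) \<le> 2 ^ (card I + 2) * l"
    using big mult_right_mono[OF pw l0] by (simp add: power_add)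
  have u0: "0 \<le> u" using b(2) p(1) by (auto simp: U_def)
  have ul: "u + l \<le> p + int (h n)" using b(3) by (auto simp: U_def L_def)
  show ?thesis
  proof (rule exI[of _ "b(k1 := 0, k2 := int a - int b')"], rule exI[of _ "nat u"], rule exI[of _ "nat l"],
      rule exI[of _ "h n + a"], intro conjI ballI allI impI)
    show "(b(k1 := 0, k2 := int a - int b')) k1 \<noteq> (b(k1 := 0, k2 := int a - int b')) k2"
      using ab(3) k by simp
    show "\<bar>(b(k1 := 0, k2 := int a - int b')) j\<bar> \<le> int S" if "j \<in> I" for j
      using that b(1) ab by (auto simp: K_def)
    have "int (nat u + nat l) \<le> int ((C + 2) * h n)" using ul u0 l0 p(2) by (simp add: algebra_simps)
    then show "nat u + nat l \<le> (C + 2) * h n" by (simp only: of_nat_le_iff)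
    show "h n + a \<le> (C + 2) * h n" using ab(1) H(2) by (simp add: algebra_simps)
    have "int (h n) \<le> int (2 ^ (card I + 2) * nat l)" using big' l0 by simp
    then show "h n \<le> 2 ^ (card I + 2) * nat l" by (simp only: of_nat_le_iff)
    fix j i assume j: "j \<in> I" and i: "int (nat u) \<le> i" "i < int (nat u) + int (nat l)"
    have i': "u \<le> i" "i < u + l" using i u0 l0 by auto
    have iU: "U \<le> i" "i < U + L" using i' b(2,3) by auto
    consider "j = k1" | "j = k2" | "j \<in> K" using j by (auto simp: K_def)
    then show "x j (i + int (h n + a)) = x j (i + (b(k1 := 0, k2 := int a - int b')) j)"
    proof cases
      case 1
      have "x k1 (i + (int (h n) + int a)) = x k1 (i + (int a - int a))"
        using g' iU by (intro recurrence_in_block[of p n "x k1" a]) (auto simp: U_def L_def)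
      then show ?thesis using 1 k by simp
    next
      case 2
      have "x k2 (i + (int (h n) + int a)) = x k2 (i + (int a - int b'))"
        using g' iU by (intro recurrence_in_block[of "p + d" n "x k2" b']) (auto simp: U_def L_def)
      then show ?thesis using 2 k by simp
    next
      case 3
      then show ?thesis using b(5) i' k by (auto simp: K_def)
    qed
  qed
qed

text \<open>
  The translations of the individual points are bounded by \<open>S\<close>, so by the pigeonhole principle the same ones
  serve for infinitely many levels.
\<close>

lemma common_recurrence:
  fixes x :: "'i \<Rightarrow> int \<Rightarrow> nat"
  assumes I: "finite I" and x: "\<And>j. j \<in> I \<Longrightarrow> x j \<in> X" and k: "k1 \<in> I" "k2 \<in> I"
    and na: "\<not> forward_asymptotic (x k1) (x k2)"
  shows "\<exists>b::'i \<Rightarrow> int. b k1 \<noteq> b k2 \<and> (\<exists>D>0. \<forall>H. \<exists>q\<ge>H. \<exists>u l t::nat.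
    u + l \<le> D * q \<and> t \<le> D * q \<and> q \<le> D * l \<and>
    (\<forall>j\<in>I. \<forall>i. int u \<le> i \<longrightarrow> i < int u + int l \<longrightarrow> x j (i + int t) = x j (i + b j)))"
proof -
  have "forward_asymptotic z z" for z
    unfolding forward_asymptotic_def by (rule exI[of _ 0]) simp
  then have k12: "k1 \<noteq> k2" using na by auto
  define C where "C = 4 + 4 * R"
  define D where "D = C + 2 + 2 ^ (card I + 2)"
  define good where "good n b \<longleftrightarrow> (\<exists>u l t::nat.
    u + l \<le> D * h n \<and> t \<le> D * h n \<and> h n \<le> D * l \<and>
    (\<forall>j\<in>I. \<forall>i. int u \<le> i \<longrightarrow> i < int u + int l \<longrightarrow> x j (i + int t) = x j (i + b j)))" for n b
  define B where "B = {b \<in> I \<rightarrow>\<^sub>E {- int S..int S}. b k1 \<noteq> b k2}"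
  have B: "finite B" unfolding B_def using I by (intro finite_subset[OF _ finite_PiE[of I "\<lambda>_. {- int S..int S}"]]) auto
  have ex: "\<exists>n\<ge>N. \<exists>b\<in>B. good n b" for N
  proof -
    obtain n p d a b' where n: "max N (32 * S * 2 ^ card I + 12 * S + Suc S) \<le> n" "0 \<le> p" "p \<le> int (C * h n)"
      "2 * \<bar>d\<bar> \<le> int (h n) + 2 * int S" "gap_change n (x k1) (x k2) p d a b'"
      using gap_changes_or_asymptotic[OF x[OF k(1)] x[OF k(2)] na, of "max N (32 * S * 2 ^ card I + 12 * S + Suc S)"]
      unfolding C_def by blast
    have H: "32 * S * 2 ^ card I + 12 * S \<le> h n" "S < h n" using n(1) h_ge[of n] by linarith+
    from common_recurrence_level[OF I x k12 n(5,4,2,3) H] obtain b u l t where b: "b k1 \<noteq> b k2"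
      "\<forall>j\<in>I. \<bar>b j\<bar> \<le> int S" "u + l \<le> (C + 2) * h n" "t \<le> (C + 2) * h n" "h n \<le> 2 ^ (card I + 2) * l"
      "\<forall>j\<in>I. \<forall>i. int u \<le> i \<longrightarrow> i < int u + int l \<longrightarrow> x j (i + int t) = x j (i + b j)"
      by blast
    have "restrict b I \<in> B" using b(1,2) k unfolding B_def by (auto simp: abs_le_iff)
    moreover have "good n (restrict b I)"
      unfolding good_def
    proof (rule exI[of _ u], rule exI[of _ l], rule exI[of _ t], intro conjI)
      have le: "(C + 2) * h n \<le> D * h n" "2 ^ (card I + 2) * l \<le> D * l"
        by (intro mult_le_mono1, simp add: D_def)+
      show "u + l \<le> D * h n" "t \<le> D * h n" "h n \<le> D * l" using b(3-5) le by linarith+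
      show "\<forall>j\<in>I. \<forall>i. int u \<le> i \<longrightarrow> i < int u + int l \<longrightarrow> x j (i + int t) = x j (i + restrict b I j)"
        using b(6) by simp
    qed
    ultimately show ?thesis using n(1) by (intro exI[of _ n]) auto
  qed
  have "\<exists>b\<in>B. \<forall>N. \<exists>n\<ge>N. good n b"
  proof (rule ccontr)
    assume "\<not> ?thesis"
    then obtain N where N: "\<And>b. b \<in> B \<Longrightarrow> \<forall>n\<ge>N b. \<not> good n b" by metis
    obtain n b where nb: "Max (insert 0 (N ` B)) \<le> n" "b \<in> B" "good n b" using ex by blast
    have "N b \<le> n" using nb(1,2) B by auto
    then show False using N nb by blast
  qed
  then obtain b where b: "b \<in> B" "\<And>N. \<exists>n\<ge>N. good n b" by blast
  show ?thesis
  proof (rule exI[of _ b], rule conjI, goal_cases)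
    case 1
    show ?case using b(1) by (simp add: B_def)
  next
    case 2
    show ?case
    proof (rule exI[of _ D], intro conjI allI)
    show "0 < D" by (simp add: D_def)
    fix H
    obtain n where n: "H \<le> n" "good n b" using b(2) by blast
    then show "\<exists>q\<ge>H. \<exists>u l t::nat. u + l \<le> D * q \<and> t \<le> D * q \<and> q \<le> D * l \<and>
      (\<forall>j\<in>I. \<forall>i. int u \<le> i \<longrightarrow> i < int u + int l \<longrightarrow> x j (i + int t) = x j (i + b j))"
      using h_ge[of n] unfolding good_def by (intro exI[of _ "h n"]) auto
  qed
  qed
qed

lemma gap_occurs_in_window:
  assumes x: "x \<in> X" and a: "a \<in> set (s n)"
  shows "\<exists>p. p \<in> occ n x \<and> p + int (h n) + int a \<in> occ n x \<and>
    i - int (h (Suc n) + S) < p \<and> p \<le> i + int (h (Suc n))"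
proof -
  obtain q where q: "q \<in> occ (Suc n) x" "q \<le> i" "i < q + int (h (Suc n)) + int S"
    using occ_cover[OF x] by blast
  obtain l where l: "l < r n - 1" "a = s n ! l" using a length_s[of n] by (auto simp: in_set_conv_nth)
  have "off n l < h (Suc n)" using off_less[of l n 0] l h_pos[of n] by simp
  moreover have "q + int (off n l) \<in> occ n x" "q + int (off n (Suc l)) \<in> occ n x"
    using l by (auto intro!: occ_Suc_copy[OF q(1)] simp del: copy_start_simps)
  ultimately show ?thesis using q(2,3) l by (intro exI[of _ "q + int (off n l)"]) (auto simp: add.assoc)
qed

end

section \<open>The invariant measure\<close>

text \<open>
  The sets \<open>G\<close> for which the limit relation holds form a Dynkin system. For disjoint unions the limit and the
  sum may be exchanged by the theorem of Tannery: since the maps preserve measure, the measures of the parts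
  are bounded by those of the sets \<open>G i\<close> in \<open>K\<close>, uniformly in \<open>n\<close>.
\<close>

lemma (in finite_measure) limit_on_generator_extends:
  assumes K: "finite_measure K" and gen: "Int_stable E" "E \<subseteq> Pow (space K)" "sets K = sigma_sets (space K) E" "space K \<in> E"
    and f: "\<And>n::nat. f n \<in> measurable M K" "\<And>n. distr M K (f n) = K" and A: "\<And>n. A n \<in> sets M"
    and f': "f' \<in> measurable M K" "distr M K f' = K" and A': "A' \<in> sets M"
    and lim: "\<And>G. G \<in> E \<Longrightarrow>
      (\<lambda>n. measure M (A n \<inter> (f n -` G \<inter> space M))) \<longlonglongrightarrow> \<alpha> * measure M (A' \<inter> (f' -` G \<inter> space M))"
    and G: "G \<in> sets K"
  shows "(\<lambda>n. measure M (A n \<inter> (f n -` G \<inter> space M))) \<longlonglongrightarrow> \<alpha> * measure M (A' \<inter> (f' -` G \<inter> space M))"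
proof -
  interpret K: finite_measure K by fact
  have "G \<in> sigma_sets (space K) E" using G gen(3) by simp
  with gen(1,2) show ?thesis
  proof (induction rule: sigma_sets_induct_disjoint)
    case (basic G)
    then show ?case by (rule lim)
  next
    case empty
    then show ?case by simp
  next
    case (compl G)
    have G: "G \<in> sets K" using compl gen(3) by simp
    have diff: "measure M (B \<inter> (g -` (space K - G) \<inter> space M)) =
        measure M (B \<inter> (g -` space K \<inter> space M)) - measure M (B \<inter> (g -` G \<inter> space M))"
      if g: "g \<in> measurable M K" and B: "B \<in> sets M" for g B
    proof -
      have m: "g -` G \<inter> space M \<in> sets M" "g -` space K \<inter> space M \<in> sets M"
        using measurable_sets[OF g G] measurable_sets[OF g sets.top] by auto
      have "B \<inter> (g -` (space K - G) \<inter> space M) = B \<inter> (g -` space K \<inter> space M) - B \<inter> (g -` G \<inter> space M)"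
        by auto
      moreover have "B \<inter> (g -` G \<inter> space M) \<subseteq> B \<inter> (g -` space K \<inter> space M)"
        using sets.sets_into_space[OF G] by auto
      ultimately show ?thesis using B m
        by (simp add: finite_measure_Diff)
    qed
    show ?case
      unfolding diff[OF f(1) A] diff[OF f'(1) A'] right_diff_distrib
      by (intro tendsto_diff compl lim gen(4))
  next
    case (union G)
    have G: "G i \<in> sets K" for i using union(2) gen(3) by auto
    have sums: "(\<lambda>i. measure M (B \<inter> (g -` G i \<inter> space M))) sums measure M (B \<inter> (g -` (\<Union>i. G i) \<inter> space M))"
      if g: "g \<in> measurable M K" and B: "B \<in> sets M" for g B
    proof -
      have "(\<lambda>i. measure M (B \<inter> (g -` G i \<inter> space M))) sums measure M (\<Union>i. B \<inter> (g -` G i \<inter> space M))"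
      proof (rule finite_measure_UNION)
        show "range (\<lambda>i. B \<inter> (g -` G i \<inter> space M)) \<subseteq> sets M"
          using measurable_sets[OF g G] B by auto
        show "disjoint_family (\<lambda>i. B \<inter> (g -` G i \<inter> space M))"
          using union(1) by (auto simp: disjoint_family_on_def)
      qed
      moreover have "(\<Union>i. B \<inter> (g -` G i \<inter> space M)) = B \<inter> (g -` (\<Union>i. G i) \<inter> space M)" by auto
      ultimately show ?thesis by simp
    qed
    have bound: "measure M (B \<inter> (g -` G i \<inter> space M)) \<le> measure K (G i)"
      if g: "g \<in> measurable M K" "distr M K g = K" for g B i
    proof -
      have "measure M (B \<inter> (g -` G i \<inter> space M)) \<le> measure M (g -` G i \<inter> space M)"
        using measurable_sets[OF g(1) G] by (intro finite_measure_mono) auto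
      also have "\<dots> = measure (distr M K g) (G i)" by (rule measure_distr[OF g(1) G, symmetric])
      finally show ?thesis by (simp only: g(2))
    qed
    have sumK: "summable (\<lambda>i. measure K (G i))"
      using K.finite_measure_UNION[of G] union(1) G by (auto simp: sums_iff)
    have "(\<lambda>n. \<Sum>i. measure M (A n \<inter> (f n -` G i \<inter> space M)))
        \<longlonglongrightarrow> (\<Sum>i. \<alpha> * measure M (A' \<inter> (f' -` G i \<inter> space M)))"
    proof (rule tannerys_theorem[THEN conjunct2, THEN conjunct2])
      show "\<forall>\<^sub>F (i, n) in sequentially \<times>\<^sub>F sequentially.
          norm (measure M (A n \<inter> (f n -` G i \<inter> space M))) \<le> measure K (G i)"
        using bound[OF f] by (auto intro!: always_eventually)
    qed (auto intro: union(3) sumK)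
    moreover have "(\<Sum>i. measure M (A n \<inter> (f n -` G i \<inter> space M))) = measure M (A n \<inter> (f n -` (\<Union>i. G i) \<inter> space M))" for n
      using sums[OF f(1) A] by (simp add: sums_iff)
    moreover have "(\<Sum>i. \<alpha> * measure M (A' \<inter> (f' -` G i \<inter> space M))) = \<alpha> * measure M (A' \<inter> (f' -` (\<Union>i. G i) \<inter> space M))"
      using sums[OF f'(1) A'] by (simp add: sums_iff suminf_mult)
    ultimately show ?case by simp
  qed
qed

lemma measurable_binary_coordinate:
  fixes f :: "'a \<Rightarrow> nat"
  assumes "{w \<in> space A. f w = 1} \<in> sets A" "\<And>w. w \<in> space A \<Longrightarrow> f w \<in> {0, 1}"
  shows "f \<in> borel_measurable A"
proof -
  let ?U = "{w \<in> space A. f w = 1}"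
  have "(\<lambda>w. indicator ?U w :: nat) \<in> borel_measurable A" using assms(1) by measurable
  moreover have "f w = indicator ?U w" if "w \<in> space A" for w
    using assms(2)[OF that] that by (auto simp: indicator_def)
  ultimately show ?thesis by (subst measurable_cong[of A f "indicator ?U"])
qed

lemma shift_power_apply: "shift_power k x i = x (i + k)" by (simp add: shift_power_def)

lemma shift_power_add: "shift_power k (shift_power l x) = shift_power (k + l) x"
  by (simp add: shift_power_def fun_eq_iff add.commute add.left_commute)

lemma shift_power_zero [simp]: "shift_power 0 x = x" by (simp add: shift_power_def)

locale rank_one_system = bounded_rank_one +
  fixes M :: "(int \<Rightarrow> nat) measure"
  assumes invariant: "invariant_prob_on X M" and total: "totally_ergodic M shift"
begin

lemma sets_M: "sets M = sets (restrict_space borel X)"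
  using invariant by (simp add: invariant_prob_on_def)

lemma space_M [simp]: "space M = X"
  using sets_eq_imp_space_eq[OF sets_M] by (simp add: space_restrict_space)

sublocale prob_space M using invariant by (simp add: invariant_prob_on_def)

lemma X_binary: "x \<in> X \<Longrightarrow> x i = 0 \<or> x i = 1"
  by (auto simp: word_subshift_def)

lemma shift_power_X: "x \<in> X \<Longrightarrow> shift_power k x \<in> X"
proof -
  assume x: "x \<in> X"
  have "shift_power k x i \<in> {0, 1}" for i using X_binary[OF x, of "i + k"] by (simp add: shift_power_def)
  then have "range (shift_power k x) \<subseteq> {0, 1}" by (rule image_subsetI)
  moreover have "\<exists>m. \<forall>j<l. shift_power k x (i + int j) = V (m + j)" for i l
    using X_window[OF x, of l "i + k"] by (simp add: shift_power_def ac_simps)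
  ultimately show ?thesis by (auto simp: word_subshift_def)
qed

lemma ergodic_power: "1 \<le> k \<Longrightarrow> ergodic_system M (shift ^^ k)"
  using total by (simp add: totally_ergodic_def)

lemma ergodic_shift: "ergodic_system M shift"
  using ergodic_power[of 1] by simp

lemma coordinate_measurable: "(\<lambda>x. x i) \<in> borel_measurable M"
proof -
  have "(\<lambda>x::int \<Rightarrow> nat. x i) \<in> borel_measurable borel" by measurable
  then have "(\<lambda>x. x i) \<in> measurable (restrict_space borel X) borel" by (rule measurable_restrict_space1)
  then show ?thesis using measurable_cong_sets[OF sets_M refl] by blast
qed

lemma measurable_into_M:
  assumes "\<And>i. (\<lambda>w. f w i) \<in> borel_measurable A" "\<And>w. w \<in> space A \<Longrightarrow> f w \<in> X"
  shows "f \<in> measurable A M"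
proof -
  have "f \<in> borel_measurable A" by (rule measurable_coordinatewise_then_product) (rule assms(1))
  then have "f \<in> measurable A (restrict_space borel X)" by (rule measurable_restrict_space2[rotated]) (use assms(2) in auto)
  then show ?thesis using measurable_cong_sets[OF refl sets_M] by blast
qed

lemma shift_power_measurable [measurable]: "shift_power k \<in> measurable M M"
  by (rule measurable_into_M) (auto simp: shift_power_apply coordinate_measurable shift_power_X)

lemma shift_power_preserving: "distr M M (shift_power k) = M"
proof -
  have pos: "distr M M (shift_power (int n)) = M" for n
    unfolding shift_power_of_nat using ergodic_systemD(2,3)[OF ergodic_shift] by (rule distr_funpow)
  show ?thesis
  proof (cases "0 \<le> k")
    case True
    then show ?thesis using pos[of "nat k"] by simp
  next
    case False
    have "distr M M (shift_power k) = distr (distr M M (shift_power (- k))) M (shift_power k)"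
      using pos[of "nat (- k)"] False by simp
    also have "\<dots> = distr M M (\<lambda>x. x)"
      by (subst distr_distr) (auto simp: o_def shift_power_add intro!: distr_cong)
    finally show ?thesis by simp
  qed
qed

abbreviation preshift :: "int \<Rightarrow> (int \<Rightarrow> nat) set \<Rightarrow> (int \<Rightarrow> nat) set" where
  "preshift k B \<equiv> shift_power k -` B \<inter> X"

lemma measure_shift_power: "A \<in> sets M \<Longrightarrow> measure M (preshift k A) = measure M A"
  using measure_distr[OF shift_power_measurable, of A k] shift_power_preserving[of k] by simp

lemma coordinates_sets: "finite F \<Longrightarrow> {x \<in> X. \<forall>i\<in>F. x i = w i} \<in> sets M"
proof -
  assume F: "finite F"
  have "{x \<in> space M. \<forall>i\<in>F. x i = w i} \<in> sets M"
  proof (rule sets.sets_Collect_finite_All[OF _ F])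
    show "{x \<in> space M. x i = w i} \<in> sets M" for i
      using measurable_sets[OF coordinate_measurable[of i], of "{w i}"]
      by (simp add: vimage_def Int_def conj_commute)
  qed
  then show ?thesis by simp
qed

text \<open>
  Prescribing ones only, instead of arbitrary letters, makes these sets closed under intersection; they
  generate because the points are binary.
\<close>

definition ones :: "int set \<Rightarrow> (int \<Rightarrow> nat) set" where
  "ones F = {x \<in> X. \<forall>i\<in>F. x i = 1}"

lemma ones_generate:
  shows "Int_stable (ones ` {F. finite F})" "ones ` {F. finite F} \<subseteq> Pow (space M)"
    "sets M = sigma_sets (space M) (ones ` {F. finite F})" "space M \<in> ones ` {F. finite F}"
proof -
  let ?E = "ones ` {F. finite F}"
  show "Int_stable ?E"
  proof (rule Int_stableI)
    fix A B assume "A \<in> ?E" "B \<in> ?E"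
    then obtain F G where "finite F" "finite G" "A = ones F" "B = ones G" by auto
    then show "A \<inter> B \<in> ?E" by (intro image_eqI[of _ _ "F \<union> G"]) (auto simp: ones_def)
  qed
  show sub: "?E \<subseteq> Pow (space M)" by (auto simp: ones_def)
  show "space M \<in> ?E" by (intro image_eqI[of _ _ "{}"]) (auto simp: ones_def)
  define A where "A = sigma (space M) ?E"
  have spA: "space A = X" unfolding A_def using sub by (subst space_measure_of) simp_all
  have setsA: "sets A = sigma_sets (space M) ?E" unfolding A_def using sub by (rule sets_measure_of)
  have "(\<lambda>x. x) \<in> measurable A M"
  proof (rule measurable_into_M)
    fix i
    show "(\<lambda>x. x i) \<in> borel_measurable A"
    proof (rule measurable_binary_coordinate)
      have "ones {i} \<in> sets A" unfolding setsA by (intro sigma_sets.Basic imageI) simp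
      then show "{x \<in> space A. x i = 1} \<in> sets A" unfolding spA by (simp add: ones_def)
    qed (use X_binary spA in auto)
  qed (simp add: spA)
  have "B \<in> sets A" if B: "B \<in> sets M" for B
  proof -
    have "(\<lambda>x. x) -` B \<inter> space A = B" using sets.sets_into_space[OF B] spA by auto
    then show ?thesis using measurable_sets[OF \<open>(\<lambda>x. x) \<in> measurable A M\<close> B] by simp
  qed
  moreover have "?E \<subseteq> sets M" using coordinates_sets[of _ "\<lambda>_. 1"] by (auto simp: ones_def)
  then have "sigma_sets (space M) ?E \<subseteq> sets M" by (rule sets.sigma_sets_subset)
  ultimately show "sets M = sigma_sets (space M) ?E" unfolding setsA by blast
qed

lemma occ_sets: "{x \<in> X. p \<in> occ n x} \<in> sets M"
proof -
  have "{x \<in> X. p \<in> occ n x} = {x \<in> X. \<forall>i\<in>(\<lambda>j. p + int j) ` {..<h n}. x i = v n ! nat (i - p)}"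
    by (auto simp: occ_def)
  then show ?thesis using coordinates_sets[of "(\<lambda>j. p + int j) ` {..<h n}" "\<lambda>i. v n ! nat (i - p)"] by simp
qed

lemma occ_shift_power: "p \<in> occ n (shift_power k x) \<longleftrightarrow> p + k \<in> occ n x"
  by (simp add: occ_def shift_power_apply ac_simps)

lemma measure_occ: "measure M {x \<in> X. p \<in> occ n x} = measure M {x \<in> X. 0 \<in> occ n x}"
proof -
  have "x \<in> X \<and> p \<in> occ n x \<longleftrightarrow> shift_power p x \<in> X \<and> 0 \<in> occ n (shift_power p x) \<and> x \<in> X" for x
    using shift_power_X[of x p] occ_shift_power[of 0 n p x] by auto
  then have "{x \<in> X. p \<in> occ n x} = shift_power p -` {x \<in> X. 0 \<in> occ n x} \<inter> X"
    by blast
  then show ?thesis by (simp only: measure_shift_power[OF occ_sets])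
qed

text \<open>
  The events that a block starts at 0, ..., \<open>h n - 1\<close> are disjoint and equally likely.
\<close>

lemma measure_occ_le: "measure M {x \<in> X. p \<in> occ n x} \<le> 1 / real (h n)"
proof -
  define m where "m = measure M {x \<in> X. 0 \<in> occ n x}"
  have m: "measure M {x \<in> X. q \<in> occ n x} = m" for q unfolding m_def by (rule measure_occ)
  have "real (h n) * m = (\<Sum>j<h n. measure M {x \<in> X. int j \<in> occ n x})"
    by (simp add: m)
  also have "\<dots> = measure M (\<Union>j<h n. {x \<in> X. int j \<in> occ n x})"
  proof (rule finite_measure_finite_Union[symmetric])
    show "disjoint_family_on (\<lambda>j. {x \<in> X. int j \<in> occ n x}) {..<h n}"
      unfolding disjoint_family_on_def
    proof (intro ballI impI)
      fix i j assume ij: "i \<in> {..<h n}" "j \<in> {..<h n}" "i \<noteq> j"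
      have "False" if "x \<in> X" "int i \<in> occ n x" "int j \<in> occ n x" for x
        using occ_separated[OF that(1,2,3)] occ_separated[OF that(1,3,2)] ij by (cases "i < j") auto
      then show "{x \<in> X. int i \<in> occ n x} \<inter> {x \<in> X. int j \<in> occ n x} = {}" by auto
    qed
  qed (auto intro: occ_sets)
  also have "\<dots> \<le> 1" by (rule prob_le_1)
  finally show ?thesis using h_pos[of n] by (simp add: m field_simps)
qed

end

section \<open>Translations by a block and a gap\<close>

context rank_one_system
begin

lemma shift_funpow: "shift ^^ n = shift_power (int n)" by (simp add: shift_power_of_nat)

lemma prob_X [simp]: "measure M X = 1" using prob_space by simp

text \<open>
  The origin lies in the middle third of a block that is followed by a gap \<open>a\<close>. Keeping away from the ends of
  the block makes \<open>x\<close> and its translate by \<open>h n + a\<close> agree on a window around the origin that grows with \<open>n\<close>.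
\<close>

definition gap_middle :: "nat \<Rightarrow> nat \<Rightarrow> (int \<Rightarrow> nat) set" where
  "gap_middle a n = {x \<in> X. \<exists>p. - 2 * int (h n div 3) \<le> p \<and> p \<le> - int (h n div 3) \<and>
     p \<in> occ n x \<and> p + int (h n) + int a \<in> occ n x}"

lemma gap_middle_sets: "gap_middle a n \<in> sets M"
proof -
  have "gap_middle a n = (\<Union>p\<in>{- 2 * int (h n div 3)..- int (h n div 3)}.
      {x \<in> X. p \<in> occ n x} \<inter> {x \<in> X. p + int (h n) + int a \<in> occ n x})"
    by (auto simp: gap_middle_def)
  also have "\<dots> \<in> sets M"
    by (intro sets.finite_UN sets.Int occ_sets) auto
  finally show ?thesis .
qed

lemma gap_middle_recurs:
  assumes "x \<in> gap_middle a n" "- int (h n div 3) \<le> i" "i < int (h n div 3)"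
  shows "x (i + int (h n + a)) = x i"
proof -
  obtain p where p: "- 2 * int (h n div 3) \<le> p" "p \<le> - int (h n div 3)"
    "p \<in> occ n x" "p + int (h n) + int a \<in> occ n x"
    using assms(1) by (auto simp: gap_middle_def)
  have "3 * int (h n div 3) \<le> int (h n)" by simp
  then have i: "p \<le> i" "i < p + int (h n)" using p(1,2) assms(2,3) by linarith+
  have "x (i + int (h n + a)) = v n ! nat (i + int (h n + a) - (p + int (h n) + int a))"
    using i by (intro occ_nth[OF p(4)]) auto
  also have "\<dots> = x i" using occ_nth[OF p(3) i] by simp
  finally show ?thesis .
qed

text \<open>
  Within a bounded multiple of \<open>h n\<close> every orbit passes a block of level \<open>n + 1\<close>, hence a block of level \<open>n\<close>
  followed by the gap \<open>a\<close>, and it spends \<open>h n div 3 + 1\<close> steps in the middle third of it.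
\<close>

lemma gap_middle_measure_ge:
  assumes a: "a \<in> set (s n)" and S: "S < h n"
  shows "1 / (12 * (real R + 1)) \<le> measure M (gap_middle a n)"
proof -
  define u where "u = h n div 3"
  define W where "W = 2 * h (Suc n) + S + 2 * u + 1"
  let ?f = "\<lambda>k x. indicator (gap_middle a n) (shift_power (int k) x) :: real"
  have pt: "real (u + 1) \<le> (\<Sum>k<W. ?f k x)" if x: "x \<in> X" for x
  proof -
    obtain p where p: "p \<in> occ n x" "p + int (h n) + int a \<in> occ n x"
      "int (h (Suc n) + S) - int (h (Suc n) + S) < p" "p \<le> int (h (Suc n) + S) + int (h (Suc n))"
      using gap_occurs_in_window[OF x a, of "int (h (Suc n) + S)"] by blast
    let ?K = "{nat p + u..nat p + 2 * u}"
    have in_gm: "?f k x = 1" if k: "k \<in> ?K" for k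
    proof -
      have "shift_power (int k) x \<in> gap_middle a n"
        unfolding gap_middle_def u_def[symmetric]
      proof (intro CollectI conjI exI[of _ "p - int k"])
        show "shift_power (int k) x \<in> X" by (rule shift_power_X[OF x])
        show "- 2 * int u \<le> p - int k" "p - int k \<le> - int u" using k p(3) by auto
        show "p - int k \<in> occ n (shift_power (int k) x)" using p(1) by (simp add: occ_shift_power)
        have e: "p - int k + int (h n) + int a + int k = p + int (h n) + int a" by simp
        show "p - int k + int (h n) + int a \<in> occ n (shift_power (int k) x)"
          unfolding occ_shift_power e by (rule p(2))
      qed
      then show ?thesis by simp
    qed
    have "real (u + 1) = (\<Sum>k\<in>?K. ?f k x)" using in_gm by simp
    also have "\<dots> \<le> (\<Sum>k<W. ?f k x)"
      using p(3,4) by (intro sum_mono2) (auto simp: W_def)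
    finally show ?thesis .
  qed
  have meas: "?f k \<in> borel_measurable M" for k
    using measurable_compose[OF shift_power_measurable borel_measurable_indicator[OF gap_middle_sets]] .
  have int: "integrable M (?f k)" for k
    by (rule integrable_const_bound[where B=1, OF _ meas]) (simp add: indicator_def)
  have eq: "(\<integral>x. ?f k x \<partial>M) = measure M (gap_middle a n)" for k
  proof -
    have "(\<integral>x. ?f k x \<partial>M) = (\<integral>x. indicator (gap_middle a n) x \<partial>(distr M M (shift_power (int k))))"
      by (rule integral_distr[OF shift_power_measurable borel_measurable_indicator[OF gap_middle_sets], symmetric])
    also have "\<dots> = measure M (gap_middle a n)"
      unfolding shift_power_preserving using sets.sets_into_space[OF gap_middle_sets, of a n]
      by (simp add: Int_absorb2)
    finally show ?thesis .
  qed
  have "real (u + 1) = (\<integral>x. real (u + 1) \<partial>M)" by simp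
  also have "\<dots> \<le> (\<integral>x. (\<Sum>k<W. ?f k x) \<partial>M)"
    using pt int by (intro integral_mono) auto
  also have "\<dots> = real W * measure M (gap_middle a n)"
    using int eq by simp
  finally have main: "real (u + 1) \<le> real W * measure M (gap_middle a n)" .
  have "h (Suc n) \<le> R * (h n + h n)"
    using h_Suc_le[of n] S by (meson add_le_cancel_left less_imp_le mult_le_mono2 order_trans)
  then have "W \<le> 4 * (R * h n) + 4 * h n"
    using S by (simp add: W_def u_def algebra_simps)
  moreover have "h n \<le> 3 * (u + 1)" unfolding u_def by simp
  ultimately have "W \<le> 12 * (R + 1) * (u + 1)"
  proof -
    assume W: "W \<le> 4 * (R * h n) + 4 * h n" and u: "h n \<le> 3 * (u + 1)"
    have "W \<le> 4 * (R + 1) * h n" using W by (simp add: algebra_simps)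
    also have "\<dots> \<le> 4 * (R + 1) * (3 * (u + 1))" by (rule mult_le_mono2[OF u])
    finally show ?thesis by (simp add: algebra_simps)
  qed
  then have "real W \<le> real (12 * (R + 1) * (u + 1))" by (simp only: of_nat_le_iff)
  then have "real W * measure M (gap_middle a n) \<le> real (12 * (R + 1) * (u + 1)) * measure M (gap_middle a n)"
    by (intro mult_right_mono) auto
  with main have "real (u + 1) * 1 \<le> real (u + 1) * (12 * (real R + 1) * measure M (gap_middle a n))"
    by (simp add: algebra_simps)
  then have "1 \<le> 12 * (real R + 1) * measure M (gap_middle a n)"
    by (subst (asm) mult_le_cancel_left_pos) auto
  then show ?thesis by (simp add: divide_le_eq mult.commute)
qed

text \<open>
  A point lies in one of the two sets but not in the other only if a block of it starts at one of \<open>i\<close> given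
  positions, and each of these events has probability at most \<open>1 / h n\<close>.
\<close>

lemma gap_middle_shift_diff:
  fixes i n :: nat and B
  assumes B: "B \<in> sets M"
  shows "\<bar>measure M (gap_middle a n \<inter> B) - measure M ((shift_power (int i) -` gap_middle a n \<inter> X) \<inter> B)\<bar>
    \<le> real i / real (h n)"
proof -
  define u where "u = int (h n div 3)"
  define Q where "Q = gap_middle a n"
  define Q' where "Q' = shift_power (int i) -` gap_middle a n \<inter> X"
  have Q'_iff: "x \<in> Q' \<longleftrightarrow> x \<in> X \<and> (\<exists>p. - 2 * u + int i \<le> p \<and> p \<le> - u + int i \<and>
     p \<in> occ n x \<and> p + int (h n) + int a \<in> occ n x)" for x
  proof -
    have "(\<exists>p. - 2 * u \<le> p \<and> p \<le> - u \<and> p + int i \<in> occ n x \<and> p + int (h n) + int a + int i \<in> occ n x) \<longleftrightarrow>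
       (\<exists>p. - 2 * u + int i \<le> p \<and> p \<le> - u + int i \<and> p \<in> occ n x \<and> p + int (h n) + int a \<in> occ n x)"
      (is "?L \<longleftrightarrow> ?R")
    proof
      assume ?L
      then obtain p where "- 2 * u \<le> p \<and> p \<le> - u \<and> p + int i \<in> occ n x \<and> p + int (h n) + int a + int i \<in> occ n x" by blast
      then show ?R by (intro exI[of _ "p + int i"]) (simp add: ac_simps)
    next
      assume ?R
      then obtain p where "- 2 * u + int i \<le> p \<and> p \<le> - u + int i \<and> p \<in> occ n x \<and> p + int (h n) + int a \<in> occ n x" by blast
      then show ?L by (intro exI[of _ "p - int i"]) (simp add: algebra_simps)
    qed
    then show ?thesis
      unfolding Q'_def gap_middle_def u_def[symmetric] using shift_power_X[of x "int i"]
      by (simp add: occ_shift_power) blast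
  qed
  have Q_iff: "x \<in> Q \<longleftrightarrow> x \<in> X \<and> (\<exists>p. - 2 * u \<le> p \<and> p \<le> - u \<and>
     p \<in> occ n x \<and> p + int (h n) + int a \<in> occ n x)" for x
    by (simp add: Q_def gap_middle_def u_def)
  define D where "D c = (\<Union>j<i. {x \<in> X. c + int j \<in> occ n x})" for c :: int
  have Dm: "D c \<in> sets M" for c unfolding D_def by (intro sets.finite_UN occ_sets) auto
  have D: "measure M (D c) \<le> real i / real (h n)" for c
  proof -
    have "measure M (D c) \<le> (\<Sum>j<i. measure M {x \<in> X. c + int j \<in> occ n x})"
      unfolding D_def by (rule finite_measure_subadditive_finite) (auto intro: occ_sets)
    also have "\<dots> \<le> (\<Sum>j<i. 1 / real (h n))" by (intro sum_mono measure_occ_le)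
    finally show ?thesis by simp
  qed
  have Qm: "Q \<in> sets M" "Q' \<in> sets M"
    unfolding Q_def Q'_def using gap_middle_sets measurable_sets[OF shift_power_measurable gap_middle_sets] by auto
  have s1: "Q \<inter> B \<subseteq> (Q' \<inter> B) \<union> D (- 2 * u)"
  proof
    fix x assume x: "x \<in> Q \<inter> B"
    then obtain p where p: "x \<in> X" "- 2 * u \<le> p" "p \<le> - u" "p \<in> occ n x" "p + int (h n) + int a \<in> occ n x"
      using Q_iff[of x] by blast
    show "x \<in> (Q' \<inter> B) \<union> D (- 2 * u)"
    proof (cases "- 2 * u + int i \<le> p")
      case True
      then have "x \<in> Q'" using Q'_iff[of x] p by auto
      then show ?thesis using x by blast
    next
      case False
      then have "x \<in> D (- 2 * u)" unfolding D_def using p by (intro UN_I[of "nat (p + 2 * u)"]) auto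
      then show ?thesis by blast
    qed
  qed
  have s2: "Q' \<inter> B \<subseteq> (Q \<inter> B) \<union> D (- u + 1)"
  proof
    fix x assume x: "x \<in> Q' \<inter> B"
    then obtain p where p: "x \<in> X" "- 2 * u + int i \<le> p" "p \<le> - u + int i" "p \<in> occ n x" "p + int (h n) + int a \<in> occ n x"
      using Q'_iff[of x] by blast
    show "x \<in> (Q \<inter> B) \<union> D (- u + 1)"
    proof (cases "p \<le> - u")
      case True
      then have "x \<in> Q" using Q_iff[of x] p by auto
      then show ?thesis using x by blast
    next
      case False
      then have "x \<in> D (- u + 1)" unfolding D_def using p by (intro UN_I[of "nat (p + u - 1)"]) auto
      then show ?thesis by blast
    qed
  qed
  have "measure M (Q \<inter> B) \<le> measure M (Q' \<inter> B) + measure M (D (- 2 * u))"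
    using s1 Qm B Dm by (intro order_trans[OF finite_measure_mono[OF s1] measure_Un_le]) auto
  moreover have "measure M (Q' \<inter> B) \<le> measure M (Q \<inter> B) + measure M (D (- u + 1))"
    using s2 Qm B Dm by (intro order_trans[OF finite_measure_mono[OF s2] measure_Un_le]) auto
  ultimately show ?thesis using D[of "- 2 * u"] D[of "- u + 1"] unfolding Q_def Q'_def by linarith
qed

text \<open>
  Since \<open>gap_middle a n\<close> is almost invariant, its intersection with \<open>F\<close> may be replaced by the average of its
  intersections with \<open>K\<close> translates of \<open>F\<close>. By ergodicity such averages are nearly independent of any event
  as soon as \<open>K\<close> is large.
\<close>

lemma gap_middle_asymptotically_independent:
  assumes F: "F \<in> sets M"
  shows "(\<lambda>n. measure M (gap_middle a n \<inter> F) - measure M (gap_middle a n) * measure M F) \<longlonglongrightarrow> 0"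
proof (rule LIMSEQ_I)
  fix e :: real assume e: "0 < e"
  let ?Q = "\<lambda>n. gap_middle a n"
  let ?eps = "\<lambda>K. \<integral>x. \<bar>visit_frequency shift F K x - measure M F\<bar> \<partial>M"
  have "\<forall>\<^sub>F K in sequentially. norm (?eps K - 0) < e / 2"
    using mean_visit_frequency[OF ergodic_shift F] e by (intro LIMSEQ_D[THEN eventually_sequentially[THEN iffD2]]) auto
  then have "\<forall>\<^sub>F K in sequentially. norm (?eps K - 0) < e / 2 \<and> 1 \<le> K"
    using eventually_ge_at_top[of 1] by (rule eventually_conj)
  then obtain K where K: "norm (?eps K - 0) < e / 2" "1 \<le> K"
    by (auto simp: eventually_sequentially)
  show "\<exists>n0. \<forall>n\<ge>n0. norm (measure M (?Q n \<inter> F) - measure M (?Q n) * measure M F - 0) < e"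
  proof (intro exI[of _ "Suc (nat \<lceil>2 * real K / e\<rceil>)"] allI impI)
    fix n assume n: "Suc (nat \<lceil>2 * real K / e\<rceil>) \<le> n"
    have "2 * real K / e < real n" using n by linarith
    then have "2 * real K / e < real (h n)" using h_ge[of n] by linarith
    then have Kh: "real K / real (h n) < e / 2" using e h_pos[of n] by (simp add: field_simps)
    let ?B = "\<lambda>i. {y \<in> space M. (shift ^^ i) y \<in> F}"
    have Bv: "?B i = preshift (int i) F" for i by (auto simp: shift_funpow)
    have Bm: "?B i \<in> sets M" for i unfolding Bv using measurable_sets[OF shift_power_measurable F] by simp
    have "\<bar>(\<Sum>i<K. measure M (?Q n \<inter> ?B i)) / real K - measure M (?Q n) * measure M F\<bar> \<le> ?eps K"
      using weak_average_bound[OF ergodic_shift prob_space_axioms measurable_ident_sets[OF refl], of F "?Q n" K] K(2) F gap_middle_sets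
      by (simp add: distr_id)
    moreover have "\<bar>(\<Sum>i<K. measure M (?Q n \<inter> ?B i)) / real K - measure M (?Q n \<inter> F)\<bar> \<le> real K / real (h n)"
    proof -
      have one: "\<bar>measure M (?Q n \<inter> ?B i) - measure M (?Q n \<inter> F)\<bar> \<le> real K / real (h n)" if i: "i < K" for i
      proof -
        have "measure M (?Q n \<inter> F) = measure M (preshift (int i) (?Q n \<inter> F))"
          using gap_middle_sets F by (intro measure_shift_power[symmetric]) auto
        also have "preshift (int i) (?Q n \<inter> F) = (shift_power (int i) -` ?Q n \<inter> X) \<inter> ?B i"
          unfolding Bv by auto
        finally have "\<bar>measure M (?Q n \<inter> ?B i) - measure M (?Q n \<inter> F)\<bar> \<le> real i / real (h n)"
          using gap_middle_shift_diff[OF Bm, of a n i i] by simp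
        also have "\<dots> \<le> real K / real (h n)" using i by (intro divide_right_mono) auto
        finally show ?thesis .
      qed
      have "(\<Sum>i<K. measure M (?Q n \<inter> ?B i)) / real K - measure M (?Q n \<inter> F)
          = (\<Sum>i<K. measure M (?Q n \<inter> ?B i) - measure M (?Q n \<inter> F)) / real K"
        using K(2) by (simp add: sum_subtractf diff_divide_distrib)
      also have "\<bar>\<dots>\<bar> \<le> (\<Sum>i<K. real K / real (h n)) / real K"
        unfolding abs_divide abs_of_nat
        by (intro divide_right_mono order_trans[OF sum_abs] sum_mono one) auto
      also have "\<dots> = real K / real (h n)" using K(2) by simp
      finally show ?thesis .
    qed
    ultimately show "norm (measure M (?Q n \<inter> F) - measure M (?Q n) * measure M F - 0) < e"
      using K(1) Kh unfolding real_norm_def by linarith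
  qed
qed

text \<open>
  For \<open>G\<close> depending on finitely many letters, \<open>x\<close> and its translate by \<open>h n + a\<close> belong to \<open>G\<close> simultaneously when
  \<open>n\<close> is large and \<open>x\<close> belongs to \<open>gap_middle a n\<close>. General \<open>G\<close> are reached by \<open>limit_on_generator_extends\<close>.
\<close>

lemma gap_middle_weak_limit:
  assumes g: "strict_mono g" and al: "(\<lambda>k. measure M (gap_middle a (g k))) \<longlonglongrightarrow> \<alpha>"
    and F: "F \<in> sets M" and G: "G \<in> sets M"
  shows "(\<lambda>k. measure M ((F \<inter> gap_middle a (g k)) \<inter> (shift_power (int (h (g k) + a)) -` G \<inter> space M)))
    \<longlonglongrightarrow> \<alpha> * measure M (F \<inter> ((\<lambda>x. x) -` G \<inter> space M))"
proof (rule limit_on_generator_extends[OF finite_measure_axioms ones_generate shift_power_measurable shift_power_preserving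
      _ measurable_ident_sets[OF refl] _ F _ G])
  show "distr M M (\<lambda>x. x) = M" by simp
  show "F \<inter> gap_middle a (g k) \<in> sets M" for k using F gap_middle_sets by auto
  fix G assume "G \<in> ones ` {F. finite F}"
  then obtain W where W: "finite W" "G = ones W" by auto
  have Gm: "G \<in> sets M" using W coordinates_sets[of W "\<lambda>_. 1"] by (simp add: ones_def)
  define w where "w = Max (insert 0 ((\<lambda>i. nat \<bar>i\<bar>) ` W))"
  have w: "\<bar>i\<bar> \<le> int w" if "i \<in> W" for i
  proof -
    have "nat \<bar>i\<bar> \<le> w" unfolding w_def using W that by (intro Max_ge) auto
    then show ?thesis by simp
  qed
  have ev: "\<forall>\<^sub>F k in sequentially. measure M (gap_middle a (g k) \<inter> (F \<inter> G)) =
     measure M ((F \<inter> gap_middle a (g k)) \<inter> (shift_power (int (h (g k) + a)) -` G \<inter> space M))"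
  proof (rule eventually_sequentiallyI[of "3 * (w + 1)"])
    fix k assume k: "3 * (w + 1) \<le> k"
    have "3 * (w + 1) \<le> h (g k)"
      using k h_ge[of "g k"] seq_suble[OF g, of k] by linarith
    then have wu: "w + 1 \<le> h (g k) div 3"
      by (simp add: less_eq_div_iff_mult_less_eq)
    have "shift_power (int (h (g k) + a)) x \<in> G \<longleftrightarrow> x \<in> G" if x: "x \<in> gap_middle a (g k)" for x
    proof -
      have xX: "x \<in> X" using x by (simp add: gap_middle_def)
      have "x (i + int (h (g k) + a)) = x i" if i: "i \<in> W" for i
        using w[OF i] wu by (intro gap_middle_recurs[OF x]) linarith+
      then show ?thesis using xX shift_power_X[OF xX] by (simp add: W(2) ones_def shift_power_apply)
    qed
    then have "gap_middle a (g k) \<inter> (F \<inter> G) = (F \<inter> gap_middle a (g k)) \<inter> (shift_power (int (h (g k) + a)) -` G \<inter> space M)"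
      using sets.sets_into_space[OF F] by auto
    then show "measure M (gap_middle a (g k) \<inter> (F \<inter> G)) =
     measure M ((F \<inter> gap_middle a (g k)) \<inter> (shift_power (int (h (g k) + a)) -` G \<inter> space M))" by simp
  qed
  have "(\<lambda>k. (measure M (gap_middle a (g k) \<inter> (F \<inter> G)) - measure M (gap_middle a (g k)) * measure M (F \<inter> G))
      + measure M (gap_middle a (g k)) * measure M (F \<inter> G)) \<longlonglongrightarrow> 0 + \<alpha> * measure M (F \<inter> G)"
    using F Gm LIMSEQ_subseq_LIMSEQ[OF gap_middle_asymptotically_independent[of "F \<inter> G" a] g]
    by (intro tendsto_add tendsto_mult al tendsto_const) (auto simp: o_def)
  then have "(\<lambda>k. measure M (gap_middle a (g k) \<inter> (F \<inter> G))) \<longlonglongrightarrow> \<alpha> * measure M (F \<inter> G)" by simp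
  moreover have "F \<inter> ((\<lambda>x. x) -` G \<inter> space M) = F \<inter> G" using sets.sets_into_space[OF F] by auto
  ultimately show "(\<lambda>k. measure M ((F \<inter> gap_middle a (g k)) \<inter> (shift_power (int (h (g k) + a)) -` G \<inter> space M)))
      \<longlonglongrightarrow> \<alpha> * measure M (F \<inter> ((\<lambda>x. x) -` G \<inter> space M))"
    using Lim_transform_eventually[OF _ ev] by simp
qed

lemma two_gaps_infinitely_often:
  "\<exists>a b g. b < a \<and> strict_mono g \<and> (\<forall>k::nat. a \<in> set (s (g k)) \<and> b \<in> set (s (g k)) \<and> S < h (g k))"
proof -
  have "\<exists>p\<in>{..S} \<times> {..S}. snd p < fst p \<and> fst p \<in> set (s n) \<and> snd p \<in> set (s n)" for n
  proof -
    obtain a b where ab: "a \<in> set (s n)" "b \<in> set (s n)" "a \<noteq> b" using spacers_not_constant by blast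
    have le: "a \<le> S" "b \<le> S" using ab spacer_le by auto
    show ?thesis
    proof (cases "a < b")
      case True
      show ?thesis by (rule bexI[of _ "(b, a)"]) (use True ab le in auto)
    next
      case False
      show ?thesis by (rule bexI[of _ "(a, b)"]) (use False ab le in auto)
    qed
  qed
  then obtain f where f: "\<And>n. f n \<in> {..S} \<times> {..S}" "\<And>n. snd (f n) < fst (f n)"
    "\<And>n. fst (f n) \<in> set (s n)" "\<And>n. snd (f n) \<in> set (s n)" by metis
  have "\<exists>p\<in>{..S} \<times> {..S}. infinite {n\<in>{Suc S..}. f n = p}"
  proof (rule pigeonhole_infinite_rel)
    show "infinite {Suc S..}" by (rule infinite_Ici)
    show "\<forall>n\<in>{Suc S..}. \<exists>p\<in>{..S} \<times> {..S}. f n = p" using f(1) by blast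
  qed simp
  then obtain p where p: "infinite {n\<in>{Suc S..}. f n = p}" by blast
  let ?g = "enumerate {n\<in>{Suc S..}. f n = p}"
  have in_g: "?g k \<in> {n\<in>{Suc S..}. f n = p}" for k using enumerate_in_set[OF p] .
  show ?thesis
  proof (rule exI[of _ "fst p"], rule exI[of _ "snd p"], rule exI[of _ ?g], intro conjI allI)
    show "snd p < fst p" using f(2)[of "?g 0"] in_g[of 0] by simp
    show "strict_mono ?g" by (rule strict_mono_enumerate[OF p])
    fix k
    show "fst p \<in> set (s (?g k))" "snd p \<in> set (s (?g k))" using f(3,4)[of "?g k"] in_g[of k] by auto
    show "S < h (?g k)" using h_ge[of "?g k"] in_g[of k] by simp
  qed
qed

text \<open>
  The measures lie in a compact interval that does not contain 0.
\<close>

lemma two_gaps_subsequence: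
  "\<exists>a b g \<alpha> \<beta>. b < a \<and> strict_mono g \<and> 0 < \<alpha> \<and> 0 < \<beta> \<and>
    (\<lambda>k::nat. measure M (gap_middle a (g k))) \<longlonglongrightarrow> \<alpha> \<and> (\<lambda>k. measure M (gap_middle b (g k))) \<longlonglongrightarrow> \<beta>"
proof -
  obtain a b g where "b < a \<and> strict_mono g \<and> (\<forall>k::nat. a \<in> set (s (g k)) \<and> b \<in> set (s (g k)) \<and> S < h (g k))"
    using two_gaps_infinitely_often by (elim exE)
  then have g: "b < a" "strict_mono g" "\<And>k. a \<in> set (s (g k))" "\<And>k. b \<in> set (s (g k))" "\<And>k. S < h (g k)"
    by simp_all
  define \<delta> where "\<delta> = 1 / (12 * (real R + 1))"
  let ?m = "\<lambda>k. (measure M (gap_middle a (g k)), measure M (gap_middle b (g k)))"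
  have "seq_compact ({\<delta>..1} \<times> {\<delta>..1})"
    by (simp add: compact_Times flip: compact_eq_seq_compact_metric)
  moreover have "\<forall>k. ?m k \<in> {\<delta>..1} \<times> {\<delta>..1}"
    using gap_middle_measure_ge[OF g(3) g(5)] gap_middle_measure_ge[OF g(4) g(5)] by (auto simp: \<delta>_def)
  ultimately obtain l q where l: "l \<in> {\<delta>..1} \<times> {\<delta>..1}" "strict_mono q" "(?m \<circ> q) \<longlonglongrightarrow> l"
    by (rule seq_compactE)
  have "0 < \<delta>" by (simp add: \<delta>_def)
  show ?thesis
  proof (rule exI[of _ a], rule exI[of _ b], rule exI[of _ "g \<circ> q"], rule exI[of _ "fst l"], rule exI[of _ "snd l"],
      intro conjI)
    show "b < a" "strict_mono (g \<circ> q)" by (fact g(1), rule strict_mono_o[OF g(2) l(2)])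
    show "0 < fst l" "0 < snd l" using l(1) \<open>0 < \<delta>\<close> by auto
    show "(\<lambda>k. measure M (gap_middle a ((g \<circ> q) k))) \<longlonglongrightarrow> fst l"
      using tendsto_fst[OF l(3)] by (simp add: o_def)
    show "(\<lambda>k. measure M (gap_middle b ((g \<circ> q) k))) \<longlonglongrightarrow> snd l"
      using tendsto_snd[OF l(3)] by (simp add: o_def)
  qed
qed

end

section \<open>Ergodicity of the square\<close>

lemma measure_pair_Times:
  assumes "prob_space A" "prob_space B" "C \<in> sets A" "D \<in> sets B"
  shows "measure (A \<Otimes>\<^sub>M B) (C \<times> D) = measure A C * measure B D"
proof -
  interpret A: prob_space A by fact
  interpret B: prob_space B by fact
  have "emeasure (A \<Otimes>\<^sub>M B) (C \<times> D) = emeasure A C * emeasure B D"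
    by (rule B.emeasure_pair_measure_Times[OF assms(3,4)])
  then show ?thesis by (simp add: measure_def enn2real_mult)
qed

lemma rectangles_generate:
  shows "Int_stable {C \<times> D |C D. C \<in> sets A \<and> D \<in> sets B}"
    "{C \<times> D |C D. C \<in> sets A \<and> D \<in> sets B} \<subseteq> Pow (space (A \<Otimes>\<^sub>M B))"
    "sets (A \<Otimes>\<^sub>M B) = sigma_sets (space (A \<Otimes>\<^sub>M B)) {C \<times> D |C D. C \<in> sets A \<and> D \<in> sets B}"
    "space (A \<Otimes>\<^sub>M B) \<in> {C \<times> D |C D. C \<in> sets A \<and> D \<in> sets B}"
proof -
  show "Int_stable {C \<times> D |C D. C \<in> sets A \<and> D \<in> sets B}" by (rule Int_stable_pair_measure_generator)
  show "{C \<times> D |C D. C \<in> sets A \<and> D \<in> sets B} \<subseteq> Pow (space (A \<Otimes>\<^sub>M B))"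
    unfolding space_pair_measure by (rule pair_measure_closed)
  show "sets (A \<Otimes>\<^sub>M B) = sigma_sets (space (A \<Otimes>\<^sub>M B)) {C \<times> D |C D. C \<in> sets A \<and> D \<in> sets B}"
    unfolding space_pair_measure by (rule sets_pair_measure)
  show "space (A \<Otimes>\<^sub>M B) \<in> {C \<times> D |C D. C \<in> sets A \<and> D \<in> sets B}"
    unfolding space_pair_measure
    by (rule CollectI, rule exI[of _ "space A"], rule exI[of _ "space B"]) simp
qed

lemma distr_map_prod:
  assumes f: "f \<in> measurable A A" "distr A A f = A" and g: "g \<in> measurable B B" "distr B B g = B"
    and B: "prob_space B"
  shows "map_prod f g \<in> measurable (A \<Otimes>\<^sub>M B) (A \<Otimes>\<^sub>M B)"
    "distr (A \<Otimes>\<^sub>M B) (A \<Otimes>\<^sub>M B) (map_prod f g) = A \<Otimes>\<^sub>M B"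
proof -
  have e: "map_prod f g = (\<lambda>(x, y). (f x, g y))" by (auto simp: fun_eq_iff)
  have "(\<lambda>x. f (fst x)) \<in> measurable (A \<Otimes>\<^sub>M B) A" "(\<lambda>x. g (snd x)) \<in> measurable (A \<Otimes>\<^sub>M B) B"
    using measurable_compose[OF measurable_fst f(1)] measurable_compose[OF measurable_snd g(1)] by auto
  from measurable_Pair[OF this] show "map_prod f g \<in> measurable (A \<Otimes>\<^sub>M B) (A \<Otimes>\<^sub>M B)"
    by (simp add: map_prod_def split_def)
  have "sigma_finite_measure (distr B B g)"
    unfolding g(2) using B by (simp add: prob_space.axioms(1) finite_measure.axioms(1) prob_space_imp_sigma_finite)
  from pair_measure_distr[OF f(1) g(1) this] show "distr (A \<Otimes>\<^sub>M B) (A \<Otimes>\<^sub>M B) (map_prod f g) = A \<Otimes>\<^sub>M B"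
    unfolding e f(2) g(2) by simp
qed

context rank_one_system
begin

abbreviation "MM \<equiv> M \<Otimes>\<^sub>M M"

lemma space_MM [simp]: "space MM = X \<times> X" by (simp add: space_pair_measure)

sublocale MM: prob_space MM
proof -
  interpret pair_prob_space M M by unfold_locales
  show "prob_space MM" by unfold_locales
qed

definition pshift :: "int \<Rightarrow> int \<Rightarrow> (int \<Rightarrow> nat) \<times> (int \<Rightarrow> nat) \<Rightarrow> (int \<Rightarrow> nat) \<times> (int \<Rightarrow> nat)" where
  "pshift k l = map_prod (shift_power k) (shift_power l)"

abbreviation prepair :: "int \<Rightarrow> int \<Rightarrow> ((int \<Rightarrow> nat) \<times> (int \<Rightarrow> nat)) set \<Rightarrow> ((int \<Rightarrow> nat) \<times> (int \<Rightarrow> nat)) set" where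
  "prepair k l E \<equiv> pshift k l -` E \<inter> X \<times> X"

lemma pshift_measurable: "pshift k l \<in> measurable MM MM"
  and pshift_preserving: "distr MM MM (pshift k l) = MM"
  unfolding pshift_def
  using distr_map_prod[OF shift_power_measurable shift_power_preserving shift_power_measurable shift_power_preserving prob_space_axioms]
  by auto

lemma pshift_vimage_Times:
  "prepair k l (A \<times> B) = (preshift k A) \<times> preshift l B"
  by (auto simp: pshift_def)

lemma measure_MM_Times: "A \<in> sets M \<Longrightarrow> B \<in> sets M \<Longrightarrow> measure MM (A \<times> B) = measure M A * measure M B"
  by (rule measure_pair_Times[OF prob_space_axioms prob_space_axioms])

text \<open>
  With \<open>Q k = gap_middle a (g k) \<times> gap_middle b (g k)\<close> and \<open>c = a - b\<close>, the translation of both coordinates by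
  \<open>h (g k) + a\<close> is on \<open>Q k\<close> in the limit the translation of the second coordinate by \<open>c\<close>. Because \<open>E\<close> is
  invariant, its translates by the same amount in both coordinates are disjoint from its complement.
\<close>

lemma invariant_set_translates:
  assumes E: "E \<in> sets MM" "prepair 1 1 E = E"
  shows "\<exists>c::nat. 1 \<le> c \<and> measure MM ((X \<times> X - E) \<inter> prepair 0 (int c) E) = 0"
proof -
  obtain a b g \<alpha> \<beta> where gab: "b < a \<and> strict_mono g \<and> 0 < \<alpha> \<and> 0 < \<beta> \<and>
    (\<lambda>k::nat. measure M (gap_middle a (g k))) \<longlonglongrightarrow> \<alpha> \<and> (\<lambda>k. measure M (gap_middle b (g k))) \<longlonglongrightarrow> \<beta>"
    using two_gaps_subsequence by (elim exE)
  then have ab: "b < a" and g: "strict_mono g" and pos: "0 < \<alpha>" "0 < \<beta>"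
    and al: "(\<lambda>k::nat. measure M (gap_middle a (g k))) \<longlonglongrightarrow> \<alpha>" and be: "(\<lambda>k. measure M (gap_middle b (g k))) \<longlonglongrightarrow> \<beta>"
    by simp_all
  define c where "c = a - b"
  define t where "t k = int (h (g k) + a)" for k
  define Q where "Q k = gap_middle a (g k) \<times> gap_middle b (g k)" for k
  have Qm: "Q k \<in> sets MM" for k unfolding Q_def by (intro pair_measureI gap_middle_sets)
  have rect: "(\<lambda>k. measure MM ((F1 \<times> F2) \<inter> Q k \<inter> prepair (t k) (t k) (G1 \<times> G2)))
      \<longlonglongrightarrow> \<alpha> * \<beta> * measure MM ((F1 \<times> F2) \<inter> prepair 0 (int c) (G1 \<times> G2))"
    if F: "F1 \<in> sets M" "F2 \<in> sets M" and G: "G1 \<in> sets M" "G2 \<in> sets M" for F1 F2 G1 G2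
  proof -
    define G2' where "G2' = preshift (int c) G2"
    have G2'm: "G2' \<in> sets M" unfolding G2'_def using measurable_sets[OF shift_power_measurable G(2)] by simp
    have t2: "preshift (t k) G2 = preshift (int (h (g k) + b)) G2'" for k
    proof -
      have "shift_power (int c) (shift_power (int (h (g k) + b)) x) = shift_power (t k) x" for x
        unfolding shift_power_add t_def c_def using ab by (simp add: of_nat_diff add.commute)
      then show ?thesis unfolding G2'_def using shift_power_X by (auto simp: vimage_def)
    qed
    have vm: "preshift k B \<in> sets M" if "B \<in> sets M" for k B
      using measurable_sets[OF shift_power_measurable that, of k] by simp
    have rew: "(F1 \<times> F2) \<inter> Q k \<inter> prepair (t k) (t k) (G1 \<times> G2)
       = ((F1 \<inter> gap_middle a (g k)) \<inter> preshift (t k) G1) \<times>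
         ((F2 \<inter> gap_middle b (g k)) \<inter> preshift (int (h (g k) + b)) G2')" for k
      unfolding pshift_vimage_Times Q_def t2[symmetric] by blast
    have eq: "measure MM ((F1 \<times> F2) \<inter> Q k \<inter> prepair (t k) (t k) (G1 \<times> G2))
       = measure M ((F1 \<inter> gap_middle a (g k)) \<inter> (shift_power (int (h (g k) + a)) -` G1 \<inter> space M)) *
         measure M ((F2 \<inter> gap_middle b (g k)) \<inter> (shift_power (int (h (g k) + b)) -` G2' \<inter> space M))" for k
      unfolding rew space_M unfolding t_def
      by (rule measure_MM_Times[OF sets.Int[OF sets.Int[OF F(1) gap_middle_sets] vm[OF G(1)]]
            sets.Int[OF sets.Int[OF F(2) gap_middle_sets] vm[OF G2'm]]])
    have eq2: "\<alpha> * \<beta> * measure MM ((F1 \<times> F2) \<inter> prepair 0 (int c) (G1 \<times> G2))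
       = (\<alpha> * measure M (F1 \<inter> ((\<lambda>x. x) -` G1 \<inter> space M))) * (\<beta> * measure M (F2 \<inter> ((\<lambda>x. x) -` G2' \<inter> space M)))"
    proof -
      have "(F1 \<times> F2) \<inter> prepair 0 (int c) (G1 \<times> G2) = (F1 \<inter> (G1 \<inter> X)) \<times> (F2 \<inter> (G2' \<inter> X))"
        unfolding pshift_vimage_Times G2'_def by auto
      moreover have "measure MM ((F1 \<inter> (G1 \<inter> X)) \<times> (F2 \<inter> (G2' \<inter> X))) = measure M (F1 \<inter> (G1 \<inter> X)) * measure M (F2 \<inter> (G2' \<inter> X))"
        using F G G2'm sets.top[of M] by (intro measure_MM_Times sets.Int) auto
      ultimately show ?thesis by simp
    qed
    show ?thesis unfolding eq eq2
      by (intro tendsto_mult gap_middle_weak_limit[OF g al] gap_middle_weak_limit[OF g be] F G G2'm)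
  qed
  (* The limit relation is known for rectangles F and G; it extends to all F first, then to all G. *)
  have step1: "(\<lambda>k. measure MM (F \<inter> Q k \<inter> prepair (t k) (t k) (G1 \<times> G2)))
      \<longlonglongrightarrow> \<alpha> * \<beta> * measure MM (F \<inter> prepair 0 (int c) (G1 \<times> G2))"
    if F: "F \<in> sets MM" and G: "G1 \<in> sets M" "G2 \<in> sets M" for F G1 G2
  proof -
    have Gm: "prepair k l (G1 \<times> G2) \<in> sets MM" for k l
      using measurable_sets[OF pshift_measurable pair_measureI[OF G]] by simp
    have "(\<lambda>k. measure MM ((Q k \<inter> prepair (t k) (t k) (G1 \<times> G2)) \<inter> ((\<lambda>x. x) -` F \<inter> space MM)))
      \<longlonglongrightarrow> \<alpha> * \<beta> * measure MM ((prepair 0 (int c) (G1 \<times> G2)) \<inter> ((\<lambda>x. x) -` F \<inter> space MM))"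
    proof (rule MM.limit_on_generator_extends[OF MM.finite_measure_axioms rectangles_generate
        measurable_ident_sets[OF refl] _ _ measurable_ident_sets[OF refl] _ Gm _ F])
      show "distr MM MM (\<lambda>x. x) = MM" "distr MM MM (\<lambda>x. x) = MM" by simp_all
      show "Q k \<inter> prepair (t k) (t k) (G1 \<times> G2) \<in> sets MM" for k using Qm Gm by blast
      fix H assume "H \<in> {C \<times> D |C D. C \<in> sets M \<and> D \<in> sets M}"
      then obtain C D where H: "H = C \<times> D" "C \<in> sets M" "D \<in> sets M" by blast
      have HX: "(\<lambda>x. x) -` H \<inter> space MM = C \<times> D" using sets.sets_into_space[OF H(2)] sets.sets_into_space[OF H(3)] H(1) by auto
      show "(\<lambda>k. measure MM ((Q k \<inter> prepair (t k) (t k) (G1 \<times> G2)) \<inter> ((\<lambda>x. x) -` H \<inter> space MM)))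
      \<longlonglongrightarrow> \<alpha> * \<beta> * measure MM ((prepair 0 (int c) (G1 \<times> G2)) \<inter> ((\<lambda>x. x) -` H \<inter> space MM))"
        unfolding HX using rect[OF H(2,3) G] by (simp only: Int_ac)
    qed
    moreover have "(\<lambda>x. x) -` F \<inter> space MM = F" using sets.sets_into_space[OF F] by auto
    ultimately show ?thesis by (simp only: Int_ac)
  qed
  have step2: "(\<lambda>k. measure MM ((F \<inter> Q k) \<inter> (pshift (t k) (t k) -` G \<inter> space MM)))
      \<longlonglongrightarrow> \<alpha> * \<beta> * measure MM (F \<inter> (pshift 0 (int c) -` G \<inter> space MM))"
    if F: "F \<in> sets MM" and G: "G \<in> sets MM" for F G
  proof (rule MM.limit_on_generator_extends[OF MM.finite_measure_axioms rectangles_generate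
      pshift_measurable pshift_preserving _ pshift_measurable pshift_preserving F _ G])
    show "F \<inter> Q k \<in> sets MM" for k using F Qm by blast
    fix H assume "H \<in> {C \<times> D |C D. C \<in> sets M \<and> D \<in> sets M}"
    then obtain C D where H: "H = C \<times> D" "C \<in> sets M" "D \<in> sets M" by blast
    show "(\<lambda>k. measure MM ((F \<inter> Q k) \<inter> (pshift (t k) (t k) -` H \<inter> space MM)))
      \<longlonglongrightarrow> \<alpha> * \<beta> * measure MM (F \<inter> (pshift 0 (int c) -` H \<inter> space MM))"
      unfolding H(1) space_MM by (rule step1[OF F H(2,3)])
  qed
  have inv: "prepair (int n) (int n) E = E" for n :: nat
  proof (induction n)
    case 0
    have "E \<subseteq> X \<times> X" using sets.sets_into_space[OF E(1)] by simp
    then show ?case by (auto simp: pshift_def map_prod_def)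
  next
    case (Suc n)
    have p: "pshift (int (Suc n)) (int (Suc n)) z = pshift (int n) (int n) (pshift 1 1 z)" for z
      by (cases z) (simp add: pshift_def shift_power_add ac_simps)
    have "prepair (int (Suc n)) (int (Suc n)) E = prepair 1 1 (pshift (int n) (int n) -` E \<inter> X \<times> X)"
      unfolding p vimage_def using shift_power_X by (auto simp: pshift_def)
    then show ?case using Suc E(2) by simp
  qed
  have "(X \<times> X - E) \<inter> Q k \<inter> (pshift (t k) (t k) -` E \<inter> space MM) = {}" for k
    unfolding t_def space_MM inv by blast
  then have "(\<lambda>k::nat. 0) \<longlonglongrightarrow> \<alpha> * \<beta> * measure MM ((X \<times> X - E) \<inter> (pshift 0 (int c) -` E \<inter> space MM))"
    using step2[of "X \<times> X - E" E] E(1) sets.compl_sets[OF E(1)] by simp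
  then have "\<alpha> * \<beta> * measure MM ((X \<times> X - E) \<inter> (pshift 0 (int c) -` E \<inter> space MM)) = 0"
    by (simp add: LIMSEQ_const_iff)
  then have "measure MM ((X \<times> X - E) \<inter> prepair 0 (int c) E) = 0" using pos by simp
  moreover have "1 \<le> c" using ab by (simp add: c_def)
  ultimately show ?thesis by blast
qed

text \<open>
  An invariant set \<open>E\<close> is, up to a null set, also invariant under translating the second coordinate by \<open>c\<close>. By
  ergodicity of the power \<open>c\<close> of the shift it is independent of the second coordinate even when the first one
  is restricted to \<open>A\<close>, and by ergodicity of the shift it is independent of the first coordinate. So it is
  independent of all rectangles, hence of itself.
\<close>

theorem ergodic_product: "ergodic_system MM (pshift 1 1)"
  unfolding ergodic_system_def invariant_measure_def
proof (intro conjI ballI impI MM.prob_space_axioms pshift_measurable pshift_preserving)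
  fix E assume Em: "E \<in> sets MM" and "pshift 1 1 -` E \<inter> space MM = E"
  then have Einv: "prepair 1 1 E = E" by simp
  obtain c :: nat where c: "1 \<le> c" "measure MM ((X \<times> X - E) \<inter> prepair 0 (int c) E) = 0"
    using invariant_set_translates[OF Em Einv] by blast
  have vm: "prepair k l B \<in> sets MM" if "B \<in> sets MM" for k l B
    using measurable_sets[OF pshift_measurable that, of k l] by simp
  have vpres: "measure MM (prepair k l B) = measure MM B" if "B \<in> sets MM" for k l B
    using measure_distr[OF pshift_measurable that, of k l] by (simp add: pshift_preserving)
  define E' where "E' = prepair 0 (int c) E"
  have E'm: "E' \<in> sets MM" unfolding E'_def by (rule vm[OF Em])
  have sub: "E \<subseteq> X \<times> X" "E' \<subseteq> X \<times> X" using sets.sets_into_space[OF Em] by (auto simp: E'_def)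
  have null1: "measure MM (E' - E) = 0"
  proof -
    have "E' - E = (X \<times> X - E) \<inter> E'" using sub by blast
    then show ?thesis using c(2) by (simp add: E'_def)
  qed
  have null2: "measure MM (E - E') = 0"
  proof -
    have "measure MM E' = measure MM E" unfolding E'_def by (rule vpres[OF Em])
    moreover have "measure MM E = measure MM (E \<inter> E') + measure MM (E - E')"
      using MM.finite_measure_Diff'[OF Em E'm] by simp
    moreover have "measure MM E' = measure MM (E' \<inter> E) + measure MM (E' - E)"
      using MM.finite_measure_Diff'[OF E'm Em] by simp
    ultimately show ?thesis using null1 by (simp add: Int_commute)
  qed
  have swap: "measure MM (E \<inter> prepair 0 (int c) H) = measure MM (E \<inter> H)" if H: "H \<in> sets MM" for H
  proof -
    let ?H = "prepair 0 (int c) H"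
    have Hm: "?H \<in> sets MM" by (rule vm[OF H])
    have le: "measure MM (A \<inter> ?H) \<le> measure MM (B \<inter> ?H) + measure MM (A - B)"
      if "A \<in> sets MM" "B \<in> sets MM" for A B
    proof -
      have "measure MM (A \<inter> ?H) \<le> measure MM ((B \<inter> ?H) \<union> (A - B))"
        using that Hm by (intro MM.finite_measure_mono) auto
      also have "\<dots> \<le> measure MM (B \<inter> ?H) + measure MM (A - B)"
        using that Hm by (intro measure_Un_le) auto
      finally show ?thesis .
    qed
    have "measure MM (E \<inter> ?H) = measure MM (E' \<inter> ?H)"
      using le[OF Em E'm] le[OF E'm Em] null1 null2 by linarith
    also have "E' \<inter> ?H = prepair 0 (int c) (E \<inter> H)" by (auto simp: E'_def)
    also have "measure MM \<dots> = measure MM (E \<inter> H)" using Em H by (intro vpres) auto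
    finally show ?thesis .
  qed
  have snd_vimage: "{y \<in> space MM. ((shift ^^ c) ^^ i) (snd y) \<in> B} = X \<times> preshift (int (c * i)) B" for i B
  proof -
    have "(shift ^^ c) ^^ i = shift_power (int (c * i))" unfolding funpow_mult by (rule shift_funpow)
    then show ?thesis by (auto simp: space_pair_measure)
  qed
  have vmM: "preshift k B \<in> sets M" if "B \<in> sets M" for k B
    using measurable_sets[OF shift_power_measurable that, of k] by simp
  have XM: "X \<in> sets M" using sets.top[of M] by simp
  have prod: "measure MM (E \<inter> (A \<times> B)) = measure MM E * measure MM (A \<times> B)" if A: "A \<in> sets M" and B: "B \<in> sets M" for A B
  proof -
    have AX: "A \<times> X \<in> sets MM" using A XM by (rule pair_measureI)
    have "measure MM ((E \<inter> (A \<times> X)) \<inter> {y \<in> space MM. snd y \<in> B}) = measure MM (E \<inter> (A \<times> X)) * measure M B"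
    proof (rule independent_of_ergodic_factor[OF ergodic_power[OF c(1)] MM.prob_space_axioms measurable_snd _ B])
      show "distr MM M snd = M"
      proof (rule measure_eqI)
        fix B assume "B \<in> sets (distr MM M snd)"
        then have B: "B \<in> sets M" by simp
        have "snd -` B \<inter> space MM = X \<times> B" using sets.sets_into_space[OF B] by auto
        then show "emeasure (distr MM M snd) B = emeasure M B"
          using B XM emeasure_space_1 by (simp add: emeasure_distr emeasure_pair_measure_Times)
      qed simp
      show "E \<inter> (A \<times> X) \<in> sets MM" using Em AX by auto
      fix i
      have "measure MM ((E \<inter> (A \<times> X)) \<inter> (X \<times> preshift (int (c * i)) B)) =
        measure MM ((E \<inter> (A \<times> X)) \<inter> (X \<times> B))"
      proof (induction i)
        case 0
        have "preshift (int (c * 0)) B = B" using sets.sets_into_space[OF B] by auto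
        then show ?case by (simp only:)
      next
        case (Suc i)
        let ?B = "preshift (int (c * i)) B"
        have "preshift (int (c * Suc i)) B = preshift (int c) ?B"
        proof -
          have "shift_power (int (c * Suc i)) x = shift_power (int (c * i)) (shift_power (int c) x)" for x
            by (simp add: shift_power_add algebra_simps)
          then show ?thesis using shift_power_X by (auto simp: vimage_def)
        qed
        then have st: "(E \<inter> (A \<times> X)) \<inter> (X \<times> preshift (int (c * Suc i)) B) =
          E \<inter> (prepair 0 (int c) ((A \<times> X) \<inter> (X \<times> ?B)))"
          using sets.sets_into_space[OF A] shift_power_X by (auto simp: pshift_def)
        have "measure MM ((E \<inter> (A \<times> X)) \<inter> (X \<times> preshift (int (c * Suc i)) B)) =
            measure MM (E \<inter> ((A \<times> X) \<inter> (X \<times> ?B)))"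
          unfolding st by (intro swap sets.Int AX pair_measureI XM vmM B)
        also have "\<dots> = measure MM ((E \<inter> (A \<times> X)) \<inter> (X \<times> B))"
          using Suc by (simp only: Int_assoc)
        finally show ?case .
      qed
      moreover have "{y \<in> space MM. snd y \<in> B} = X \<times> B" using sets.sets_into_space[OF B] by auto
      ultimately show "measure MM ((E \<inter> (A \<times> X)) \<inter> {y \<in> space MM. ((shift ^^ c) ^^ i) (snd y) \<in> B}) =
        measure MM ((E \<inter> (A \<times> X)) \<inter> {y \<in> space MM. snd y \<in> B})"
        by (simp only: snd_vimage)
    qed
    moreover have "(E \<inter> (A \<times> X)) \<inter> {y \<in> space MM. snd y \<in> B} = E \<inter> (A \<times> B)"
      using sub sets.sets_into_space[OF B] by auto
    ultimately have 1: "measure MM (E \<inter> (A \<times> B)) = measure MM (E \<inter> (A \<times> X)) * measure M B" by simp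
    have "measure MM (E \<inter> {y \<in> space MM. fst y \<in> A}) = measure MM E * measure M A"
    proof (rule independent_of_ergodic_factor[OF ergodic_shift MM.prob_space_axioms measurable_fst _ A Em])
      show "distr MM M fst = M" by (rule distr_pair_fst)
      fix i
      show "measure MM (E \<inter> {y \<in> space MM. (shift ^^ i) (fst y) \<in> A}) = measure MM (E \<inter> {y \<in> space MM. fst y \<in> A})"
      proof (induction i)
        case (Suc i)
        let ?A = "{y \<in> space MM. (shift ^^ i) (fst y) \<in> A}"
        have Am: "?A \<in> sets MM"
          using measurable_sets[OF measurable_compose[OF measurable_fst shift_power_measurable] A, of "int i" M]
          by (simp add: shift_funpow vimage_def Int_def conj_commute)
        have "E \<inter> {y \<in> space MM. (shift ^^ Suc i) (fst y) \<in> A} = prepair 1 1 (E \<inter> ?A)"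
          using Einv shift_power_X by (auto simp: pshift_def shift_funpow shift_power_add add.commute)
        then show ?case using Suc vpres[OF sets.Int[OF Em Am], of 1 1] by simp
      qed simp
    qed
    moreover have "E \<inter> {y \<in> space MM. fst y \<in> A} = E \<inter> (A \<times> X)" using sub by auto
    ultimately show ?thesis using 1 measure_MM_Times[OF A B] by simp
  qed
  have "(\<lambda>n::nat. measure MM (E \<inter> ((\<lambda>x. x) -` H \<inter> space MM))) \<longlonglongrightarrow> measure MM E * measure MM (X \<times> X \<inter> ((\<lambda>x. x) -` H \<inter> space MM))"
    if H: "H \<in> sets MM" for H
  proof (rule MM.limit_on_generator_extends[OF MM.finite_measure_axioms rectangles_generate
        measurable_ident_sets[OF refl] _ Em measurable_ident_sets[OF refl] _ _ _ H])
    show "distr MM MM (\<lambda>x. x) = MM" "distr MM MM (\<lambda>x. x) = MM" by simp_all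
    show "X \<times> X \<in> sets MM" by (intro pair_measureI XM)
    fix H assume "H \<in> {C \<times> D |C D. C \<in> sets M \<and> D \<in> sets M}"
    then obtain C D where H: "H = C \<times> D" "C \<in> sets M" "D \<in> sets M" by blast
    have HX: "(\<lambda>x. x) -` H \<inter> space MM = C \<times> D" "X \<times> X \<inter> C \<times> D = C \<times> D"
      using sets.sets_into_space[OF H(2)] sets.sets_into_space[OF H(3)] H(1) by auto
    show "(\<lambda>n::nat. measure MM (E \<inter> ((\<lambda>x. x) -` H \<inter> space MM))) \<longlonglongrightarrow> measure MM E * measure MM (X \<times> X \<inter> ((\<lambda>x. x) -` H \<inter> space MM))"
      unfolding HX prod[OF H(2,3)] by simp
  qed
  from this[OF Em] have "measure MM E = measure MM E * measure MM E"
    using sub(1) by (simp add: LIMSEQ_const_iff Int_absorb2 inf.absorb2 vimage_def)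
  then show "measure MM E = 0 \<or> measure MM E = 1" by auto
qed

end

section \<open>Weak mixing\<close>

lemma cesaro_dilate:
  fixes c :: "nat \<Rightarrow> real"
  assumes c: "\<And>i. 0 \<le> c i" and lim: "(\<lambda>n. (\<Sum>i<n. c i) / real n) \<longlonglongrightarrow> 0" and A: "1 \<le> A"
  shows "(\<lambda>n. (\<Sum>i<n. c (i * A)) / real n) \<longlonglongrightarrow> 0"
proof -
  have "strict_mono (\<lambda>n. n * A)" using A by (intro strict_monoI) simp
  from LIMSEQ_subseq_LIMSEQ[OF lim this]
  have "(\<lambda>n. real A * ((\<Sum>i<n * A. c i) / real (n * A))) \<longlonglongrightarrow> real A * 0"
    by (intro tendsto_mult tendsto_const) (simp add: o_def)
  then have lim': "(\<lambda>n. real A * ((\<Sum>i<n * A. c i) / real (n * A))) \<longlonglongrightarrow> 0" by simp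
  show ?thesis
  proof (rule Lim_null_comparison[OF always_eventually lim'], intro allI)
    fix n
    have "(\<Sum>i<n. c (i * A)) = (\<Sum>j\<in>(\<lambda>i. i * A) ` {..<n}. c j)"
      using A by (subst sum.reindex) (auto simp: inj_on_def)
    also have "\<dots> \<le> (\<Sum>i<n * A. c i)"
      using A c by (intro sum_mono2) auto
    finally have "(\<Sum>i<n. c (i * A)) / real n \<le> (\<Sum>i<n * A. c i) / real n" by (intro divide_right_mono) auto
    moreover have "real A * ((\<Sum>i<n * A. c i) / real (n * A)) = (\<Sum>i<n * A. c i) / real n" using A by simp
    moreover have "0 \<le> (\<Sum>i<n. c (i * A)) / real n" using c by (simp add: sum_nonneg)
    ultimately show "norm ((\<Sum>i<n. c (i * A)) / real n) \<le> real A * ((\<Sum>i<n * A. c i) / real (n * A))" by simp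
  qed
qed

lemma cesaro_abs_of_square:
  fixes c :: "nat \<Rightarrow> real"
  assumes lim: "(\<lambda>n. (\<Sum>i<n. (c i)\<^sup>2) / real n) \<longlonglongrightarrow> 0"
  shows "(\<lambda>n. (\<Sum>i<n. \<bar>c i\<bar>) / real n) \<longlonglongrightarrow> 0"
proof -
  have le: "(\<Sum>i<n. \<bar>c i\<bar>) / real n \<le> sqrt ((\<Sum>i<n. (c i)\<^sup>2) / real n)" for n
  proof (rule real_le_rsqrt)
    have "(\<Sum>i<n. \<bar>c i\<bar> * 1)\<^sup>2 \<le> (\<Sum>i<n. \<bar>c i\<bar>\<^sup>2) * (\<Sum>i<n. 1\<^sup>2)"
      by (rule Cauchy_Schwarz_ineq_sum)
    then have "(\<Sum>i<n. \<bar>c i\<bar>)\<^sup>2 \<le> (\<Sum>i<n. (c i)\<^sup>2) * real n" by simp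
    then have "(\<Sum>i<n. \<bar>c i\<bar>)\<^sup>2 / (real n * real n) \<le> (\<Sum>i<n. (c i)\<^sup>2) * real n / (real n * real n)"
      by (intro divide_right_mono) auto
    then show "((\<Sum>i<n. \<bar>c i\<bar>) / real n)\<^sup>2 \<le> (\<Sum>i<n. (c i)\<^sup>2) / real n"
      by (cases "n = 0") (simp_all add: power_divide power2_eq_square)
  qed
  have "(\<lambda>n. sqrt ((\<Sum>i<n. (c i)\<^sup>2) / real n)) \<longlonglongrightarrow> sqrt 0" by (intro tendsto_real_sqrt lim)
  then have lim': "(\<lambda>n. sqrt ((\<Sum>i<n. (c i)\<^sup>2) / real n)) \<longlonglongrightarrow> 0" by simp
  show ?thesis
  proof (rule Lim_null_comparison[OF always_eventually lim'], intro allI)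
    fix n
    have "0 \<le> (\<Sum>i<n. \<bar>c i\<bar>) / real n" by (simp add: sum_nonneg)
    then show "norm ((\<Sum>i<n. \<bar>c i\<bar>) / real n) \<le> sqrt ((\<Sum>i<n. (c i)\<^sup>2) / real n)" using le[of n] by simp
  qed
qed

text \<open>
  An instance of the method of van der Corput. With \<open>Z\<close> the sum of \<open>1\<^sub>C\<^sub>k - q\<close> over \<open>k < n\<close>, the integral of \<open>Z\<close> over
  \<open>G\<close> is \<open>n\<close> times the deviation from independence, and its square is at most the integral of \<open>Z\<^sup>2\<close>, a double sum
  of correlations that is \<open>o(n\<^sup>2)\<close>.
\<close>

lemma (in prob_space) independent_of_averaged_events:
  assumes G: "G \<in> sets M" and C: "\<And>n::nat. C n \<in> sets M"
    and const: "\<And>n. measure M (G \<inter> C n) = measure M (G \<inter> C 0)"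
    and q: "\<And>n. measure M (C n) = q"
    and corr: "\<And>k l. k \<le> l \<Longrightarrow> measure M (C k \<inter> C l) = \<phi> (l - k)"
    and lim: "(\<lambda>n. (\<Sum>i<n. \<bar>\<phi> i - q\<^sup>2\<bar>) / real n) \<longlonglongrightarrow> 0"
  shows "measure M (G \<inter> C 0) = measure M G * q"
proof -
  define \<delta> where "\<delta> = measure M (G \<inter> C 0) - measure M G * q"
  have main: "\<delta>\<^sup>2 \<le> 2 * ((\<Sum>i<n. \<bar>\<phi> i - q\<^sup>2\<bar>) / real n)" if n: "1 \<le> n" for n
  proof -
    define Z where "Z x = (\<Sum>k<n. indicator (C k) x - q)" for x
    have q1: "\<bar>indicator (C k) x - q\<bar> \<le> 1" for k x
      using q[of k] measure_nonneg[of M "C k"] prob_le_1[of "C k"] by (auto simp: indicator_def)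
    have Zb: "\<bar>Z x\<bar> \<le> real n" for x
    proof -
      have "\<bar>Z x\<bar> \<le> (\<Sum>k<n. \<bar>indicator (C k) x - q\<bar>)" unfolding Z_def by (rule sum_abs)
      also have "\<dots> \<le> (\<Sum>k<n. 1)" by (intro sum_mono q1)
      finally show ?thesis by simp
    qed
    have Zm[measurable]: "Z \<in> borel_measurable M" unfolding Z_def using C by measurable
    note [measurable] = G C
    define Y where "Y x = indicator G x * Z x" for x
    have Ym[measurable]: "Y \<in> borel_measurable M" unfolding Y_def by measurable
    have Yb: "\<bar>Y x\<bar> \<le> real n" for x using Zb[of x] by (auto simp: Y_def indicator_def)
    have sq: "z\<^sup>2 \<le> (real n)\<^sup>2" if "\<bar>z\<bar> \<le> real n" for z :: real
      using that by (simp add: abs_le_square_iff[symmetric])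
    have Yi1: "integrable M Y"
      by (rule integrable_const_bound[where B="real n"], use Yb in simp, simp)
    have Yi2: "integrable M (\<lambda>x. (Y x)\<^sup>2)"
      by (rule integrable_const_bound[where B="(real n)\<^sup>2"], use sq[OF Yb] in simp, simp)
    note Yi = Yi1 Yi2
    have Zi: "integrable M (\<lambda>x. (Z x)\<^sup>2)"
      by (rule integrable_const_bound[where B="(real n)\<^sup>2"], use sq[OF Zb] in simp, simp)
    have ind: "integrable M (indicator A :: _ \<Rightarrow> real)" "(\<integral>x. indicator A x \<partial>M) = measure M A" if "A \<in> sets M" for A
      using that sets.sets_into_space[OF that] by (auto simp: emeasure_eq_measure Int_absorb2)
    have EY: "(\<integral>x. Y x \<partial>M) = real n * \<delta>"
    proof -
      have "Y x = (\<Sum>k<n. indicator (G \<inter> C k) x - q * indicator G x)" for x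
        unfolding Y_def Z_def sum_distrib_left by (intro sum.cong) (auto simp: indicator_def)
      then have "(\<integral>x. Y x \<partial>M) = (\<Sum>k<n. \<integral>x. (indicator (G \<inter> C k) x - q * indicator G x) \<partial>M)"
        using ind(1) G C by (simp add: Bochner_Integration.integral_sum)
      also have "\<dots> = (\<Sum>k<n. \<delta>)"
      proof (rule sum.cong[OF refl])
        fix k
        have "(\<integral>x. (indicator (G \<inter> C k) x - q * indicator G x) \<partial>M) = measure M (G \<inter> C k) - q * measure M G"
          using ind[of "G \<inter> C k"] ind[of G] G C by (simp add: Bochner_Integration.integral_diff)
        then show "(\<integral>x. (indicator (G \<inter> C k) x - q * indicator G x) \<partial>M) = \<delta>"
          by (simp add: \<delta>_def const[of k])
      qed
      finally show ?thesis by simp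
    qed
    have EZ: "(\<integral>x. (Z x)\<^sup>2 \<partial>M) = (\<Sum>k<n. \<Sum>l<n. measure M (C k \<inter> C l) - q\<^sup>2)"
    proof -
      have "(Z x)\<^sup>2 = (\<Sum>k<n. \<Sum>l<n. indicator (C k \<inter> C l) x - q * indicator (C k) x - q * indicator (C l) x + q\<^sup>2)" for x
        unfolding Z_def power2_eq_square sum_product
        by (intro sum.cong refl) (auto simp: indicator_def power2_eq_square algebra_simps)
      then have "(\<integral>x. (Z x)\<^sup>2 \<partial>M) = (\<Sum>k<n. \<Sum>l<n. \<integral>x. (indicator (C k \<inter> C l) x - q * indicator (C k) x - q * indicator (C l) x + q\<^sup>2) \<partial>M)"
        using ind(1) C by (simp add: Bochner_Integration.integral_sum)
      also have "\<dots> = (\<Sum>k<n. \<Sum>l<n. measure M (C k \<inter> C l) - q\<^sup>2)"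
      proof (intro sum.cong refl)
        fix k l
        have "(\<integral>x. (indicator (C k \<inter> C l) x - q * indicator (C k) x - q * indicator (C l) x + q\<^sup>2) \<partial>M)
          = measure M (C k \<inter> C l) - q * measure M (C k) - q * measure M (C l) + q\<^sup>2"
          using ind[of "C k \<inter> C l"] ind[OF C[of k]] ind[OF C[of l]] C
          by (simp add: Bochner_Integration.integral_diff Bochner_Integration.integral_add prob_space)
        then show "(\<integral>x. (indicator (C k \<inter> C l) x - q * indicator (C k) x - q * indicator (C l) x + q\<^sup>2) \<partial>M) = measure M (C k \<inter> C l) - q\<^sup>2"
          by (simp add: q power2_eq_square)
      qed
      finally show ?thesis .
    qed
    have "0 \<le> (\<integral>x. (Y x)\<^sup>2 \<partial>M) - (\<integral>x. Y x \<partial>M)\<^sup>2"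
      by (subst variance_eq[OF Yi, symmetric]) (rule variance_positive)
    then have "(real n * \<delta>)\<^sup>2 \<le> (\<integral>x. (Y x)\<^sup>2 \<partial>M)" unfolding EY by linarith
    also have "\<dots> \<le> (\<integral>x. (Z x)\<^sup>2 \<partial>M)"
      using Yi Zi by (intro integral_mono) (auto simp: Y_def indicator_def)
    also have "\<dots> \<le> (\<Sum>k<n. 2 * (\<Sum>i<n. \<bar>\<phi> i - q\<^sup>2\<bar>))"
      unfolding EZ
    proof (rule sum_mono)
      fix k assume k: "k \<in> {..<n}"
      have split: "{..<n} = {..<k} \<union> {k..<n}" using k by auto
      have "(\<Sum>l<n. measure M (C k \<inter> C l) - q\<^sup>2) = (\<Sum>l<k. measure M (C k \<inter> C l) - q\<^sup>2) + (\<Sum>l=k..<n. measure M (C k \<inter> C l) - q\<^sup>2)"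
        unfolding split by (rule sum.union_disjoint) auto
      also have "(\<Sum>l<k. measure M (C k \<inter> C l) - q\<^sup>2) \<le> (\<Sum>l<k. \<bar>\<phi> (k - l) - q\<^sup>2\<bar>)"
        by (intro sum_mono) (use corr in \<open>auto simp: Int_commute\<close>)
      also have "(\<Sum>l<k. \<bar>\<phi> (k - l) - q\<^sup>2\<bar>) = (\<Sum>i\<in>(\<lambda>l. k - l) ` {..<k}. \<bar>\<phi> i - q\<^sup>2\<bar>)"
        by (subst sum.reindex) (auto simp: inj_on_def)
      also have "\<dots> \<le> (\<Sum>i<Suc k. \<bar>\<phi> i - q\<^sup>2\<bar>)" by (intro sum_mono2) auto
      also have "\<dots> \<le> (\<Sum>i<n. \<bar>\<phi> i - q\<^sup>2\<bar>)" using k by (intro sum_mono2) auto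
      also have "(\<Sum>l=k..<n. measure M (C k \<inter> C l) - q\<^sup>2) \<le> (\<Sum>l=k..<n. \<bar>\<phi> (l - k) - q\<^sup>2\<bar>)"
        by (intro sum_mono) (use corr in auto)
      also have "(\<Sum>l=k..<n. \<bar>\<phi> (l - k) - q\<^sup>2\<bar>) = (\<Sum>i\<in>(\<lambda>l. l - k) ` {k..<n}. \<bar>\<phi> i - q\<^sup>2\<bar>)"
        by (subst sum.reindex) (auto simp: inj_on_def)
      also have "\<dots> \<le> (\<Sum>i<n. \<bar>\<phi> i - q\<^sup>2\<bar>)" by (intro sum_mono2) auto
      finally show "(\<Sum>l<n. measure M (C k \<inter> C l) - q\<^sup>2) \<le> 2 * (\<Sum>i<n. \<bar>\<phi> i - q\<^sup>2\<bar>)" by simp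
    qed
    also have "\<dots> = real n * (2 * (\<Sum>i<n. \<bar>\<phi> i - q\<^sup>2\<bar>))" by simp
    finally have "real n * real n * \<delta>\<^sup>2 \<le> real n * (2 * (\<Sum>i<n. \<bar>\<phi> i - q\<^sup>2\<bar>))"
      by (simp add: power2_eq_square mult.assoc mult.left_commute)
    then show ?thesis using n by (simp add: field_simps)
  qed
  have "(\<lambda>n. 2 * ((\<Sum>i<n. \<bar>\<phi> i - q\<^sup>2\<bar>) / real n)) \<longlonglongrightarrow> 2 * 0" by (intro tendsto_mult tendsto_const lim)
  then have "\<delta>\<^sup>2 \<le> 2 * 0"
    by (rule LIMSEQ_le_const) (use main in blast)
  then show ?thesis by (simp add: \<delta>_def)
qed

context rank_one_system
begin

definition self_overlap :: "(int \<Rightarrow> nat) set \<Rightarrow> int \<Rightarrow> real" where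
  "self_overlap B k = measure M (B \<inter> preshift k B)"

lemma vimage_shift_sets: "B \<in> sets M \<Longrightarrow> preshift k B \<in> sets M"
  using measurable_sets[OF shift_power_measurable, of B k] by simp

lemma measure_overlap_shift:
  assumes B: "B \<in> sets M"
  shows "measure M ((preshift k B) \<inter> preshift l B) = self_overlap B (l - k)"
proof -
  have "(preshift k B) \<inter> preshift l B = preshift k (B \<inter> (shift_power (l - k) -` B \<inter> X))"
    using shift_power_X by (auto simp: shift_power_add)
  then show ?thesis
    unfolding self_overlap_def using B vimage_shift_sets by (simp only: measure_shift_power sets.Int)
qed

lemma self_overlap_minus:
  assumes B: "B \<in> sets M" shows "self_overlap B (- k) = self_overlap B k"
proof -
  have 0: "preshift 0 B = B" using sets.sets_into_space[OF B] by auto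
  show ?thesis
    using measure_overlap_shift[OF B, of k 0] measure_overlap_shift[OF B, of 0 k]
    unfolding 0 by (simp add: Int_commute)
qed

lemma self_overlap_abs: "B \<in> sets M \<Longrightarrow> self_overlap B \<bar>k\<bar> = self_overlap B k"
  using self_overlap_minus[of B k] by (auto simp: abs_if)

text \<open>
  Ergodicity of the square, applied to \<open>B \<times> B\<close>, gives the mean of the squares of the overlaps and ergodicity
  gives their mean; together these yield the mean of \<open>(p i - q)\<^sup>2\<close>.
\<close>

theorem weakly_mixing:
  assumes B: "B \<in> sets M"
  shows "(\<lambda>n. (\<Sum>i<n. \<bar>self_overlap B (int i) - (measure M B)\<^sup>2\<bar>) / real n) \<longlonglongrightarrow> 0"
proof (rule cesaro_abs_of_square)
  define q where "q = (measure M B)\<^sup>2"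
  define p where "p i = self_overlap B (int i)" for i :: nat
  have BB: "B \<times> B \<in> sets MM" using B by blast
  have pw: "(pshift 1 1 ^^ i) = pshift (int i) (int i)" for i
  proof (induction i)
    case (Suc i)
    have "pshift 1 1 (pshift (int i) (int i) z) = pshift (int (Suc i)) (int (Suc i)) z" for z
      by (cases z) (simp add: pshift_def shift_power_add add.commute)
    then show ?case using Suc by (simp add: fun_eq_iff)
  qed (simp add: pshift_def fun_eq_iff)
  have "(\<lambda>n. (\<Sum>i<n. measure MM (B \<times> B \<inter> {y \<in> space MM. (pshift 1 1 ^^ i) y \<in> B \<times> B})) / real n)
    \<longlonglongrightarrow> measure MM (B \<times> B) * measure MM (B \<times> B)"
    by (rule weak_average[OF ergodic_product MM.prob_space_axioms measurable_ident_sets[OF refl] _ BB BB]) simp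
  moreover have "measure MM (B \<times> B \<inter> {y \<in> space MM. (pshift 1 1 ^^ i) y \<in> B \<times> B}) = (p i)\<^sup>2" for i
  proof -
    have "B \<times> B \<inter> {y \<in> space MM. (pshift 1 1 ^^ i) y \<in> B \<times> B}
      = (B \<inter> preshift (int i) B) \<times> (B \<inter> preshift (int i) B)"
      unfolding pw by (auto simp: pshift_def space_pair_measure)
    then show ?thesis using B vimage_shift_sets[OF B, of "int i"]
      by (simp only: measure_MM_Times sets.Int) (simp add: p_def self_overlap_def power2_eq_square)
  qed
  ultimately have sq: "(\<lambda>n. (\<Sum>i<n. (p i)\<^sup>2) / real n) \<longlonglongrightarrow> q * q"
    using measure_MM_Times[OF B B] by (simp add: q_def power2_eq_square)
  have "(\<lambda>n. (\<Sum>i<n. measure M (B \<inter> {y \<in> space M. (shift ^^ i) y \<in> B})) / real n) \<longlonglongrightarrow> measure M B * measure M B"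
    by (rule weak_average[OF ergodic_shift prob_space_axioms measurable_ident_sets[OF refl] _ B B]) simp
  moreover have "measure M (B \<inter> {y \<in> space M. (shift ^^ i) y \<in> B}) = p i" for i
    unfolding shift_funpow p_def self_overlap_def by (simp add: vimage_def Int_def conj_commute)
  ultimately have li: "(\<lambda>n. (\<Sum>i<n. p i) / real n) \<longlonglongrightarrow> q" by (simp add: q_def power2_eq_square)
  have "(\<lambda>n. (\<Sum>i<n. (p i)\<^sup>2) / real n - 2 * q * ((\<Sum>i<n. p i) / real n) + q * q) \<longlonglongrightarrow> q * q - 2 * q * q + q * q"
    by (intro tendsto_intros sq li)
  then have l0: "(\<lambda>n. (\<Sum>i<n. (p i)\<^sup>2) / real n - 2 * q * ((\<Sum>i<n. p i) / real n) + q * q) \<longlonglongrightarrow> 0"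
    by (simp add: algebra_simps)
  have ev: "\<forall>\<^sub>F n in sequentially. (\<Sum>i<n. (p i)\<^sup>2) / real n - 2 * q * ((\<Sum>i<n. p i) / real n) + q * q
      = (\<Sum>i<n. (p i - q)\<^sup>2) / real n"
    using eventually_ge_at_top[of 1]
  proof eventually_elim
    case (elim n)
    have "(\<Sum>i<n. (p i - q)\<^sup>2) = (\<Sum>i<n. (p i)\<^sup>2) - 2 * q * (\<Sum>i<n. p i) + real n * (q * q)"
      by (simp add: power2_diff sum.distrib sum_subtractf sum_distrib_left power2_eq_square algebra_simps)
    then show ?case using elim by (simp add: field_simps)
  qed
  show "(\<lambda>n. (\<Sum>i<n. (self_overlap B (int i) - (measure M B)\<^sup>2)\<^sup>2) / real n) \<longlonglongrightarrow> 0"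
    using Lim_transform_eventually[OF l0 ev] by (simp only: p_def q_def)
qed

end

section \<open>Translations that preserve a joining\<close>

lemma linear_growth_error:
  fixes f :: "nat \<Rightarrow> real"
  assumes lim: "(\<lambda>n. f n / real n) \<longlonglongrightarrow> A" and e: "0 < e"
  shows "\<exists>C\<ge>0. \<forall>n. \<bar>f n - real n * A\<bar> \<le> C + e * real n"
proof -
  obtain n0 where n0: "\<And>n. n0 \<le> n \<Longrightarrow> \<bar>f n / real n - A\<bar> < e"
    using LIMSEQ_D[OF lim e] by auto
  define C where "C = (\<Sum>n\<le>n0. \<bar>f n - real n * A\<bar>)"
  have C0: "0 \<le> C" unfolding C_def by (simp add: sum_nonneg)
  have "\<bar>f n - real n * A\<bar> \<le> C + e * real n" for n
  proof (cases "n \<le> n0")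
    case True
    have "\<bar>f n - real n * A\<bar> \<le> C" unfolding C_def
      by (rule member_le_sum[of n]) (use True in auto)
    moreover have "0 \<le> e * real n" using e by simp
    ultimately show ?thesis by linarith
  next
    case False
    then have n: "0 < real n" by simp
    have "\<bar>f n - real n * A\<bar> = real n * \<bar>f n / real n - A\<bar>"
    proof -
      have "f n - real n * A = real n * (f n / real n - A)" using n by (simp add: right_diff_distrib)
      then show ?thesis by (simp add: abs_mult)
    qed
    also have "\<dots> \<le> real n * e" using n0[of n] False n by (intro mult_left_mono) auto
    finally show ?thesis using C0 by (simp add: mult.commute)
  qed
  then show ?thesis using C0 by blast
qed

lemma increment_error:
  fixes f1 f2 g1 g2 y1 y2 z1 z2 :: real
  assumes "\<bar>f1 - y1\<bar> \<le> c1" "\<bar>f2 - y2\<bar> \<le> c2" "\<bar>g1 - z1\<bar> \<le> c3" "\<bar>g2 - z2\<bar> \<le> c4" "f1 - f2 = g1 - g2"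
  shows "\<bar>(y1 - y2) - (z1 - z2)\<bar> \<le> c1 + c2 + c3 + c4"
  using assms by linarith

text \<open>
  The increments of \<open>f\<close> and \<open>g\<close> over the two windows are equal. Up to \<open>o(q)\<close> they are \<open>l * A\<close> and \<open>l * B\<close>, and
  \<open>l\<close> is at least a constant multiple of \<open>q\<close>.
\<close>

lemma frequencies_agree_on_windows:
  fixes f g :: "nat \<Rightarrow> real"
  assumes f: "(\<lambda>n. f n / real n) \<longlonglongrightarrow> A" and g: "(\<lambda>n. g n / real n) \<longlonglongrightarrow> B" and D: "0 < D"
    and win: "\<And>H. \<exists>q\<ge>H. \<exists>u l t::nat. u + l \<le> D * q \<and> t \<le> D * q \<and> q \<le> D * l \<and>
      (2 * w \<le> l \<longrightarrow> f (u + (l - w) + t) - f (u + w + t) = g (u + (l - w)) - g (u + w))"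
  shows "A = B"
proof (rule ccontr)
  assume "A \<noteq> B"
  define d where "d = \<bar>A - B\<bar>"
  have d: "0 < d" using \<open>A \<noteq> B\<close> by (simp add: d_def)
  define e where "e = d / (16 * real D * real D)"
  have e: "0 < e" using d D by (simp add: e_def)
  obtain C1 where C1: "0 \<le> C1" "\<And>n. \<bar>f n - real n * A\<bar> \<le> C1 + e * real n" using linear_growth_error[OF f e] by blast
  obtain C2 where C2: "0 \<le> C2" "\<And>n. \<bar>g n - real n * B\<bar> \<le> C2 + e * real n" using linear_growth_error[OF g e] by blast
  define C where "C = 2 * C1 + 2 * C2 + 2 * real w * d"
  have C0: "0 \<le> C" using C1 C2 d by (simp add: C_def)
  define H where "H = max (2 * w * D) (Suc (nat \<lceil>C * (4 * real D) / d\<rceil>))"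
  obtain q u l t where q: "H \<le> q" "u + l \<le> D * q" "t \<le> D * q" "q \<le> D * l"
    "2 * w \<le> l \<longrightarrow> f (u + (l - w) + t) - f (u + w + t) = g (u + (l - w)) - g (u + w)"
    using win[of H] by blast
  have "2 * w * D \<le> H" by (simp add: H_def)
  then have "2 * w * D \<le> D * l" using q(1,4) by linarith
  then have "D * (2 * w) \<le> D * l" by (simp only: mult.commute)
  then have wl: "2 * w \<le> l" using D by (simp only: mult_le_cancel1)
  let ?a = "u + (l - w)" and ?b = "u + w"
  have ab: "real ?a - real ?b = real l - 2 * real w" using wl by (simp add: of_nat_diff)
  have eq: "f (?a + t) - f (?b + t) = g ?a - g ?b" using q(5) wl by (simp add: ac_simps)
  have le: "real ?a \<le> real D * real q" "real ?b \<le> real D * real q" "real t \<le> real D * real q"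
  proof -
    have "?a \<le> D * q" "?b \<le> D * q" using q(2) wl by auto
    then show "real ?a \<le> real D * real q" "real ?b \<le> real D * real q" "real t \<le> real D * real q"
      using q(3) by (simp_all only: of_nat_le_iff of_nat_mult[symmetric])
  qed
  have el: "e * real (?a + t) \<le> 2 * (e * (real D * real q))" "e * real (?b + t) \<le> 2 * (e * (real D * real q))"
    "e * real ?a \<le> e * (real D * real q)" "e * real ?b \<le> e * (real D * real q)"
  proof -
    have "real (?a + t) \<le> 2 * (real D * real q)" "real (?b + t) \<le> 2 * (real D * real q)"
      using le unfolding of_nat_add by linarith+
    then have "e * real (?a + t) \<le> e * (2 * (real D * real q))" "e * real (?b + t) \<le> e * (2 * (real D * real q))"
      using e by (simp_all only: mult_le_cancel_left_pos)
    then show "e * real (?a + t) \<le> 2 * (e * (real D * real q))" "e * real (?b + t) \<le> 2 * (e * (real D * real q))"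
      by simp_all
    show "e * real ?a \<le> e * (real D * real q)" "e * real ?b \<le> e * (real D * real q)"
      using e le by (simp_all only: mult_le_cancel_left_pos)
  qed
  have "(real ?a - real ?b) * A - (real ?a - real ?b) * B =
    (real (?a + t) * A - real (?b + t) * A) - (real ?a * B - real ?b * B)"
    by (simp add: algebra_simps)
  moreover have "\<bar>(real (?a + t) * A - real (?b + t) * A) - (real ?a * B - real ?b * B)\<bar>
      \<le> (C1 + e * real (?a + t)) + (C1 + e * real (?b + t)) + (C2 + e * real ?a) + (C2 + e * real ?b)"
    by (rule increment_error[OF C1(2) C1(2) C2(2) C2(2) eq])
  ultimately have "\<bar>(real ?a - real ?b) * (A - B)\<bar>
      \<le> (C1 + e * real (?a + t)) + (C1 + e * real (?b + t)) + (C2 + e * real ?a) + (C2 + e * real ?b)"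
    by (simp only: right_diff_distrib[of "real ?a - real ?b"])
  also have "\<dots> \<le> (C1 + 2 * (e * (real D * real q))) + (C1 + 2 * (e * (real D * real q)))
      + (C2 + e * (real D * real q)) + (C2 + e * (real D * real q))"
    by (intro add_mono order_refl el)
  also have "\<dots> = 2 * C1 + 2 * C2 + 6 * (e * (real D * real q))" by simp
  finally have "\<bar>(real ?a - real ?b) * (A - B)\<bar> \<le> 2 * C1 + 2 * C2 + 6 * (e * (real D * real q))" .
  then have "(real l - 2 * real w) * d \<le> 2 * C1 + 2 * C2 + 6 * (e * (real D * real q))"
    unfolding ab d_def using wl by (simp add: abs_mult)
  then have 1: "real l * d \<le> C + 6 * (e * (real D * real q))" by (simp add: C_def algebra_simps)
  have "real q \<le> real D * real l" using q(4) by (simp only: of_nat_le_iff of_nat_mult[symmetric])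
  then have "real q * d \<le> real D * (real l * d)" using d by (simp add: mult.assoc[symmetric])
  also have "\<dots> \<le> real D * (C + 6 * (e * (real D * real q)))" using 1 by (intro mult_left_mono) auto
  also have "\<dots> = real D * C + 6 / 16 * (real q * d)" using D by (simp add: e_def field_simps)
  finally have "real q * d \<le> real D * C + 6 / 16 * (real q * d)" .
  moreover have DC: "0 \<le> real D * C" using C0 D by simp
  ultimately have 2: "real q * d \<le> 2 * (real D * C)" by linarith
  have "C * (4 * real D) / d < real q" using q(1) unfolding H_def by linarith
  then have "4 * (real D * C) < real q * d" using d by (simp add: field_simps)
  with 2 DC show False by linarith
qed

context rank_one_system
begin

abbreviation "\<Omega> I \<equiv> PiE I (\<lambda>_::nat. X)"
abbreviation "MI I \<equiv> PiM I (\<lambda>_::nat. M)"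

lemma Omega_mem: "x \<in> \<Omega> I \<Longrightarrow> j \<in> I \<Longrightarrow> x j \<in> X"
  by (drule PiE_mem)

lemma space_MI: "space (MI I) = \<Omega> I" by (simp add: space_PiM)

text \<open>
  There are countably many of these sets, so almost every tuple is generic for all of them at once.
\<close>

definition cyl :: "nat set \<Rightarrow> (nat \<times> int) set \<Rightarrow> (nat \<Rightarrow> int \<Rightarrow> nat) set" where
  "cyl I F = {x \<in> \<Omega> I. \<forall>(j, i)\<in>F. x j i = 1}"

definition cyls :: "nat set \<Rightarrow> (nat \<times> int) set set" where
  "cyls I = {F. finite F \<and> F \<subseteq> I \<times> UNIV}"

lemma coordinate_I_measurable: "j \<in> I \<Longrightarrow> (\<lambda>x. x j i) \<in> borel_measurable (MI I)"
  using measurable_compose[OF measurable_component_singleton[of j I "\<lambda>_. M"] coordinate_measurable] .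

lemma cyl_sets: "F \<in> cyls I \<Longrightarrow> cyl I F \<in> sets (MI I)"
proof -
  assume F: "F \<in> cyls I"
  have "{x \<in> space (MI I). \<forall>z\<in>F. x (fst z) (snd z) = 1} \<in> sets (MI I)"
  proof (rule sets.sets_Collect_finite_All)
    show "finite F" using F by (simp add: cyls_def)
    fix z assume z: "z \<in> F"
    then have "fst z \<in> I" using F by (auto simp: cyls_def)
    from measurable_sets[OF coordinate_I_measurable[OF this, of "snd z"], of "{1}"]
    show "{x \<in> space (MI I). x (fst z) (snd z) = 1} \<in> sets (MI I)"
      by (simp add: vimage_def Int_def conj_commute)
  qed
  then show ?thesis by (simp add: cyl_def space_MI split_def)
qed

lemma cyl_generate:
  shows "Int_stable (cyl I ` cyls I)" "cyl I ` cyls I \<subseteq> Pow (\<Omega> I)"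
    "sets (MI I) = sigma_sets (\<Omega> I) (cyl I ` cyls I)" "\<Omega> I \<in> cyl I ` cyls I"
proof -
  let ?E = "cyl I ` cyls I"
  show "Int_stable ?E"
  proof (rule Int_stableI)
    fix A B assume "A \<in> ?E" "B \<in> ?E"
    then obtain F G where FG: "F \<in> cyls I" "G \<in> cyls I" "A = cyl I F" "B = cyl I G" by auto
    have "A \<inter> B = cyl I (F \<union> G)" unfolding FG cyl_def by blast
    moreover have "F \<union> G \<in> cyls I" using FG by (simp add: cyls_def)
    ultimately show "A \<inter> B \<in> ?E" by blast
  qed
  show sub: "?E \<subseteq> Pow (\<Omega> I)" by (auto simp: cyl_def)
  have "\<Omega> I = cyl I {}" by (simp add: cyl_def)
  moreover have "{} \<in> cyls I" by (simp add: cyls_def)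
  ultimately show "\<Omega> I \<in> ?E" by blast
  define A where "A = sigma (\<Omega> I) ?E"
  have spA: "space A = \<Omega> I" unfolding A_def using sub by (rule space_measure_of)
  have setsA: "sets A = sigma_sets (\<Omega> I) ?E" unfolding A_def using sub by (rule sets_measure_of)
  have "(\<lambda>x. \<lambda>j\<in>I. x j) \<in> measurable A (MI I)"
  proof (rule measurable_restrict)
    fix j assume j: "j \<in> I"
    show "(\<lambda>x. x j) \<in> measurable A M"
    proof (rule measurable_into_M)
      fix i
      show "(\<lambda>x. x j i) \<in> borel_measurable A"
      proof (rule measurable_binary_coordinate)
        have "{(j, i)} \<in> cyls I" using j by (simp add: cyls_def)
        then have "cyl I {(j, i)} \<in> sets A" unfolding setsA by (intro sigma_sets.Basic imageI)
        then show "{x \<in> space A. x j i = 1} \<in> sets A" unfolding spA by (simp add: cyl_def)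
        show "x j i \<in> {0, 1}" if "x \<in> space A" for x
          using X_binary[of "x j" i] Omega_mem[of x I j] that j unfolding spA by auto
      qed
    qed (use j spA Omega_mem in auto)
  qed
  then have id: "(\<lambda>x. x) \<in> measurable A (MI I)"
    by (rule measurable_cong[THEN iffD1, rotated]) (simp add: spA)
  have "B \<in> sets A" if B: "B \<in> sets (MI I)" for B
  proof -
    have "(\<lambda>x. x) -` B \<inter> space A = B" using sets.sets_into_space[OF B] spA space_MI by auto
    then show ?thesis using measurable_sets[OF id B] by simp
  qed
  moreover have "?E \<subseteq> sets (MI I)" using cyl_sets by blast
  then have "sigma_sets (\<Omega> I) ?E \<subseteq> sets (MI I)" using sets.sigma_sets_subset[of ?E "MI I"] by (simp add: space_MI)
  ultimately show "sets (MI I) = sigma_sets (\<Omega> I) ?E" unfolding setsA by blast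
qed

definition vshift :: "nat set \<Rightarrow> (nat \<Rightarrow> int) \<Rightarrow> (nat \<Rightarrow> int \<Rightarrow> nat) \<Rightarrow> nat \<Rightarrow> int \<Rightarrow> nat" where
  "vshift I a x = (\<lambda>i\<in>I. shift_power (a i) (x i))"

lemma vshift_measurable: "vshift I a \<in> measurable (MI I) (MI I)"
  unfolding vshift_def
proof (rule measurable_restrict)
  fix j assume "j \<in> I"
  then show "(\<lambda>x. shift_power (a j) (x j)) \<in> measurable (MI I) M"
    using measurable_compose[OF measurable_component_singleton[of j I "\<lambda>_. M"] shift_power_measurable] by simp
qed

lemma vshift_space: "x \<in> \<Omega> I \<Longrightarrow> vshift I a x \<in> \<Omega> I"
  unfolding vshift_def by (intro restrict_PiE_iff[THEN iffD2] ballI shift_power_X) (rule Omega_mem)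

lemma vshift_vshift: "vshift I a (vshift I b x) = vshift I (\<lambda>i. a i + b i) x"
  by (rule ext) (simp add: vshift_def shift_power_add)

lemma vshift_zero: "x \<in> \<Omega> I \<Longrightarrow> vshift I (\<lambda>_. 0) x = x"
  unfolding vshift_def by (rule ext) (auto simp: PiE_def extensional_def)

lemma shift_eq: "shift = shift_power 1"
  by (simp add: shift_def shift_power_def fun_eq_iff)

lemma product_shift_eq: "product_shift I = vshift I (\<lambda>_. 1)"
  by (rule ext) (simp add: product_shift_def vshift_def shift_eq)

lemma funpow_product_shift: "x \<in> \<Omega> I \<Longrightarrow> (product_shift I ^^ n) x = vshift I (\<lambda>_. int n) x"
  by (induction n) (simp_all add: vshift_zero product_shift_eq vshift_vshift)

end

locale joining = rank_one_system +
  fixes I :: "nat set" and N :: "(nat \<Rightarrow> int \<Rightarrow> nat) measure"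
  assumes fin: "finite I" and joining: "ergodic_self_joining M I N"
begin

lemma sets_N: "sets N = sets (MI I)" using joining by (simp add: ergodic_self_joining_def)

lemma space_N: "space N = \<Omega> I" using sets_eq_imp_space_eq[OF sets_N] by (simp add: space_MI)

lemma ergodic_N: "ergodic_system N (product_shift I)" using joining by (simp add: ergodic_self_joining_def)

sublocale N: prob_space N using ergodic_systemD(1)[OF ergodic_N] .

lemma marginal: "i \<in> I \<Longrightarrow> distr N M (\<lambda>x. x i) = M" using joining by (simp add: ergodic_self_joining_def)

lemma component_measurable: "i \<in> I \<Longrightarrow> (\<lambda>x. x i) \<in> measurable N M"
  using measurable_component_singleton[of i I "\<lambda>_. M"] measurable_cong_sets[OF sets_N refl] by blast

lemma vshift_measurable_N: "vshift I a \<in> measurable N N"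
  using vshift_measurable measurable_cong_sets[OF sets_N sets_N] by blast

definition preserves :: "(nat \<Rightarrow> int) \<Rightarrow> bool" where
  "preserves a \<longleftrightarrow> distr N N (vshift I a) = N"

lemma preserves_add:
  assumes "preserves a" "preserves b" shows "preserves (\<lambda>i. a i + b i)"
proof -
  have "distr N N (vshift I (\<lambda>i. a i + b i)) = distr N N (vshift I a \<circ> vshift I b)"
    by (simp add: o_def vshift_vshift)
  also have "\<dots> = distr (distr N N (vshift I b)) N (vshift I a)"
    by (rule distr_distr[OF vshift_measurable_N vshift_measurable_N, symmetric])
  finally show ?thesis using assms by (simp add: preserves_def)
qed

lemma preserves_diagonal: "preserves (\<lambda>_. k)"
proof -
  have pos: "preserves (\<lambda>_. int n)" for n
  proof -
    have "distr N N (vshift I (\<lambda>_. int n)) = distr N N (product_shift I ^^ n)"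
      by (rule distr_cong) (simp_all add: space_N funpow_product_shift)
    then show ?thesis unfolding preserves_def
      using distr_funpow[OF ergodic_systemD(2,3)[OF ergodic_N]] by simp
  qed
  show ?thesis
  proof (cases "0 \<le> k")
    case True
    then show ?thesis using pos[of "nat k"] by simp
  next
    case False
    have "distr N N (vshift I (\<lambda>_. k)) = distr (distr N N (vshift I (\<lambda>_. - k))) N (vshift I (\<lambda>_. k))"
      using pos[of "nat (- k)"] False by (simp add: preserves_def)
    also have "\<dots> = distr N N (vshift I (\<lambda>_. k) \<circ> vshift I (\<lambda>_. - k))"
      by (rule distr_distr[OF vshift_measurable_N vshift_measurable_N])
    also have "\<dots> = distr N N (\<lambda>x. x)"
      by (rule distr_cong) (simp_all add: vshift_vshift space_N vshift_zero)
    finally show ?thesis by (simp add: preserves_def)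
  qed
qed

lemma preservesD:
  assumes "preserves a" "A \<in> sets N"
  shows "measure N (vshift I a -` A \<inter> \<Omega> I) = measure N A"
  using measure_distr[OF vshift_measurable_N assms(2), of a] assms(1) by (simp add: preserves_def space_N)

lemma vshift_vimage_cyl:
  "vshift I b -` cyl I F \<inter> \<Omega> I = cyl I ((\<lambda>(j, i). (j, i + b j)) ` F)" if "F \<in> cyls I"
proof -
  have e: "(\<forall>z\<in>F. vshift I b x (fst z) (snd z) = 1) = (\<forall>z\<in>F. x (fst z) (snd z + b (fst z)) = 1)" for x
    by (intro ball_cong refl) (use that in \<open>auto simp: cyls_def vshift_def shift_power_apply\<close>)
  show ?thesis
  proof (rule set_eqI)
    fix x
    show "x \<in> vshift I b -` cyl I F \<inter> \<Omega> I \<longleftrightarrow> x \<in> cyl I ((\<lambda>(j, i). (j, i + b j)) ` F)"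
      using e[of x] vshift_space[of x I b] unfolding cyl_def split_def
      by (cases "x \<in> \<Omega> I") (simp_all del: PiE_iff)
  qed
qed

text \<open>
  For a generic tuple, the visits to a cylinder set during the stretch translated by \<open>t\<close> correspond to the
  visits to the cylinder set moved by \<open>b\<close> during the stretch itself, where \<open>b\<close> comes from \<open>common_recurrence\<close>. Both
  windows have a length comparable with their distance from the origin, so the two cylinder sets have the
  same measure.
\<close>

lemma joint_translation_invariance:
  assumes k: "k1 \<in> I" "k2 \<in> I" and na: "AE x in N. \<not> forward_asymptotic (x k1) (x k2)"
  shows "\<exists>b. b k1 \<noteq> b k2 \<and> preserves b"
proof -
  have cntF: "countable (cyls I)"
    by (rule countable_subset[OF _ countable_Collect_finite]) (auto simp: cyls_def)
  have "AE x in N. \<forall>F\<in>cyls I. (\<lambda>n. visit_frequency (product_shift I) (cyl I F) n x) \<longlonglongrightarrow> measure N (cyl I F)"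
    using cyl_sets sets_N by (subst AE_ball_countable[OF cntF]) (auto intro!: birkhoff_visit_frequency[OF ergodic_N])
  with na AE_space have "AE x in N. x \<in> space N \<and> \<not> forward_asymptotic (x k1) (x k2) \<and>
    (\<forall>F\<in>cyls I. (\<lambda>n. visit_frequency (product_shift I) (cyl I F) n x) \<longlonglongrightarrow> measure N (cyl I F))"
    by eventually_elim blast
  then have "\<exists>x. x \<in> space N \<and> \<not> forward_asymptotic (x k1) (x k2) \<and>
    (\<forall>F\<in>cyls I. (\<lambda>n. visit_frequency (product_shift I) (cyl I F) n x) \<longlonglongrightarrow> measure N (cyl I F))"
    by (rule eventually_happens'[OF N.ae_filter_bot])
  then obtain x where x: "x \<in> \<Omega> I" "\<not> forward_asymptotic (x k1) (x k2)"
    "\<And>F. F \<in> cyls I \<Longrightarrow> (\<lambda>n. visit_frequency (product_shift I) (cyl I F) n x) \<longlonglongrightarrow> measure N (cyl I F)"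
    unfolding space_N by blast
  have xX: "x j \<in> X" if "j \<in> I" for j using x(1) that by (rule PiE_mem)
  obtain b D where b: "b k1 \<noteq> b k2" "0 < D" "\<And>H. \<exists>q\<ge>H. \<exists>u l t::nat.
    u + l \<le> D * q \<and> t \<le> D * q \<and> q \<le> D * l \<and>
    (\<forall>j\<in>I. \<forall>i. int u \<le> i \<longrightarrow> i < int u + int l \<longrightarrow> x j (i + int t) = x j (i + b j))"
    using common_recurrence[OF fin xX k x(2)] by blast
  have visit: "(product_shift I ^^ n) x \<in> cyl I F \<longleftrightarrow> (\<forall>(j, i)\<in>F. x j (i + int n) = 1)" if "F \<in> cyls I" for F n
  proof -
    have "(\<forall>z\<in>F. vshift I (\<lambda>_. int n) x (fst z) (snd z) = 1) = (\<forall>z\<in>F. x (fst z) (snd z + int n) = 1)"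
      by (intro ball_cong refl) (use that in \<open>auto simp: cyls_def vshift_def shift_power_apply\<close>)
    then show ?thesis unfolding funpow_product_shift[OF x(1)] cyl_def split_def using vshift_space[OF x(1)] by simp
  qed
  have eq: "measure N (cyl I F) = measure N (cyl I ((\<lambda>(j, i). (j, i + b j)) ` F))" if F: "F \<in> cyls I" for F
  proof -
    let ?F' = "(\<lambda>(j, i). (j, i + b j)) ` F"
    have F': "?F' \<in> cyls I" using F by (auto simp: cyls_def)
    define f where "f n = (\<Sum>i<n. indicator (cyl I F) ((product_shift I ^^ i) x) :: real)" for n
    define g where "g n = (\<Sum>i<n. indicator (cyl I ?F') ((product_shift I ^^ i) x) :: real)" for n
    (* Deciding on a visit at time n needs the letters at distance at most w from n. *)
    define w where "w = Max (insert 0 ((\<lambda>z. nat \<bar>snd z\<bar>) ` F))"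
    have w: "\<bar>m\<bar> \<le> int w" if "(j, m) \<in> F" for j m
    proof -
      have "nat \<bar>m\<bar> \<le> w" unfolding w_def using F that
        by (intro Max_ge) (force simp: cyls_def)+
      then show ?thesis by simp
    qed
    have win: "f (u + (l - w) + t) - f (u + w + t) = g (u + (l - w)) - g (u + w)"
      if per: "\<forall>j\<in>I. \<forall>i. int u \<le> i \<longrightarrow> i < int u + int l \<longrightarrow> x j (i + int t) = x j (i + b j)"
        and l: "2 * w \<le> l" for u l t
    proof -
      have step: "(product_shift I ^^ (n + t)) x \<in> cyl I F \<longleftrightarrow> (product_shift I ^^ n) x \<in> cyl I ?F'"
        if n: "u + w \<le> n" "n < u + (l - w)" for n
      proof -
        have "x j (m + int (n + t)) = x j (m + b j + int n)" if jm: "(j, m) \<in> F" for j m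
        proof -
          have "j \<in> I" using jm F by (auto simp: cyls_def)
          moreover have "int u \<le> m + int n" "m + int n < int u + int l" using w[OF jm] n l by auto
          ultimately have "x j (m + int n + int t) = x j (m + int n + b j)" using per by blast
          then show ?thesis by (simp add: ac_simps)
        qed
        then show ?thesis unfolding visit[OF F] visit[OF F'] by (auto simp: split_def)
      qed
      have diff: "(\<Sum>i<q. c i) - (\<Sum>i<p. c i) = (\<Sum>i=p..<q. c i)" if "p \<le> q" for p q and c :: "nat \<Rightarrow> real"
        using sum.atLeastLessThan_concat[of 0 p q c] that by (simp add: atLeast0LessThan)
      have "f (u + (l - w) + t) - f (u + w + t) =
          (\<Sum>i=u + w + t..<u + (l - w) + t. indicator (cyl I F) ((product_shift I ^^ i) x))"
        unfolding f_def using l by (intro diff) simp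
      also have "\<dots> = (\<Sum>i=u + w..<u + (l - w). indicator (cyl I F) ((product_shift I ^^ (i + t)) x))"
        by (rule sum.shift_bounds_nat_ivl)
      also have "\<dots> = (\<Sum>i=u + w..<u + (l - w). indicator (cyl I ?F') ((product_shift I ^^ i) x))"
        by (intro sum.cong refl) (simp add: indicator_def step del: funpow.simps)
      also have "\<dots> = g (u + (l - w)) - g (u + w)"
        unfolding g_def using l by (intro diff[symmetric]) simp
      finally show ?thesis .
    qed
    show ?thesis
    proof (rule frequencies_agree_on_windows[OF _ _ b(2)])
      show "(\<lambda>n. f n / real n) \<longlonglongrightarrow> measure N (cyl I F)"
        using x(3)[OF F] by (simp only: f_def visit_frequency_def)
      show "(\<lambda>n. g n / real n) \<longlonglongrightarrow> measure N (cyl I ?F')"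
        using x(3)[OF F'] by (simp only: g_def visit_frequency_def)
      fix H
      obtain q u l t where q: "H \<le> q" "u + l \<le> D * q" "t \<le> D * q" "q \<le> D * l"
        "\<forall>j\<in>I. \<forall>i. int u \<le> i \<longrightarrow> i < int u + int l \<longrightarrow> x j (i + int t) = x j (i + b j)"
        using b(3)[of H] by blast
      show "\<exists>q\<ge>H. \<exists>u l t::nat. u + l \<le> D * q \<and> t \<le> D * q \<and> q \<le> D * l \<and>
        (2 * w \<le> l \<longrightarrow> f (u + (l - w) + t) - f (u + w + t) = g (u + (l - w)) - g (u + w))"
        by (rule exI[of _ q], rule conjI[OF q(1)], rule exI[of _ u], rule exI[of _ l], rule exI[of _ t])
          (use q(2-4) win[OF q(5)] in blast)
    qed
  qed
  have "distr N N (vshift I b) = N"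
  proof (rule measure_eqI_generator_eq[OF cyl_generate(1,2), where A="\<lambda>_. \<Omega> I"])
    show "sets (distr N N (vshift I b)) = sigma_sets (\<Omega> I) (cyl I ` cyls I)" "sets N = sigma_sets (\<Omega> I) (cyl I ` cyls I)"
      using cyl_generate(3)[of I] by (simp_all add: sets_N)
    show "range (\<lambda>_. \<Omega> I) \<subseteq> cyl I ` cyls I" using cyl_generate(4) by blast
    interpret P: prob_space "distr N N (vshift I b)" by (rule N.prob_space_distr[OF vshift_measurable_N])
    show "emeasure (distr N N (vshift I b)) (\<Omega> I) \<noteq> \<infinity>" by simp
    fix A assume "A \<in> cyl I ` cyls I"
    then obtain F where F: "F \<in> cyls I" "A = cyl I F" by blast
    have Am: "A \<in> sets N" using cyl_sets[OF F(1)] by (simp add: F(2) sets_N)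
    show "emeasure (distr N N (vshift I b)) A = emeasure N A"
      using eq[OF F(1)] Am vshift_vimage_cyl[OF F(1), of b]
      by (simp add: emeasure_distr[OF vshift_measurable_N] space_N F(2) N.emeasure_eq_measure)
  qed simp
  then show ?thesis using b(1) by (auto simp: preserves_def)
qed

end

section \<open>Joinings without translates\<close>

context joining
begin

definition eventually_equal :: "nat \<Rightarrow> nat \<Rightarrow> int \<Rightarrow> int \<Rightarrow> (nat \<Rightarrow> int \<Rightarrow> nat) set" where
  "eventually_equal j k d m = {x \<in> \<Omega> I. \<forall>i\<ge>m. x j i = x k (i + d)}"

lemma eventually_equal_sets:
  assumes "j \<in> I" "k \<in> I" shows "eventually_equal j k d m \<in> sets N"
proof -
  have "{x \<in> space (MI I). \<forall>i. m \<le> i \<longrightarrow> x j i = x k (i + d)} \<in> sets (MI I)"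
  proof (rule sets.sets_Collect_countable_All)
    fix i
    note [measurable] = coordinate_I_measurable[OF assms(1), of i] coordinate_I_measurable[OF assms(2), of "i + d"]
    have "{x \<in> space (MI I). x j i = x k (i + d)} \<in> sets (MI I)" by measurable
    then show "{x \<in> space (MI I). m \<le> i \<longrightarrow> x j i = x k (i + d)} \<in> sets (MI I)"
      by (cases "m \<le> i") simp_all
  qed
  then show ?thesis by (simp add: eventually_equal_def sets_N space_MI)
qed

text \<open>
  The sets \<open>eventually_equal j k d m\<close> increase with \<open>m\<close>, and the shift maps them to each other, so they all have the
  same measure. Their union over \<open>m\<close> is invariant. If it is not null, it has full measure, hence so has every one of
  the sets, and then their intersection.
\<close>

lemma forward_asymptotic_null_or_translate:
  assumes jk: "j \<in> I" "k \<in> I" and ne: "\<And>d. \<not> (AE x in N. x j = shift_power d (x k))"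
  shows "AE x in N. \<not> forward_asymptotic (x j) (x k)"
proof -
  let ?F = "eventually_equal j k"
  have null: "measure N (?F d m) = 0" for d m
  proof (rule ccontr)
    assume nz: "measure N (?F d m) \<noteq> 0"
    have Fm: "?F d m \<in> sets N" for m by (rule eventually_equal_sets[OF jk])
    define U where "U = (\<Union>n::nat. ?F d (int n))"
    have Um: "U \<in> sets N" unfolding U_def using Fm by blast
    have step: "product_shift I -` ?F d m \<inter> \<Omega> I = ?F d (m + 1)" for m
    proof (rule set_eqI)
      fix x :: "nat \<Rightarrow> int \<Rightarrow> nat"
      have "(\<forall>i\<ge>m. x j (i + 1) = x k (i + d + 1)) \<longleftrightarrow> (\<forall>i\<ge>m + 1. x j i = x k (i + d))" (is "?L \<longleftrightarrow> ?R")
      proof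
        assume L: ?L
        show ?R
        proof (intro allI impI)
          fix i assume "m + 1 \<le> i"
          then show "x j i = x k (i + d)" using L[rule_format, of "i - 1"] by simp
        qed
      next
        assume R: ?R
        show ?L
        proof (intro allI impI)
          fix i assume "m \<le> i"
          then show "x j (i + 1) = x k (i + d + 1)" using R[rule_format, of "i + 1"] by (simp add: add.commute add.left_commute)
        qed
      qed
      then show "x \<in> product_shift I -` ?F d m \<inter> \<Omega> I \<longleftrightarrow> x \<in> ?F d (m + 1)"
        using jk vshift_space[of x I "\<lambda>_. 1"]
        unfolding eventually_equal_def product_shift_eq
        by (cases "x \<in> \<Omega> I") (simp_all add: vshift_def shift_power_apply del: PiE_iff)
    qed
    have same: "measure N (?F d (m + int n)) = measure N (?F d m)" for m n
    proof (induction n)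
      case (Suc n)
      have "measure N (?F d (m + int n + 1)) = measure N (?F d (m + int n))"
        using measure_preserving_vimage[OF ergodic_systemD(2,3)[OF ergodic_N] Fm, of 1 "m + int n"]
        by (simp add: step space_N)
      moreover have "m + int (Suc n) = m + int n + 1" by simp
      ultimately show ?case using Suc by (simp only:)
    qed simp
    have mono: "?F d m \<subseteq> ?F d m'" if "m \<le> m'" for m m'
      unfolding eventually_equal_def using that by auto
    have allm: "measure N (?F d m') = measure N (?F d m)" for m'
    proof (cases "m \<le> m'")
      case True
      then show ?thesis using same[of m "nat (m' - m)"] by simp
    next
      case False
      then show ?thesis using same[of m' "nat (m - m')"] by simp
    qed
    have "product_shift I -` U \<inter> \<Omega> I = U"
    proof -
      have "product_shift I -` U \<inter> \<Omega> I = (\<Union>n::nat. ?F d (int n + 1))"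
        unfolding U_def using step by blast
      also have "\<dots> = U"
      proof
        have "?F d (int n + 1) = ?F d (int (Suc n))" for n by (simp add: add.commute)
        then show "(\<Union>n. ?F d (int n + 1)) \<subseteq> U" unfolding U_def by blast
        have "?F d (int n) \<subseteq> ?F d (int n + 1)" for n by (rule mono) simp
        then show "U \<subseteq> (\<Union>n. ?F d (int n + 1))" unfolding U_def by blast
      qed
      finally show ?thesis .
    qed
    then have "measure N U = 0 \<or> measure N U = 1"
      using ergodic_N Um by (simp add: ergodic_system_def space_N)
    moreover have "measure N (?F d m) \<le> measure N U"
    proof -
      have "measure N (?F d m) = measure N (?F d (int 0))" by (rule allm[symmetric])
      also have "\<dots> \<le> measure N U" 
      proof (rule N.finite_measure_mono[OF _ Um])
        show "?F d (int 0) \<subseteq> U" unfolding U_def by blast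
      qed
      finally show ?thesis .
    qed
    ultimately have U1: "measure N U = 1" using nz measure_nonneg[of N "?F d m"] by linarith
    have "(\<lambda>n. measure N (?F d (int n))) \<longlonglongrightarrow> measure N U"
      unfolding U_def
    proof (rule N.finite_Lim_measure_incseq)
      show "range (\<lambda>n. ?F d (int n)) \<subseteq> sets N" using Fm by blast
      show "incseq (\<lambda>n. ?F d (int n))" by (intro incseq_SucI mono) simp
    qed
    then have lim: "(\<lambda>n. measure N (?F d (int n))) \<longlonglongrightarrow> 1" by (simp only: U1)
    obtain c where c: "\<And>m'. measure N (?F d m') = c" using allm by blast
    have "(\<lambda>n::nat. c) \<longlonglongrightarrow> 1" using lim by (simp only: c)
    then have one: "measure N (?F d m') = 1" for m' by (simp add: c LIMSEQ_const_iff)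
    have "AE x in N. \<forall>n::nat. x \<in> ?F d (- int n)"
      unfolding AE_all_countable using one Fm N.prob_eq_1 by blast
    then have "AE x in N. x j = shift_power d (x k)"
    proof eventually_elim
      case (elim x)
      have "x j i = x k (i + d)" for i
      proof -
        have "x \<in> ?F d (- int (nat (- i)))" using elim by blast
        then show ?thesis unfolding eventually_equal_def by auto
      qed
      then show ?case by (simp add: fun_eq_iff shift_power_apply)
    qed
    with ne show False by blast
  qed
  have "AE x in N. \<forall>d m. x \<notin> ?F d m"
    unfolding AE_all_countable using null eventually_equal_sets[OF jk] N.prob_eq_0 by blast
  then show ?thesis using AE_space
  proof eventually_elim
    case (elim x)
    then show ?case unfolding forward_asymptotic_def eventually_equal_def space_N by blast
  qed
qed

lemma restrict_measurable: "J \<subseteq> I \<Longrightarrow> (\<lambda>x. restrict x J) \<in> measurable N (MI J)"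
  using measurable_restrict_subset[of J I "\<lambda>_. M"] measurable_cong_sets[OF sets_N refl] by blast

lemma restrict_space: "J \<subseteq> I \<Longrightarrow> x \<in> \<Omega> I \<Longrightarrow> restrict x J \<in> \<Omega> J"
  by (intro restrict_PiE_iff[THEN iffD2] ballI Omega_mem[of x I]) auto

lemma restrict_product_shift: "J \<subseteq> I \<Longrightarrow> restrict (product_shift I x) J = product_shift J (restrict x J)"
  by (rule ext) (auto simp: product_shift_def)

lemma joining_restrict:
  assumes J: "J \<subseteq> I"
  shows "joining r s R S M J (distr N (MI J) (\<lambda>x. restrict x J))"
proof -
  let ?NJ = "distr N (MI J) (\<lambda>x. restrict x J)"
  note m = restrict_measurable[OF J]
  interpret NJ: prob_space ?NJ by (rule N.prob_space_distr[OF m])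
  note T = ergodic_systemD(2,3)[OF ergodic_N]
  have TJ: "product_shift J \<in> measurable (MI J) (MI J)"
    unfolding product_shift_eq by (rule vshift_measurable)
  then have TJ': "product_shift J \<in> measurable ?NJ ?NJ" by simp
  have "distr ?NJ ?NJ (product_shift J) = distr N (MI J) (product_shift J \<circ> (\<lambda>x. restrict x J))"
    using distr_distr[OF TJ m] by (simp cong: distr_cong)
  also have "\<dots> = distr N (MI J) ((\<lambda>x. restrict x J) \<circ> product_shift I)"
    by (simp add: o_def restrict_product_shift[OF J])
  also have "\<dots> = distr (distr N N (product_shift I)) (MI J) (\<lambda>x. restrict x J)"
    by (rule distr_distr[OF m T(1), symmetric])
  finally have inv: "distr ?NJ ?NJ (product_shift J) = ?NJ" by (simp add: T(2))
  have "measure ?NJ E = 0 \<or> measure ?NJ E = 1" if E: "E \<in> sets ?NJ" "product_shift J -` E \<inter> space ?NJ = E" for E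
  proof -
    define E' where "E' = (\<lambda>x. restrict x J) -` E \<inter> space N"
    have E'm: "E' \<in> sets N" unfolding E'_def using measurable_sets[OF m] E(1) by simp
    have EJ: "x \<in> E \<longleftrightarrow> product_shift J x \<in> E" if "x \<in> \<Omega> J" for x
      using E(2) that by (auto simp: space_MI)
    have "product_shift I -` E' \<inter> space N = E'"
    proof (rule set_eqI)
      fix x
      show "x \<in> product_shift I -` E' \<inter> space N \<longleftrightarrow> x \<in> E'"
        using EJ[OF restrict_space[OF J], of x] measurable_space[OF T(1), of x]
        unfolding E'_def by (cases "x \<in> space N") (simp_all add: restrict_product_shift[OF J] space_N del: PiE_iff)
    qed
    then have "measure N E' = 0 \<or> measure N E' = 1" using ergodic_N E'm by (simp add: ergodic_system_def)
    moreover have "measure ?NJ E = measure N E'"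
      unfolding E'_def using E(1) by (intro measure_distr m) simp
    ultimately show ?thesis by simp
  qed
  then have "ergodic_system ?NJ (product_shift J)"
    unfolding ergodic_system_def invariant_measure_def using TJ' inv NJ.prob_space_axioms by blast
  moreover have "distr ?NJ M (\<lambda>x. x i) = M" if i: "i \<in> J" for i
  proof -
    have "distr ?NJ M (\<lambda>x. x i) = distr N M ((\<lambda>x. x i) \<circ> (\<lambda>x. restrict x J))"
      by (rule distr_distr[OF measurable_component_singleton[OF i, of "\<lambda>_. M"] m])
    then show ?thesis using marginal[of i] i J by (auto simp: o_def)
  qed
  ultimately have "ergodic_self_joining M J ?NJ" by (simp add: ergodic_self_joining_def)
  then show ?thesis
    by (intro joining.intro joining_axioms.intro rank_one_system_axioms finite_subset[OF J fin])
qed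

definition box :: "nat set \<Rightarrow> (nat \<Rightarrow> (int \<Rightarrow> nat) set) \<Rightarrow> (nat \<Rightarrow> int \<Rightarrow> nat) set" where
  "box J B = {x \<in> \<Omega> I. \<forall>j\<in>J. x j \<in> B j}"

lemma box_sets:
  assumes J: "J \<subseteq> I" and B: "\<And>j. j \<in> J \<Longrightarrow> B j \<in> sets M"
  shows "box J B \<in> sets N"
proof -
  have "{x \<in> space N. \<forall>j\<in>J. x j \<in> B j} \<in> sets N"
  proof (rule sets.sets_Collect_finite_All)
    show "finite J" by (rule finite_subset[OF J fin])
    fix j assume "j \<in> J"
    then show "{x \<in> space N. x j \<in> B j} \<in> sets N"
      using measurable_sets[OF component_measurable B, of j j] J by (auto simp: vimage_def Int_def conj_commute)
  qed
  then show ?thesis by (simp add: box_def space_N)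
qed

lemma measure_restrict_box:
  assumes J: "J \<subseteq> I" and A: "\<And>j. j \<in> J \<Longrightarrow> A j \<in> sets M"
  shows "measure (distr N (MI J) (\<lambda>x. restrict x J)) {x \<in> \<Omega> J. \<forall>i\<in>J. x i \<in> A i} = measure N (box J A)"
proof -
  have "{x \<in> space (MI J). \<forall>i\<in>J. x i \<in> A i} \<in> sets (MI J)"
  proof (rule sets.sets_Collect_finite_All)
    show "finite J" by (rule finite_subset[OF J fin])
    fix i assume i: "i \<in> J"
    show "{x \<in> space (MI J). x i \<in> A i} \<in> sets (MI J)"
      using measurable_sets[OF measurable_component_singleton[OF i, of "\<lambda>_. M"] A[OF i]]
      by (simp add: vimage_def Int_def conj_commute)
  qed
  then have "{x \<in> \<Omega> J. \<forall>i\<in>J. x i \<in> A i} \<in> sets (MI J)" by (simp add: space_MI)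
  then have "measure (distr N (MI J) (\<lambda>x. restrict x J)) {x \<in> \<Omega> J. \<forall>i\<in>J. x i \<in> A i} =
      measure N ((\<lambda>x. restrict x J) -` {x \<in> \<Omega> J. \<forall>i\<in>J. x i \<in> A i} \<inter> space N)"
    by (intro measure_distr restrict_measurable J)
  also have "(\<lambda>x. restrict x J) -` {x \<in> \<Omega> J. \<forall>i\<in>J. x i \<in> A i} \<inter> space N = box J A"
    using restrict_space[OF J] unfolding box_def space_N by (auto simp del: PiE_iff)
  finally show ?thesis .
qed

lemma preserves_multiple: "preserves a \<Longrightarrow> preserves (\<lambda>i. int n * a i)"
proof (induction n)
  case 0
  then show ?case using preserves_diagonal[of 0] by simp
next
  case (Suc n)
  then show ?case using preserves_add[of a "\<lambda>i. int n * a i"] by (simp add: algebra_simps)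
qed

text \<open>
  The events \<open>C n\<close> are the translates of a box in the coordinates \<open>K\<close>. Because \<open>a\<close> vanishes on \<open>J\<close>, translating does
  not change their joint probability with the box in the coordinates \<open>J\<close>. The correlations of the events are
  products of overlaps \<open>self_overlap (B j) (int i * a j)\<close>, whose averages are given by weak mixing since \<open>a j \<noteq> 0\<close>.
\<close>

lemma joining_splits_at_fixed_coordinates:
  assumes a: "preserves a" and J: "J = {j \<in> I. a j = 0}" and K: "K = {j \<in> I. a j \<noteq> 0}"
    and B: "\<And>j. j \<in> I \<Longrightarrow> B j \<in> sets M"
    and prod: "\<And>A. (\<And>j. j \<in> K \<Longrightarrow> A j \<in> sets M) \<Longrightarrow> measure N (box K A) = (\<Prod>j\<in>K. measure M (A j))"
  shows "measure N (box I B) = measure N (box J B) * (\<Prod>j\<in>K. measure M (B j))"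
proof -
  have sub: "J \<subseteq> I" "K \<subseteq> I" "J \<union> K = I" "finite K" using fin by (auto simp: J K)
  define C where "C n = box K (\<lambda>j. preshift (int n * a j) (B j))" for n :: nat
  define \<phi> where "\<phi> i = (\<Prod>j\<in>K. self_overlap (B j) (int i * a j))" for i :: nat
  define q where "q = (\<Prod>j\<in>K. measure M (B j))"
  have BK: "B j \<in> sets M" if "j \<in> K" for j using B sub(2) that by blast
  have Cm: "C n \<in> sets N" for n unfolding C_def by (intro box_sets sub vimage_shift_sets BK)
  have C0: "C 0 = box K B"
    using sub(2) Omega_mem[of _ I] unfolding C_def box_def by auto
  have Gm: "box J B \<in> sets N" using sub B by (intro box_sets) auto
  have "measure N (box J B \<inter> C 0) = measure N (box J B) * q"
  proof (rule N.independent_of_averaged_events[OF Gm Cm])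
    fix n
    have "vshift I (\<lambda>i. int n * a i) -` (box J B \<inter> C 0) \<inter> \<Omega> I = box J B \<inter> C n"
    proof (rule set_eqI)
      fix x
      show "x \<in> vshift I (\<lambda>i. int n * a i) -` (box J B \<inter> C 0) \<inter> \<Omega> I \<longleftrightarrow> x \<in> box J B \<inter> C n"
      proof (cases "x \<in> \<Omega> I")
        case True
        have 1: "(\<forall>j\<in>J. vshift I (\<lambda>i. int n * a i) x j \<in> B j) = (\<forall>j\<in>J. x j \<in> B j)"
          by (intro ball_cong refl) (simp add: J vshift_def)
        have 2: "(\<forall>j\<in>K. vshift I (\<lambda>i. int n * a i) x j \<in> B j) = (\<forall>j\<in>K. shift_power (int n * a j) (x j) \<in> B j \<and> x j \<in> X)"
          using Omega_mem[OF True] by (intro ball_cong refl) (simp add: K vshift_def)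
        show ?thesis
          unfolding C0 unfolding C_def box_def using 1 2 vshift_space[OF True] True by (simp del: PiE_iff)
      qed (simp add: box_def del: PiE_iff)
    qed
    then show "measure N (box J B \<inter> C n) = measure N (box J B \<inter> C 0)"
      using preservesD[OF preserves_multiple[OF a], of "box J B \<inter> C 0" n] Gm Cm by simp
  next
    fix n
    have "measure N (C n) = (\<Prod>j\<in>K. measure M (preshift (int n * a j) (B j)))"
      unfolding C_def by (intro prod vimage_shift_sets BK)
    also have "\<dots> = q" unfolding q_def by (intro prod.cong refl measure_shift_power BK)
    finally show "measure N (C n) = q" .
  next
    fix k l :: nat assume kl: "k \<le> l"
    have "C k \<inter> C l = box K (\<lambda>j. (preshift (int k * a j) (B j)) \<inter> preshift (int l * a j) (B j))"
      unfolding C_def box_def by blast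
    then have "measure N (C k \<inter> C l) = (\<Prod>j\<in>K. measure M ((preshift (int k * a j) (B j)) \<inter> preshift (int l * a j) (B j)))"
      by (simp only:) (intro prod sets.Int vimage_shift_sets BK)
    also have "\<dots> = \<phi> (l - k)"
      unfolding \<phi>_def
    proof (intro prod.cong refl)
      fix j assume "j \<in> K"
      have "int l * a j - int k * a j = int (l - k) * a j" using kl by (simp add: of_nat_diff left_diff_distrib)
      then show "measure M ((preshift (int k * a j) (B j)) \<inter> preshift (int l * a j) (B j)) = self_overlap (B j) (int (l - k) * a j)"
        using measure_overlap_shift[OF BK[OF \<open>j \<in> K\<close>]] by simp
    qed
    finally show "measure N (C k \<inter> C l) = \<phi> (l - k)" .
  next
    define c where "c j i = \<bar>self_overlap (B j) (int i) - (measure M (B j))\<^sup>2\<bar>" for j and i :: nat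
    have le: "\<bar>\<phi> i - q\<^sup>2\<bar> \<le> (\<Sum>j\<in>K. c j (i * nat \<bar>a j\<bar>))" for i
    proof -
      have "norm ((\<Prod>j\<in>K. self_overlap (B j) (int i * a j)) - (\<Prod>j\<in>K. (measure M (B j))\<^sup>2))
        \<le> (\<Sum>j\<in>K. norm (self_overlap (B j) (int i * a j) - (measure M (B j))\<^sup>2))"
      proof (rule norm_prod_diff)
        fix j assume "j \<in> K"
        show "norm (self_overlap (B j) (int i * a j)) \<le> 1"
          unfolding self_overlap_def by simp
        show "norm ((measure M (B j))\<^sup>2) \<le> 1" by (simp add: power_le_one)
      qed
      moreover have "norm (self_overlap (B j) (int i * a j) - (measure M (B j))\<^sup>2) = c j (i * nat \<bar>a j\<bar>)" if "j \<in> K" for j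
      proof -
        have "int (i * nat \<bar>a j\<bar>) = \<bar>int i * a j\<bar>" by (simp add: abs_mult)
        then show ?thesis unfolding c_def using self_overlap_abs[OF BK[OF that], of "int i * a j"] by simp
      qed
      ultimately show ?thesis by (simp add: \<phi>_def q_def prod_power_distrib)
    qed
    have lim: "(\<lambda>n. (\<Sum>i<n. c j (i * nat \<bar>a j\<bar>)) / real n) \<longlonglongrightarrow> 0" if j: "j \<in> K" for j
    proof (rule cesaro_dilate)
      show "(\<lambda>n. (\<Sum>i<n. c j i) / real n) \<longlonglongrightarrow> 0" unfolding c_def by (rule weakly_mixing[OF BK[OF j]])
      have "a j \<noteq> 0" using j by (simp add: K)
      then show "1 \<le> nat \<bar>a j\<bar>" by linarith
    qed (simp add: c_def)
    have "(\<lambda>n. \<Sum>j\<in>K. (\<Sum>i<n. c j (i * nat \<bar>a j\<bar>)) / real n) \<longlonglongrightarrow> (\<Sum>j\<in>K. 0)"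
      by (intro tendsto_sum lim)
    then have lim': "(\<lambda>n. \<Sum>j\<in>K. (\<Sum>i<n. c j (i * nat \<bar>a j\<bar>)) / real n) \<longlonglongrightarrow> 0" by simp
    show "(\<lambda>n. (\<Sum>i<n. \<bar>\<phi> i - q\<^sup>2\<bar>) / real n) \<longlonglongrightarrow> 0"
    proof (rule Lim_null_comparison[OF always_eventually lim'], intro allI)
      fix n
      have "(\<Sum>i<n. \<bar>\<phi> i - q\<^sup>2\<bar>) \<le> (\<Sum>i<n. \<Sum>j\<in>K. c j (i * nat \<bar>a j\<bar>))" by (intro sum_mono le)
      also have "\<dots> = (\<Sum>j\<in>K. \<Sum>i<n. c j (i * nat \<bar>a j\<bar>))" by (rule sum.swap)
      finally have "(\<Sum>i<n. \<bar>\<phi> i - q\<^sup>2\<bar>) / real n \<le> (\<Sum>j\<in>K. (\<Sum>i<n. c j (i * nat \<bar>a j\<bar>))) / real n"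
        by (intro divide_right_mono) auto
      then show "norm ((\<Sum>i<n. \<bar>\<phi> i - q\<^sup>2\<bar>) / real n) \<le> (\<Sum>j\<in>K. (\<Sum>i<n. c j (i * nat \<bar>a j\<bar>)) / real n)"
        by (simp add: sum_nonneg sum_divide_distrib)
    qed
  qed
  moreover have "box J B \<inter> C 0 = box I B" unfolding C0 box_def using sub(3) by blast
  ultimately show ?thesis by (simp add: q_def)
qed

end

context rank_one_system
begin

text \<open>
  Two coordinates \<open>k1\<close> and \<open>k2\<close> that are not translates of each other provide a translation vector \<open>a\<close> that
  preserves the joining and has \<open>a k1 = 0\<close> but \<open>a k2 \<noteq> 0\<close>. So its zeros and the other coordinates are two proper
  subsets, to which the induction hypothesis applies.
\<close>

theorem unrelated_joining_is_product:
  assumes "joining r s R S M I N"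
    and "\<And>j k d. j \<in> I \<Longrightarrow> k \<in> I \<Longrightarrow> j \<noteq> k \<Longrightarrow> \<not> (AE x in N. x j = shift_power d (x k))"
    and "\<And>i. i \<in> I \<Longrightarrow> B i \<in> sets M"
  shows "measure N {x \<in> \<Omega> I. \<forall>i\<in>I. x i \<in> B i} = (\<Prod>i\<in>I. measure M (B i))"
  using assms
proof (induction "card I" arbitrary: I N B rule: less_induct)
  case less
  interpret joining r s R S M I N by (rule less.prems(1))
  have sub_prod: "measure N (box J A) = (\<Prod>j\<in>J. measure M (A j))"
    if J: "J \<subset> I" and A: "\<And>j. j \<in> J \<Longrightarrow> A j \<in> sets M" for J A
  proof -
    have JI: "J \<subseteq> I" using J by blast
    let ?NJ = "distr N (MI J) (\<lambda>x. restrict x J)"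
    have "measure ?NJ {x \<in> \<Omega> J. \<forall>i\<in>J. x i \<in> A i} = (\<Prod>i\<in>J. measure M (A i))"
    proof (rule less.hyps[OF psubset_card_mono[OF fin J] joining_restrict[OF JI] _ A])
      fix j k d assume jk: "j \<in> J" "k \<in> J" "j \<noteq> k"
      show "\<not> (AE x in ?NJ. x j = shift_power d (x k))"
      proof
        assume "AE x in ?NJ. x j = shift_power d (x k)"
        from AE_distrD[OF restrict_measurable[OF JI] this]
        have "AE x in N. x j = shift_power d (x k)" using jk by simp
        then show False using less.prems(2)[of j k d] jk JI by blast
      qed
    qed
    then show ?thesis using measure_restrict_box[OF JI A] by simp
  qed
  have boxI: "{x \<in> \<Omega> I. \<forall>i\<in>I. x i \<in> B i} = box I B" by (simp add: box_def)
  consider "I = {}" | i where "I = {i}" | k1 k2 where "k1 \<in> I" "k2 \<in> I" "k1 \<noteq> k2" by blast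
  then show ?case
  proof cases
    case 1
    then show ?thesis using N.prob_space by (simp add: space_N)
  next
    case (2 i)
    have "box I B = (\<lambda>x. x i) -` B i \<inter> space N" unfolding box_def space_N using 2 by auto
    then have "measure N (box I B) = measure (distr N M (\<lambda>x. x i)) (B i)"
      using less.prems(3)[of i] 2 by (simp add: measure_distr component_measurable)
    then show ?thesis unfolding boxI using marginal[of i] 2 by simp
  next
    case (3 k1 k2)
    have "AE x in N. \<not> forward_asymptotic (x k1) (x k2)"
      by (rule forward_asymptotic_null_or_translate[OF 3(1,2)]) (rule less.prems(2)[OF 3])
    from joint_translation_invariance[OF 3(1,2) this] obtain b where b: "b k1 \<noteq> b k2" "preserves b" by blast
    define a where "a j = b j + (- b k1)" for j
    have pa: "preserves a" unfolding a_def by (rule preserves_add[OF b(2) preserves_diagonal])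
    define J where "J = {j \<in> I. a j = 0}"
    define K where "K = {j \<in> I. a j \<noteq> 0}"
    have JK: "J \<subset> I" "K \<subset> I" 
    proof -
      have "J \<subseteq> I" "K \<subseteq> I" "k2 \<notin> J" "k1 \<notin> K" using b(1) by (auto simp: J_def K_def a_def)
      then show "J \<subset> I" "K \<subset> I" using 3 by blast+
    qed
    have "measure N (box I B) = measure N (box J B) * (\<Prod>j\<in>K. measure M (B j))"
      by (rule joining_splits_at_fixed_coordinates[OF pa J_def K_def less.prems(3) sub_prod[OF JK(2)]])
    also have "measure N (box J B) = (\<Prod>j\<in>J. measure M (B j))"
      using JK less.prems(3) by (intro sub_prod) auto
    also have "(\<Prod>j\<in>J. measure M (B j)) * (\<Prod>j\<in>K. measure M (B j)) = (\<Prod>j\<in>J \<union> K. measure M (B j))"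
      using fin by (intro prod.union_disjoint[symmetric]) (auto simp: J_def K_def)
    also have "J \<union> K = I" by (auto simp: J_def K_def)
    finally show ?thesis unfolding boxI .
  qed
qed

end

section \<open>Minimal self-joinings\<close>

context joining
begin

text \<open>
  Coordinates are equivalent if almost surely one is a translate of the other. With one representative \<open>rp C\<close> for
  each class \<open>C\<close>, every coordinate \<open>i\<close> is the translate by \<open>\<kappa> i\<close> of the representative of its class, and the
  representatives are independent. The two measures are compared on boxes.
\<close>

theorem product_of_off_diagonals:
  "\<exists>P D. partition_on I P \<and> (\<forall>C\<in>P. off_diagonal M C (D C)) \<and> N = class_product M I P D"
proof -
  define rel where "rel = {(j, k). j \<in> I \<and> k \<in> I \<and> (\<exists>d. AE x in N. x j = shift_power d (x k))}"
  have eqv: "equiv I rel"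
  proof (rule equivI)
    show "rel \<subseteq> I \<times> I" by (auto simp: rel_def)
    show "refl_on I rel"
    proof (rule refl_onI)
      fix j assume "j \<in> I"
      moreover have "AE x in N. x j = shift_power 0 (x j)" by simp
      ultimately show "(j, j) \<in> rel" unfolding rel_def by blast
    qed
    show "sym rel"
    proof (rule symI)
      fix j k assume "(j, k) \<in> rel"
      then obtain d where jk: "j \<in> I" "k \<in> I" and d: "AE x in N. x j = shift_power d (x k)" unfolding rel_def by blast
      from d have "AE x in N. x k = shift_power (- d) (x j)" by eventually_elim (simp add: shift_power_add)
      then show "(k, j) \<in> rel" using jk unfolding rel_def by blast
    qed
    show "trans rel"
    proof (rule transI)
      fix j k l assume "(j, k) \<in> rel" "(k, l) \<in> rel"
      then obtain d e where jl: "j \<in> I" "l \<in> I" and d: "AE x in N. x j = shift_power d (x k)" "AE x in N. x k = shift_power e (x l)"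
        unfolding rel_def by blast
      from d have "AE x in N. x j = shift_power (d + e) (x l)" by eventually_elim (simp add: shift_power_add)
      then show "(j, l) \<in> rel" using jl unfolding rel_def by blast
    qed
  qed
  define P where "P = I // rel"
  have part: "partition_on I P" unfolding P_def by (rule partition_on_quotient[OF eqv])
  have finP: "finite P" unfolding P_def using fin by (rule finite_quotient) (auto simp: rel_def)
  define cls where "cls i = rel `` {i}" for i
  have cls: "cls i \<in> P" "i \<in> cls i" if "i \<in> I" for i
    unfolding cls_def P_def by (rule quotientI[OF that], rule equiv_class_self[OF eqv that])
  have CI: "C \<subseteq> I" if "C \<in> P" for C using partition_onD1[OF part] that by blast
  have cls_eq: "C = cls i" if C: "C \<in> P" and i: "i \<in> C" for C i
  proof (rule ccontr)
    assume "C \<noteq> cls i"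
    have "i \<in> I" using CI[OF C] i by blast
    then have "C \<inter> cls i = {}"
      using disjointD[OF partition_onD2[OF part] C cls(1) \<open>C \<noteq> cls i\<close>] by blast
    then show False using i cls(2)[OF \<open>i \<in> I\<close>] by blast
  qed
  define rp where "rp C = (SOME i. i \<in> C)" for C :: "nat set"
  have rp: "rp C \<in> C" if "C \<in> P" for C
  proof -
    have "C \<noteq> {}" using that partition_onD3[OF part] by blast
    then show ?thesis unfolding rp_def by (simp add: some_in_eq)
  qed
  have cls_rp: "cls (rp C) = C" if "C \<in> P" for C using cls_eq[OF that rp[OF that]] by simp
  define \<kappa> where "\<kappa> i = (SOME d. AE x in N. x i = shift_power d (x (rp (cls i))))" for i
  have \<kappa>: "AE x in N. x i = shift_power (\<kappa> i) (x (rp (cls i)))" if i: "i \<in> I" for i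
  proof -
    have "(i, rp (cls i)) \<in> rel" using rp[OF cls(1)[OF i]] unfolding cls_def by blast
    then have "\<exists>d. AE x in N. x i = shift_power d (x (rp (cls i)))" unfolding rel_def by blast
    then show ?thesis unfolding \<kappa>_def by (rule someI_ex)
  qed
  define emb where "emb C x = (\<lambda>i\<in>C. shift_power (\<kappa> i) x)" for C :: "nat set" and x
  have emb_m: "emb C \<in> measurable M (MI C)" for C
    unfolding emb_def by (intro measurable_restrict shift_power_measurable)
  define D where "D C = distr M (MI C) (emb C)" for C
  have D_prob: "prob_space (D C)" for C unfolding D_def by (rule prob_space_distr[OF emb_m])
  have D_off: "off_diagonal M C (D C)" for C unfolding off_diagonal_def D_def emb_def by blast
  have sets_D: "sets (D C) = sets (MI C)" "space (D C) = \<Omega> C" for C by (simp_all add: D_def space_MI)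
  have the_cls: "(THE C. C \<in> P \<and> i \<in> C) = cls i" if "i \<in> I" for i
    by (rule the_equality) (use cls[OF that] cls_eq in blast)+
  let ?f = "\<lambda>w. \<lambda>i\<in>I. w (THE C. C \<in> P \<and> i \<in> C) i"
  have f_m: "?f \<in> measurable (PiM P D) (MI I)"
  proof (rule measurable_restrict)
    fix i assume i: "i \<in> I"
    have "(\<lambda>y. y i) \<in> measurable (D (cls i)) M"
      using measurable_component_singleton[OF cls(2)[OF i], of "\<lambda>_. M"] measurable_cong_sets[OF sets_D(1)[of "cls i"] refl, of M] by blast
    then show "(\<lambda>w. w (THE C. C \<in> P \<and> i \<in> C) i) \<in> measurable (PiM P D) M"
      unfolding the_cls[OF i] by (rule measurable_compose[OF measurable_component_singleton[OF cls(1)[OF i]]])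
  qed
  have "N = class_product M I P D"
  proof (rule measure_eqI_PiM_finite[OF fin sets_N, where A="\<lambda>_. \<Omega> I"])
    show "sets (class_product M I P D) = sets (MI I)" by (simp add: class_product_def)
    show "range (\<lambda>_::nat. \<Omega> I) \<subseteq> prod_algebra I (\<lambda>_. M)"
      using prod_algebraI_finite[OF fin, of "\<lambda>_. X" "\<lambda>_. M"] sets.top[of M] by auto
    show "(\<Union>i::nat. \<Omega> I) = space (MI I)" by (simp add: space_MI)
    show "\<And>i::nat. emeasure N (\<Omega> I) \<noteq> \<infinity>" by simp
    fix A assume A: "\<And>i. i \<in> I \<Longrightarrow> A i \<in> sets M"
    have AX: "A i \<subseteq> X" if "i \<in> I" for i using sets.sets_into_space[OF A[OF that]] by simp
    (* The event that the coordinates in C lie in the box, in terms of the representative of C. *)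
    define W where "W C = emb C -` (PiE C A) \<inter> X" for C
    have W_iff: "x \<in> W C \<longleftrightarrow> x \<in> X \<and> (\<forall>i\<in>C. shift_power (\<kappa> i) x \<in> A i)" for C x
      unfolding W_def emb_def by (auto simp: restrict_PiE_iff simp del: PiE_iff)
    have PiC: "PiE C A \<in> sets (MI C)" if "C \<in> P" for C
      using A CI[OF that] finite_subset[OF CI[OF that] fin] by (intro sets_PiM_I_finite) auto
    have Wm: "W C \<in> sets M" if "C \<in> P" for C
      unfolding W_def using measurable_sets[OF emb_m PiC[OF that]] by simp
    have DW: "emeasure (D C) (PiE C A) = emeasure M (W C)" if "C \<in> P" for C
      unfolding D_def W_def using emeasure_distr[OF emb_m PiC[OF that]] by simp
    define J where "J = rp ` P"
    have JI: "J \<subseteq> I" unfolding J_def using rp CI by blast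
    have inj: "inj_on rp P" by (rule inj_on_inverseI[where g=cls]) (rule cls_rp)
    have WJ: "W (cls j) \<in> sets M" if "j \<in> J" for j using that Wm cls_rp unfolding J_def by auto
    let ?NJ = "distr N (MI J) (\<lambda>x. restrict x J)"
    have "measure ?NJ {x \<in> \<Omega> J. \<forall>j\<in>J. x j \<in> W (cls j)} = (\<Prod>j\<in>J. measure M (W (cls j)))"
    proof (rule unrelated_joining_is_product[OF joining_restrict[OF JI] _ WJ])
      fix j k d assume jk: "j \<in> J" "k \<in> J" "j \<noteq> k"
      show "\<not> (AE x in ?NJ. x j = shift_power d (x k))"
      proof
        assume "AE x in ?NJ. x j = shift_power d (x k)"
        from AE_distrD[OF restrict_measurable[OF JI] this]
        have "AE x in N. x j = shift_power d (x k)" using jk by simp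
        then have "(j, k) \<in> rel" using jk JI unfolding rel_def by blast
        then have "cls j = cls k" unfolding cls_def using equiv_class_eq[OF eqv] by blast
        then show False using jk cls_rp unfolding J_def by auto
      qed
    qed
    moreover have "measure ?NJ {x \<in> \<Omega> J. \<forall>j\<in>J. x j \<in> W (cls j)} = measure N (box J (\<lambda>j. W (cls j)))"
      by (rule measure_restrict_box[OF JI WJ])
    moreover have "(\<Prod>j\<in>J. measure M (W (cls j))) = (\<Prod>C\<in>P. measure M (W C))"
      unfolding J_def prod.reindex[OF inj] by (intro prod.cong refl) (simp add: cls_rp)
    ultimately have NJ: "measure N (box J (\<lambda>j. W (cls j))) = (\<Prod>C\<in>P. measure M (W C))" by (simp only:)
    have PiI: "PiE I A \<in> sets N" unfolding sets_N using A fin by (intro sets_PiM_I_finite) auto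
    have "AE x in N. \<forall>i\<in>I. x i = shift_power (\<kappa> i) (x (rp (cls i)))"
      using \<kappa> by (subst AE_ball_countable[OF countable_finite[OF fin]]) blast
    then have "AE x in N. x \<in> PiE I A \<longleftrightarrow> x \<in> box J (\<lambda>j. W (cls j))"
      using AE_space
    proof eventually_elim
      case (elim x)
      have xO: "x \<in> \<Omega> I" using elim(2) by (simp add: space_N del: PiE_iff)
      have "x \<in> PiE I A \<longleftrightarrow> (\<forall>i\<in>I. x i \<in> A i)" using xO by (auto simp: PiE_def)
      also have "\<dots> \<longleftrightarrow> (\<forall>i\<in>I. shift_power (\<kappa> i) (x (rp (cls i))) \<in> A i)"
        using elim(1) by auto
      also have "\<dots> \<longleftrightarrow> (\<forall>C\<in>P. \<forall>i\<in>C. shift_power (\<kappa> i) (x (rp C)) \<in> A i)"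
        using cls cls_eq CI by (metis subsetD)
      also have "\<dots> \<longleftrightarrow> (\<forall>C\<in>P. x (rp C) \<in> W C)"
        unfolding W_iff using Omega_mem[OF xO] rp CI by blast
      also have "\<dots> \<longleftrightarrow> x \<in> box J (\<lambda>j. W (cls j))"
        unfolding box_def J_def using xO cls_rp by (auto simp del: PiE_iff)
      finally show ?case .
    qed
    then have "measure N (PiE I A) = measure N (box J (\<lambda>j. W (cls j)))"
      by (rule N.finite_measure_eq_AE) (use PiI box_sets[OF JI WJ] in auto)
    then have "emeasure N (PiE I A) = (\<Prod>C\<in>P. emeasure M (W C))"
      by (simp add: N.emeasure_eq_measure emeasure_eq_measure NJ prod_ennreal)
    also have "\<dots> = (\<Prod>C\<in>P. emeasure (D C) (PiE C A))" by (intro prod.cong refl DW[symmetric])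
    also have "\<dots> = emeasure (PiM P D) (PiE P (\<lambda>C. PiE C A))"
    proof -
      have "emeasure (PiM P D) (prod_emb P D P (PiE P (\<lambda>C. PiE C A))) = (\<Prod>C\<in>P. emeasure (D C) (PiE C A))"
        by (rule emeasure_PiM_emb) (use D_prob finP PiC sets_D in auto)
      moreover have "prod_emb P D P (PiE P (\<lambda>C. PiE C A)) = PiE P (\<lambda>C. PiE C A)"
      proof (rule prod_emb_PiE_same_index)
        fix C assume "C \<in> P"
        then show "PiE C A \<subseteq> space (D C)" unfolding sets_D using AX CI by (intro PiE_mono) blast
      qed
      ultimately show ?thesis by simp
    qed
    also have "PiE P (\<lambda>C. PiE C A) = ?f -` PiE I A \<inter> space (PiM P D)"
    proof (rule set_eqI)
      fix w
      show "w \<in> PiE P (\<lambda>C. PiE C A) \<longleftrightarrow> w \<in> ?f -` PiE I A \<inter> space (PiM P D)"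
      proof (cases "w \<in> space (PiM P D)")
        case True
        then have w: "w \<in> extensional P" "\<And>C. C \<in> P \<Longrightarrow> w C \<in> \<Omega> C"
          by (auto simp: space_PiM sets_D PiE_def)
        have "w \<in> PiE P (\<lambda>C. PiE C A) \<longleftrightarrow> (\<forall>C\<in>P. w C \<in> PiE C A)" using w(1) by (auto simp: PiE_def)
        also have "\<dots> \<longleftrightarrow> (\<forall>C\<in>P. \<forall>i\<in>C. w C i \<in> A i)" using w(2) by (auto simp: PiE_def)
        also have "\<dots> \<longleftrightarrow> (\<forall>i\<in>I. w (cls i) i \<in> A i)" using cls cls_eq CI by (metis subsetD)
        also have "\<dots> \<longleftrightarrow> (\<forall>i\<in>I. w (THE C. C \<in> P \<and> i \<in> C) i \<in> A i)" by (intro ball_cong refl) (simp add: the_cls)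
        also have "\<dots> \<longleftrightarrow> ?f w \<in> PiE I A" by (rule restrict_PiE_iff[symmetric])
        finally show ?thesis using True by simp
      next
        case False
        have "w \<notin> PiE P (\<lambda>C. PiE C A)"
        proof
          assume w: "w \<in> PiE P (\<lambda>C. PiE C A)"
          have "PiE P (\<lambda>C. PiE C A) \<subseteq> PiE P (\<lambda>C. \<Omega> C)" using AX CI by (intro PiE_mono) blast
          then show False using w False by (simp add: space_PiM sets_D subset_iff del: PiE_iff)
        qed
        then show ?thesis using False by simp
      qed
    qed
    also have "emeasure (PiM P D) (?f -` PiE I A \<inter> space (PiM P D)) = emeasure (class_product M I P D) (PiE I A)"
      unfolding class_product_def using PiI sets_N by (intro emeasure_distr[symmetric] f_m) simp
    finally show "emeasure N (PiE I A) = emeasure (class_product M I P D) (PiE I A)" .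
  qed
  then show ?thesis using part D_off by blast
qed

end

theorem theorem4p1:
  fixes r :: "nat \<Rightarrow> nat"
    and s :: "nat \<Rightarrow> nat list"
    and M :: "(int \<Rightarrow> nat) measure"
  assumes "cutting_parameter r" and "spacer_parameter r s"
    and "summable (\<lambda>n. (real (height s (Suc n)) - real (height s n) * real (r n))
                       / real (height s (Suc n)))"
    and "\<not> degenerate (rank_one_word s)"
    and "unique_invariant_prob_on (word_subshift (rank_one_word s)) M"
    and "\<exists>R. \<forall>n. r n \<le> R"
    and "\<exists>S. \<forall>n i. 0 < i \<and> i < r n \<longrightarrow> s n ! (i - 1) \<le> S"
    and "\<forall>n c. card (occurrences (s n) (s n @ [c] @ s n)) = 2"
    and "totally_ergodic M shift"
  shows "\<forall>m\<ge>2. minimal_self_joinings m M"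
proof -
  obtain R where R: "\<And>n. r n \<le> R" using assms(6) by blast
  obtain S where S: "\<And>n i. 0 < i \<Longrightarrow> i < r n \<Longrightarrow> s n ! (i - 1) \<le> S" using assms(7) by blast
  have S': "a \<le> S" if a: "a \<in> set (s n)" for a n
  proof -
    obtain i where i: "i < length (s n)" "a = s n ! i" using a by (auto simp: in_set_conv_nth)
    have "Suc i < r n" using i(1) assms(2) unfolding spacer_parameter_def by (metis less_diff_conv Suc_eq_plus1)
    then show ?thesis using S[of "Suc i" n] i(2) by simp
  qed
  interpret rank_one_system r s R S M
    using assms R S' by unfold_locales (auto simp: unique_invariant_prob_on_def)
  show ?thesis
    unfolding minimal_self_joinings_def
  proof (intro allI impI)
    fix m N assume "ergodic_self_joining M {1..m} N"
    then interpret joining r s R S M "{1..m}" N by unfold_locales auto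
    show "\<exists>P D. partition_on {1..m} P \<and> (\<forall>C\<in>P. off_diagonal M C (D C)) \<and> N = class_product M {1..m} P D"
      by (rule product_of_off_diagonals)
  qed
qed

end
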